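(* Let $\varphi\in L^1(\mathbb R)$ have Fourier transform $\widehat{\varphi}(\xi)=\int_{\mathbb R}\varphi(t)e^{-2\pi i t\xi}\,dt$ that does not vanish anywhere and satisfies $$A e^{-2\pi|\xi|}\leq |\widehat{\varphi}(\xi)|\leq B e^{-2\pi|\xi|}\qquad(\xi\in\mathbb R)$$ for some constants $A,B>0$, and assume also that $|(\widehat{\varphi})'(\xi)|=O(e^{-2\pi|\xi|})$. Let $\Lambda\subseteq\mathbb R$ be a discrete set. Then the closed linear span in $L^1(\mathbb R)$ of the translates $\{\varphi(t-\lambda):\lambda\in\Lambda\}$ is all of $L^1(\mathbb R)$ if and only if $$\sum_{\lambda\in\Lambda}e^{-\frac{\pi}{2}|\lambda|}=\infty.$$
   Context: A family of functions in $L^p(\mathbb R)$ is said to span $L^p(\mathbb R)$ if its finite linear combinations are dense in $L^p(\mathbb R)$. *)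

theory Defs
  imports "HOL-Analysis.Analysis"
begin

definition fourier_transform :: "(real \<Rightarrow> complex) \<Rightarrow> real \<Rightarrow> complex" where
  "fourier_transform \<phi> \<xi> =
     (LINT t|lebesgue. \<phi> t * exp (- (2 * complex_of_real pi * \<i> * complex_of_real (t * \<xi>))))"

definition discrete_set :: "real set \<Rightarrow> bool" where
  "discrete_set \<Lambda> \<longleftrightarrow> (\<forall>r. finite (\<Lambda> \<inter> {-r..r}))"

definition translates_span_L1 :: "(real \<Rightarrow> complex) \<Rightarrow> real set \<Rightarrow> bool" where
  "translates_span_L1 \<phi> \<Lambda> \<longleftrightarrow>
     (\<forall>f :: real \<Rightarrow> complex. integrable lebesgue f \<longrightarrow>
        (\<forall>\<epsilon>>0. \<exists>F c. finite F \<and> F \<subseteq> \<Lambda> \<and>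
           (LINT t|lebesgue. norm (f t - (\<Sum>l\<in>F. c l * \<phi> (t - l)))) < \<epsilon>))"

end

theory Submission
  imports Defs "HOL-Complex_Analysis.Complex_Analysis" "HOL-Probability.Probability"
begin

text \<open>
  Suppose that the series converges, let \<open>x \<notin> \<Lambda>\<close> and let \<open>\<mu> = \<delta>\<^sub>x - \<Sum> c\<^sub>l \<delta>\<^sub>l\<close> be such that
  \<open>\<phi> * \<mu>\<close> is small in \<open>L\<^sup>1\<close>. Then the transform of \<open>\<mu>\<close> is at most \<open>\<eta> exp (2 pi \<bar>\<xi>\<bar>)\<close>, so its
  Cauchy transform \<open>\<Sum> \<mu>\<^sub>l / (z - l)\<close> is at most \<open>\<eta> / (\<bar>Im z\<bar> - 1)\<close> outside the strip
  \<open>\<bar>Im z\<bar> \<le> 1\<close>. Multiplying by the Blaschke product of the strip with zeros at the poles and applying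
  the maximum principle on the slightly wider region
  \<open>\<bar>Im z\<bar> < 1 + exp (- pi \<bar>Re z\<bar> / 2) / 4\<close>, where this product is still bounded, bounds the value of
  the product at \<open>x\<close> by a multiple of \<open>\<eta>\<close>, which fails for small \<open>\<eta>\<close>.

  Suppose that the series diverges. Because the transform of \<open>\<phi>\<close> is \<open>exp (- 2 pi \<bar>\<xi>\<bar>)\<close> times a
  Lipschitz factor, the \<open>L\<^sup>1\<close> norm of \<open>\<Sum> r\<^sub>l \<phi>(\<cdot> - l)\<close> is controlled by the weighted Sobolev norm
  \<open>\<integral> exp (- 4 pi \<bar>\<xi>\<bar>) (\<bar>E\<bar>\<^sup>2 + \<bar>E'\<bar>\<^sup>2)\<close> of the trigonometric sum \<open>E = \<Sum> r\<^sub>l exp (- 2 pi i l \<xi>)\<close>,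
  a quadratic form with an explicit rational kernel. The residual of the projection of one exponential on
  finitely many others gives a function that is analytic in the strip, vanishes at the chosen points of
  \<open>\<Lambda>\<close> and is bounded independently of them; a Blaschke estimate in a half-plane shows that its norm tends
  to 0. Hence all translates of \<open>\<phi>\<close> lie in the closed span, and therefore so do all convolutions with
  \<open>\<phi>\<close>; among them are all normal densities, which form an approximate identity.
\<close>

subsection \<open>Cauchy transforms of finite measures\<close>

text \<open>The exponent pi/2 is a Blaschke condition: exp(-2 pi i z xi) has modulus exp(2 pi Im z
  xi), which exp(2 pi |xi|) dominates exactly when |Im z| <= 1, and z -> exp(pi z / 2) maps that
  strip to a half-plane, where the point l contributes a Blaschke term of size exp(-pi |l| / 2). In
  the convergent case the obstacle is that the Cauchy bound blows up at the edges |Im z| = 1.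
  Widening the strip by exp(-pi |Re z| / 2) / 4 is a compromise: a factor then exceeds 1 by at most
  pi exp(-pi |l| / 2), a summable amount, and the price 4 exp(pi |Re z| / 2) is absorbed by a factor
  exp(-z^2). In the divergent case the obstacle is that L1 is not a Hilbert space. One derivative on
  the Fourier side buys the weight 1 + t^2, and Cauchy-Schwarz against 1 / (1 + t^2) then controls
  the L1 norm. The model \<phi> is the Poisson kernel 1 / (pi (1 + t^2)); its transform has a corner
  at 0, so derivatives are taken away from 0. All constants are uniform over finite subsets of
  \<Lambda>, which makes both halves direct estimates on finite sums.\<close>

lemma has_bochner_integral_exp_half_line:
  assumes "Re s > 0"
  shows "has_bochner_integral lborel (\<lambda>x. indicator {0<..} x *\<^sub>R exp (-(s * complex_of_real x))) (1 / s)"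
proof -
  have s0: "s \<noteq> 0" using assms by auto
  have ein: "einterval 0 \<infinity> = {0<..}"
    by (auto simp: einterval_def)
  have int: "set_integrable lborel {0<..} (\<lambda>x. exp (-(s * complex_of_real x)))"
    unfolding set_integrable_def
    by (rule Bochner_Integration.integrable_bound
          [OF integrable_I0i_exp_mscale[OF assms, unfolded set_integrable_def]])
       (auto split: split_indicator simp: mult.commute)
  have "(LBINT x=0..\<infinity>. exp (-(s * complex_of_real x))) = 0 - (- 1 / s)"
  proof (rule interval_integral_FTC_integrable[where F = "\<lambda>x. - exp (-(s * complex_of_real x)) / s"])
    show "((\<lambda>x. - exp (-(s * complex_of_real x)) / s) has_vector_derivative exp (-(s * complex_of_real x))) (at x)"
      for x using s0
      by (auto intro!: derivative_eq_intros has_vector_derivative_real_field simp: field_simps)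
    show "set_integrable lborel (einterval 0 \<infinity>) (\<lambda>x. exp (-(s * complex_of_real x)))"
      using int by (simp add: ein)
    show "(((\<lambda>x. - exp (- (s * complex_of_real x)) / s) \<circ> real_of_ereal) \<longlongrightarrow> - 1 / s) (at_right 0)"
      unfolding zero_ereal_def ereal_tendsto_simps
      by (rule tendsto_eq_intros refl s0 | simp)+
    have "((\<lambda>x. - exp (- (s * complex_of_real x)) / s) \<longlongrightarrow> 0) at_top"
    proof (rule tendsto_norm_zero_cancel)
      have "filterlim (\<lambda>x. Re s * x) at_top at_top"
        using assms by (intro filterlim_tendsto_pos_mult_at_top[OF tendsto_const] filterlim_ident)
      then have "((\<lambda>x. exp (- (Re s * x))) \<longlongrightarrow> 0) at_top"
        by (auto intro!: filterlim_compose[OF exp_at_bot] simp: filterlim_uminus_at_bot)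
      from tendsto_mult[OF this tendsto_const[of "1 / norm s"]]
      show "((\<lambda>x. cmod (- exp (- (s * complex_of_real x)) / s)) \<longlongrightarrow> 0) at_top"
        by (simp add: norm_divide)
    qed
    then show "(((\<lambda>x. - exp (- (s * complex_of_real x)) / s) \<circ> real_of_ereal) \<longlongrightarrow> 0) (at_left \<infinity>)"
      unfolding ereal_tendsto_simps .
  qed auto
  moreover have "(LBINT x=0..\<infinity>. exp (-(s * complex_of_real x))) = (LINT x:{0<..}|lborel. exp (-(s * complex_of_real x)))"
    by (simp add: interval_lebesgue_integral_def ein)
  ultimately show ?thesis
    using int unfolding has_bochner_integral_iff set_integrable_def set_lebesgue_integral_def by simp
qed

text \<open>Up to the factor -2 pi i sigma, 1 / (z - l) is the half-line integral of exp(2 pi i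
  sigma (z - l) x). In the half-plane selected by the sign sigma this integrand decays like exp(-2
  pi sigma Im z x), which beats the permitted growth exp(2 pi x) of the exponential sum as soon as
  sigma Im z > 1.\<close>

lemma cauchy_sum_bound_aux:
  fixes \<mu> :: "real \<Rightarrow> complex" and \<eta> \<sigma> :: real
  assumes S: "finite S" and \<sigma>: "\<bar>\<sigma>\<bar> = 1" and z: "\<sigma> * Im z > 1"
    and E: "\<And>\<xi>. norm (\<Sum>l\<in>S. \<mu> l * cis (-(2 * pi * l * \<xi>))) \<le> \<eta> * exp (2 * pi * \<bar>\<xi>\<bar>)"
  shows "norm (\<Sum>l\<in>S. \<mu> l / (z - complex_of_real l)) \<le> \<eta> / (\<sigma> * Im z - 1)"
proof -
  define s where "s l = - 2 * pi * \<i> * \<sigma> * (z - complex_of_real l)" for l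
  have Res: "Re (s l) = 2 * pi * (\<sigma> * Im z)" for l by (simp add: s_def)
  have Repos: "Re (s l) > 0" for l using z by (simp add: Res)
  have znl: "z - complex_of_real l \<noteq> 0" for l using z by auto
  define g where "g x = (\<Sum>l\<in>S. \<mu> l * (indicator {0<..} x *\<^sub>R exp (-(s l * complex_of_real x))))" for x
  have "has_bochner_integral lborel g (\<Sum>l\<in>S. \<mu> l * (1 / s l))"
    unfolding g_def
    by (intro has_bochner_integral_sum has_bochner_integral_mult_right has_bochner_integral_exp_half_line Repos)
  then have gi: "integrable lborel g" "integral\<^sup>L lborel g = (\<Sum>l\<in>S. \<mu> l * (1 / s l))"
    by (auto simp: has_bochner_integral_iff)
  have geq: "g x = indicator {0<..} x *\<^sub>R (exp (2 * pi * \<i> * \<sigma> * z * x) * (\<Sum>l\<in>S. \<mu> l * cis (-(2 * pi * l * (\<sigma> * x)))))" for x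
    unfolding g_def sum_distrib_left scaleR_sum_right
    by (intro sum.cong refl) (simp add: s_def cis_conv_exp exp_add[symmetric] algebra_simps)
  define u where "u = 2 * pi * (\<sigma> * Im z - 1)"
  have u: "u > 0" using z by (simp add: u_def)
  have hu: "has_bochner_integral lborel (\<lambda>x. indicator {0<..} x *\<^sub>R exp (-(complex_of_real u * complex_of_real x))) (1 / of_real u)"
    by (rule has_bochner_integral_exp_half_line) (simp add: u)
  have "has_bochner_integral lborel (\<lambda>x. Re (indicator {0<..} x *\<^sub>R exp (-(complex_of_real u * complex_of_real x)))) (Re (1 / of_real u))"
    using hu by (rule has_bochner_integral_Re)
  then have hu': "has_bochner_integral lborel (\<lambda>x. \<eta> * (indicator {0<..} x *\<^sub>R exp (-(u * x)))) (\<eta> * (1 / u))"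
    by (intro has_bochner_integral_mult_right) (simp add: Re_exp)
  have nb: "norm (g x) \<le> \<eta> * (indicator {0<..} x *\<^sub>R exp (-(u * x)))" for x
  proof (cases "x > 0")
    case True
    have "norm (g x) = exp (- 2 * pi * (\<sigma> * Im z) * x) * norm (\<Sum>l\<in>S. \<mu> l * cis (-(2 * pi * l * (\<sigma> * x))))"
      using True by (simp add: geq norm_mult)
    also have "\<dots> \<le> exp (- 2 * pi * (\<sigma> * Im z) * x) * (\<eta> * exp (2 * pi * \<bar>\<sigma> * x\<bar>))"
      by (intro mult_left_mono E) auto
    also have "\<bar>\<sigma> * x\<bar> = x" using True \<sigma> by (simp add: abs_mult)
    finally show ?thesis using True by (simp add: u_def algebra_simps flip: exp_add)
  qed (simp add: geq)
  have "norm (integral\<^sup>L lborel g) \<le> (\<integral>x. norm (g x) \<partial>lborel)" by simp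
  also have "\<dots> \<le> (\<integral>x. \<eta> * (indicator {0<..} x *\<^sub>R exp (-(u * x))) \<partial>lborel)"
    using hu' gi nb by (intro integral_mono) (auto simp: has_bochner_integral_iff)
  also have "\<dots> = \<eta> / u" using hu' by (simp add: has_bochner_integral_iff)
  finally have 1: "norm (\<Sum>l\<in>S. \<mu> l * (1 / s l)) \<le> \<eta> / u" by (simp add: gi)
  have "(\<Sum>l\<in>S. \<mu> l / (z - complex_of_real l)) = (- 2 * pi * \<i> * \<sigma>) * (\<Sum>l\<in>S. \<mu> l * (1 / s l))"
    unfolding sum_distrib_left
  proof (intro sum.cong refl)
    fix l
    define c where "c = - 2 * complex_of_real pi * \<i> * \<sigma>"
    have "c \<noteq> 0" using \<sigma> by (auto simp: c_def)
    moreover have "s l = c * (z - complex_of_real l)" by (simp add: s_def c_def)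
    moreover have "complex_of_real (- 2 * pi) * \<i> * \<sigma> = c" by (simp add: c_def)
    ultimately show "\<mu> l / (z - complex_of_real l) = complex_of_real (- 2 * pi) * \<i> * \<sigma> * (\<mu> l * (1 / s l))"
      by simp
  qed
  then have "norm (\<Sum>l\<in>S. \<mu> l / (z - complex_of_real l)) = 2 * pi * norm (\<Sum>l\<in>S. \<mu> l * (1 / s l))"
    using \<sigma> by (simp add: norm_mult)
  also have "\<dots> \<le> 2 * pi * (\<eta> / u)" by (intro mult_left_mono 1) auto
  also have "\<dots> = \<eta> / (\<sigma> * Im z - 1)" by (simp add: u_def)
  finally show ?thesis .
qed

lemma cauchy_sum_bound:
  fixes \<mu> :: "real \<Rightarrow> complex" and \<eta> :: real
  assumes "finite S" and "\<bar>Im z\<bar> > 1"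
    and "\<And>\<xi>. norm (\<Sum>l\<in>S. \<mu> l * cis (-(2 * pi * l * \<xi>))) \<le> \<eta> * exp (2 * pi * \<bar>\<xi>\<bar>)"
  shows "norm (\<Sum>l\<in>S. \<mu> l / (z - complex_of_real l)) \<le> \<eta> / (\<bar>Im z\<bar> - 1)"
  using cauchy_sum_bound_aux[OF assms(1), of 1 z \<mu> \<eta>] cauchy_sum_bound_aux[OF assms(1), of "-1" z \<mu> \<eta>] assms(2,3)
  by (cases "Im z > 0") auto

subsection \<open>Blaschke factors of the strip\<close>

text \<open>With X = exp(pi z / 2) and a = exp(pi l / 2) this is (X - a) / (X + a), the Blaschke
  factor of the right half-plane pulled back to |Im z| < 1. Its poles have |Im z| >= 2, so it can be
  followed across the edges of the strip.\<close>

definition strip_factor :: "real \<Rightarrow> complex \<Rightarrow> complex" where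
  "strip_factor l z =
     (exp (complex_of_real (pi / 2) * z) - exp (complex_of_real (pi / 2) * complex_of_real l)) /
     (exp (complex_of_real (pi / 2) * z) + exp (complex_of_real (pi / 2) * complex_of_real l))"

text \<open>The value pi/4 is the derivative of \<open>strip_factor l\<close> at its zero, so the
  singularity is removed. A product of factors times 1 / (z - l) can thus be written without
  poles.\<close>

definition strip_quotient :: "real \<Rightarrow> complex \<Rightarrow> complex" where
  "strip_quotient l z = (if z = complex_of_real l then complex_of_real (pi / 4) else strip_factor l z / (z - complex_of_real l))"

lemma strip_factor_denominator_nonzero:
  assumes "\<bar>Im z\<bar> < 2"
  shows "exp (complex_of_real (pi / 2) * z) + exp (complex_of_real (pi / 2) * complex_of_real l) \<noteq> 0"
proof
  assume eq: "exp (complex_of_real (pi / 2) * z) + exp (complex_of_real (pi / 2) * complex_of_real l) = 0"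
  have "Im (exp (complex_of_real (pi / 2) * z) + exp (complex_of_real (pi / 2) * complex_of_real l)) = 0"
    unfolding eq by simp
  then have "sin (pi / 2 * Im z) = 0" by (simp add: Im_exp)
  moreover have "\<bar>pi / 2 * Im z\<bar> < pi" using assms by (simp add: abs_mult)
  ultimately have "pi / 2 * Im z = 0" using sin_eq_0_pi[of "pi / 2 * Im z"] by linarith
  then have y: "Im z = 0" by simp
  have "Re (exp (complex_of_real (pi / 2) * z) + exp (complex_of_real (pi / 2) * complex_of_real l)) = 0"
    unfolding eq by simp
  then show False using y add_pos_pos[OF exp_gt_zero[of "pi * Re z / 2"] exp_gt_zero[of "pi * l / 2"]]
    by (simp add: Re_exp)
qed

lemma holomorphic_strip_factor: "strip_factor l holomorphic_on {z. \<bar>Im z\<bar> < 2}"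
  unfolding strip_factor_def
  by (intro holomorphic_intros) (use strip_factor_denominator_nonzero in auto)

lemma open_strip: "open {z. \<bar>Im z\<bar> < (r::real)}"
  by (intro open_Collect_less continuous_intros)

lemma strip_factor_self: "strip_factor l (complex_of_real l) = 0"
  by (simp add: strip_factor_def)

lemma deriv_strip_factor: "deriv (strip_factor l) (complex_of_real l) = pi / 4"
proof (rule DERIV_imp_deriv)
  have nz: "exp (complex_of_real (pi / 2) * complex_of_real l) \<noteq> 0" by simp
  show "(strip_factor l has_field_derivative complex_of_real (pi / 4)) (at (complex_of_real l))"
    unfolding strip_factor_def
    by (rule derivative_eq_intros refl | use nz in \<open>simp add: field_simps\<close>)+
qed

lemma holomorphic_strip_quotient: "strip_quotient l holomorphic_on {z. \<bar>Im z\<bar> < 2}"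
proof (rule pole_theorem_open_0[OF holomorphic_strip_factor open_strip])
  show "strip_factor l z = (z - complex_of_real l) * strip_quotient l z"
    if "z \<in> {z. \<bar>Im z\<bar> < 2} - {complex_of_real l}" for z
    using that by (simp add: strip_quotient_def)
qed (auto simp: strip_quotient_def deriv_strip_factor strip_factor_self)

text \<open>With m = |X| and c = cos(pi Im z / 2), the squares |X - a|^2 and |X + a|^2 differ by 4 a
  m c. Inside the strip c >= 0; in the added margin c >= -t with t = (pi/8) exp(-pi |x| / 2). Since
  a m / (m^2 + a^2) is at most exp(pi |x| / 2) exp(-pi |l| / 2), the dependence on x cancels and
  only the decay in l is left.\<close>

lemma norm_strip_factor_le:
  assumes y: "\<bar>Im z\<bar> \<le> 1 + exp (- (pi / 2) * \<bar>Re z\<bar>) / 4"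
  shows "norm (strip_factor l z) \<le> 1 + pi * exp (- (pi / 2) * \<bar>l\<bar>)"
proof -
  define x where "x = Re z"
  define m where "m = exp (pi / 2 * x)"
  define a where "a = exp (pi / 2 * l)"
  define c where "c = cos (pi / 2 * Im z)"
  define t where "t = pi / 8 * exp (- (pi / 2) * \<bar>x\<bar>)"
  have pos: "m > 0" "a > 0" by (auto simp: m_def a_def)
  have t0: "t > 0" by (simp add: t_def)
  have e1: "exp (- (pi / 2) * \<bar>x\<bar>) \<le> 1" by simp
  then have "t \<le> pi / 8 * 1" unfolding t_def by (intro mult_left_mono) auto
  then have t: "t \<le> 1 / 2" using pi_less_4 by simp
  have c: "c \<ge> - t"
  proof -
    define u where "u = pi / 2 * (1 - \<bar>Im z\<bar>)"
    have "c = cos (\<bar>pi / 2 * Im z\<bar>)" unfolding c_def by (simp only: cos_abs_real)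
    also have "\<bar>pi / 2 * Im z\<bar> = pi / 2 - u" by (simp add: u_def abs_mult field_simps)
    also have "cos (pi / 2 - u) = sin u" by (simp add: cos_diff)
    finally have cu: "c = sin u" .
    have "pi / 2 * (1 - \<bar>Im z\<bar>) \<ge> pi / 2 * (- exp (- (pi / 2) * \<bar>x\<bar>) / 4)"
      using y by (intro mult_left_mono) (auto simp: x_def)
    then have ut: "u \<ge> - t" by (simp add: u_def t_def)
    show ?thesis
    proof (cases "u \<ge> 0")
      case True
      have "pi / 2 * (1 - \<bar>Im z\<bar>) \<le> pi / 2 * 1" by (intro mult_left_mono) auto
      then have "u \<le> pi / 2" by (simp add: u_def)
      then have "sin u \<ge> 0" using True by (intro sin_ge_zero) auto
      then show ?thesis using cu t0 by simp
    next
      case False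
      then have "sin (- u) \<le> - u" by (intro sin_x_le_x) auto
      then show ?thesis using cu ut by simp
    qed
  qed
  define X where "X = exp (complex_of_real (pi / 2) * z)"
  have ReX: "Re X = m * c" and ImX: "Im X = m * sin (pi / 2 * Im z)"
    by (auto simp: X_def m_def c_def x_def Re_exp Im_exp)
  have X2: "(Re X)\<^sup>2 + (Im X)\<^sup>2 = m\<^sup>2"
  proof -
    have "(Re X)\<^sup>2 + (Im X)\<^sup>2 = m\<^sup>2 * ((sin (pi / 2 * Im z))\<^sup>2 + (cos (pi / 2 * Im z))\<^sup>2)"
      unfolding ReX ImX c_def power_mult_distrib by (simp only: distrib_left add.commute)
    then show ?thesis by (simp only: sin_cos_squared_add mult_1_right)
  qed
  have P: "(norm (X + of_real a))\<^sup>2 = m\<^sup>2 + a\<^sup>2 + 2 * (a * m * c)"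
    unfolding cmod_power2 using X2 by (simp add: ReX power2_eq_square algebra_simps)
  have N: "(norm (X - of_real a))\<^sup>2 = m\<^sup>2 + a\<^sup>2 - 2 * (a * m * c)"
    unfolding cmod_power2 using X2 by (simp add: ReX power2_eq_square algebra_simps)
  have amc: "a * m * c \<ge> - (a * m * t)" using mult_left_mono[OF c, of "a * m"] pos by simp
  have "a * m * t \<le> (a * m) / 2" using mult_left_mono[OF t, of "a * m"] pos by simp
  have "2 * (a * m) \<le> m\<^sup>2 + a\<^sup>2" using sum_squares_bound[of a m] by (simp add: algebra_simps)
  \<comment> \<open>Here t <= 1/2 keeps the denominator away from 0: 2 a m c >= -a m >= -(m^2 + a^2)
    / 2.\<close>
  have Pge: "(norm (X + of_real a))\<^sup>2 \<ge> (m\<^sup>2 + a\<^sup>2) / 2"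
  proof -
    have "p * 2 \<le> q \<Longrightarrow> r \<le> p / 2 \<Longrightarrow> - r \<le> s \<Longrightarrow> q / 2 \<le> q + 2 * s" for p q r s :: real
      by linarith
    from this[of "a * m" "m\<^sup>2 + a\<^sup>2" "a * m * t" "a * m * c"] show ?thesis
      unfolding P using \<open>a * m * t \<le> _\<close> \<open>2 * (a * m) \<le> _\<close> amc by (simp only: mult.commute[of _ 2] simp_thms)
  qed
  have s0: "m\<^sup>2 + a\<^sup>2 > 0" using pos by (simp add: add_pos_pos)
  define w where "w = exp (- (pi / 2) * \<bar>l\<bar>)"
  have amw: "8 * t * (a * m) \<le> pi * w * (m\<^sup>2 + a\<^sup>2)"
  proof -
    \<comment> \<open>One of the ratios m / a (for l >= 0) and a / m (for l < 0) is at most exp(pi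
      |x| / 2) w.\<close>
    have "a \<le> m * exp (pi / 2 * \<bar>x\<bar>) * w \<or> m \<le> a * exp (pi / 2 * \<bar>x\<bar>) * w"
    proof (cases "l \<ge> 0")
      case True
      then have "m \<le> a * exp (pi / 2 * \<bar>x\<bar>) * w"
        unfolding m_def a_def w_def by (simp flip: exp_add)
      then show ?thesis ..
    next
      case False
      have "pi * l \<le> pi * x + pi * \<bar>x\<bar> + pi * l"
        using pi_gt_zero by (cases "x \<ge> 0") (auto simp: algebra_simps)
      then have "a \<le> m * exp (pi / 2 * \<bar>x\<bar>) * w"
        unfolding m_def a_def w_def using False by (simp add: field_simps flip: exp_add)
      then show ?thesis ..
    qed
    then have "a * m \<le> exp (pi / 2 * \<bar>x\<bar>) * w * (m\<^sup>2 + a\<^sup>2)"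
    proof
      assume "a \<le> m * exp (pi / 2 * \<bar>x\<bar>) * w"
      then have "a * m \<le> m * exp (pi / 2 * \<bar>x\<bar>) * w * m" using pos by (intro mult_right_mono) auto
      also have "\<dots> \<le> exp (pi / 2 * \<bar>x\<bar>) * w * (m\<^sup>2 + a\<^sup>2)"
        using pos by (simp add: w_def power2_eq_square algebra_simps)
      finally show ?thesis .
    next
      assume "m \<le> a * exp (pi / 2 * \<bar>x\<bar>) * w"
      then have "m * a \<le> a * exp (pi / 2 * \<bar>x\<bar>) * w * a" using pos by (intro mult_right_mono) auto
      also have "\<dots> \<le> exp (pi / 2 * \<bar>x\<bar>) * w * (m\<^sup>2 + a\<^sup>2)"
        using pos by (simp add: w_def power2_eq_square algebra_simps)
      finally show ?thesis by (simp add: mult.commute)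
    qed
    then have "8 * t * (a * m) \<le> 8 * t * (exp (pi / 2 * \<bar>x\<bar>) * w * (m\<^sup>2 + a\<^sup>2))"
      using t0 by (intro mult_left_mono) auto
    also have "\<dots> = pi * (exp (- (pi / 2) * \<bar>x\<bar>) * exp (pi / 2 * \<bar>x\<bar>)) * w * (m\<^sup>2 + a\<^sup>2)"
      by (simp add: t_def)
    also have "exp (- (pi / 2) * \<bar>x\<bar>) * exp (pi / 2 * \<bar>x\<bar>) = 1" by (simp flip: exp_add)
    finally show ?thesis by simp
  qed
  have w0: "w > 0" by (simp add: w_def)
  have "(norm (X - of_real a))\<^sup>2 = (norm (X + of_real a))\<^sup>2 - 4 * (a * m * c)"
    by (simp add: P N)
  also have "\<dots> \<le> (norm (X + of_real a))\<^sup>2 + 4 * (a * m * t)" using amc by (intro diff_le_eq[THEN iffD2]) argo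
  also have "\<dots> \<le> (norm (X + of_real a))\<^sup>2 + pi * w * ((m\<^sup>2 + a\<^sup>2) / 2)" using amw by (simp add: field_simps)
  also have "\<dots> \<le> (norm (X + of_real a))\<^sup>2 + pi * w * (norm (X + of_real a))\<^sup>2"
    using Pge w0 by (intro add_left_mono mult_left_mono) auto
  also have "\<dots> \<le> ((1 + pi * w) * norm (X + of_real a))\<^sup>2"
  proof -
    have "1 + pi * w \<le> (1 + pi * w)\<^sup>2" using w0 by (simp add: power2_eq_square algebra_simps)
    then have "(1 + pi * w) * (norm (X + of_real a))\<^sup>2 \<le> (1 + pi * w)\<^sup>2 * (norm (X + of_real a))\<^sup>2"
      by (rule mult_right_mono) simp
    then show ?thesis unfolding power_mult_distrib by (simp add: distrib_right)
  qed
  finally have "norm (X - of_real a) \<le> (1 + pi * w) * norm (X + of_real a)"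
    by (rule power2_le_imp_le) (use w0 in simp)
  moreover have "norm (X + of_real a) > 0"
  proof -
    have "(norm (X + of_real a))\<^sup>2 > 0" by (rule less_le_trans[OF half_gt_zero[OF s0] Pge])
    then show ?thesis by simp
  qed
  moreover have "strip_factor l z = (X - of_real a) / (X + of_real a)"
    by (simp add: strip_factor_def X_def a_def exp_of_real[symmetric])
  ultimately show ?thesis by (simp add: norm_divide pos_divide_le_eq w_def)
qed

lemma prod_norm_strip_factor_le:
  assumes "finite S" and y: "\<bar>Im z\<bar> \<le> 1 + exp (- (pi / 2) * \<bar>Re z\<bar>) / 4"
    and W: "(\<Sum>l\<in>S. exp (- (pi / 2) * \<bar>l\<bar>)) \<le> W"
  shows "(\<Prod>l\<in>S. norm (strip_factor l z)) \<le> exp (pi * W)"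
proof -
  have "(\<Prod>l\<in>S. norm (strip_factor l z)) \<le> (\<Prod>l\<in>S. exp (pi * exp (- (pi / 2) * \<bar>l\<bar>)))"
    by (intro prod_mono conjI order_trans[OF norm_strip_factor_le[OF y]] exp_ge_add_one_self) auto
  also have "\<dots> = exp (pi * (\<Sum>l\<in>S. exp (- (pi / 2) * \<bar>l\<bar>)))"
    by (simp add: exp_sum assms(1) sum_distrib_left)
  also have "\<dots> \<le> exp (pi * W)" using W by simp
  finally show ?thesis .
qed

text \<open>The modulus of exp(-z^2) absorbs the loss exp(pi |Re z| / 2) on the widened edges:
  completing the square leaves (pi/4)^2 <= 1, and y^2 <= 25/16 <= 2.\<close>

lemma exp_quadratic_bound:
  fixes x y :: real
  assumes "\<bar>y\<bar> \<le> 5/4"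
  shows "exp (pi / 2 * \<bar>x\<bar>) * exp (y\<^sup>2 - x\<^sup>2) \<le> exp 3"
proof -
  have "0 \<le> (\<bar>x\<bar> - pi / 4)\<^sup>2" by simp
  then have 1: "pi / 2 * \<bar>x\<bar> - x\<^sup>2 \<le> (pi / 4)\<^sup>2" by (simp add: power2_eq_square algebra_simps)
  have "(pi / 4)\<^sup>2 \<le> 1\<^sup>2" using pi_less_4 by (intro power_mono) auto
  moreover have "y\<^sup>2 \<le> (5/4)\<^sup>2" using power_mono[OF assms, of 2] by simp
  moreover have "(5/4)\<^sup>2 \<le> (2::real)" by (simp add: power2_eq_square)
  ultimately show ?thesis using 1 by (simp flip: exp_add)
qed

text \<open>The maximum principle is applied to Cauchy transform times Blaschke product times
  exp(-z^2). At \<open>x0\<close> only the term of the pole \<open>x0\<close> survives, with value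
  pi/4 times the remaining factors. On the curved edges the Cauchy bound is \<eta> divided by the
  margin; on the vertical sides, where \<eta> gives nothing, the Gaussian decay of exp(-z^2) takes
  over.\<close>

lemma strip_extremal_bound:
  fixes \<mu> :: "real \<Rightarrow> complex" and \<eta> W :: real
  assumes S: "finite S" and x0: "x0 \<in> S" "\<mu> x0 = 1" and \<eta>: "\<eta> > 0"
    and W: "(\<Sum>l\<in>S. exp (- (pi / 2) * \<bar>l\<bar>)) \<le> W"
    and E: "\<And>\<xi>. norm (\<Sum>l\<in>S. \<mu> l * cis (-(2 * pi * l * \<xi>))) \<le> \<eta> * exp (2 * pi * \<bar>\<xi>\<bar>)"
  shows "pi / 4 * (\<Prod>l\<in>S - {x0}. norm (strip_factor l x0)) * exp (- x0\<^sup>2) \<le> 4 * exp (3 + pi * W) * \<eta>"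
proof -
  define K where "K = exp (pi * W)"
  \<comment> \<open>\<open>R\<close> is \<open>M\<close> times the whole product with each pole
    cancelled by its own factor. It is holomorphic also at the points of \<open>S\<close>, where
    \<open>M\<close> only has the default value of a division by 0 in one summand.\<close>
  define R where "R z = (\<Sum>l\<in>S. \<mu> l * strip_quotient l z * (\<Prod>k\<in>S - {l}. strip_factor k z))" for z
  define M where "M z = (\<Sum>l\<in>S. \<mu> l / (z - complex_of_real l))" for z
  define Q where "Q z = R z * exp (- (z\<^sup>2))" for z
  have K0: "K > 0" by (simp add: K_def)
  have holR: "R holomorphic_on {z. \<bar>Im z\<bar> < 2}"
    unfolding R_def by (intro holomorphic_intros holomorphic_strip_factor holomorphic_strip_quotient)
  then have holQ: "Q holomorphic_on {z. \<bar>Im z\<bar> < 2}"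
    unfolding Q_def by (intro holomorphic_intros)
  have RM: "R z = M z * (\<Prod>l\<in>S. strip_factor l z)" if "z \<notin> complex_of_real ` S" for z
    unfolding R_def M_def sum_distrib_right
  proof (intro sum.cong refl)
    fix l assume l: "l \<in> S"
    then have "z \<noteq> l" using that by auto
    then show "\<mu> l * strip_quotient l z * (\<Prod>k\<in>S - {l}. strip_factor k z) =
        \<mu> l / (z - complex_of_real l) * (\<Prod>l\<in>S. strip_factor l z)"
      using S l by (simp add: strip_quotient_def prod.remove)
  qed
  have Rx0: "R x0 = pi / 4 * (\<Prod>k\<in>S - {x0}. strip_factor k x0)"
  proof -
    have "R x0 = (\<Sum>l\<in>S. if l = x0 then pi / 4 * (\<Prod>k\<in>S - {x0}. strip_factor k x0) else 0)"
      unfolding R_def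
    proof (intro sum.cong refl)
      fix l assume l: "l \<in> S"
      show "\<mu> l * strip_quotient l x0 * (\<Prod>k\<in>S - {l}. strip_factor k x0) =
        (if l = x0 then pi / 4 * (\<Prod>k\<in>S - {x0}. strip_factor k x0) else 0)"
      proof (cases "l = x0")
        case False
        then have "(\<Prod>k\<in>S - {l}. strip_factor k x0) = 0"
          using S x0(1) strip_factor_self by (intro prod_zero) auto
        then show ?thesis using False by simp
      qed (simp add: x0 strip_quotient_def)
    qed
    then show ?thesis using S x0 by simp
  qed
  have nQ: "norm (Q z) = norm (R z) * exp ((Im z)\<^sup>2 - (Re z)\<^sup>2)" for z
    by (simp add: Q_def norm_mult power2_eq_square)
  define L where "L = Max ((\<lambda>l. \<bar>l\<bar>) ` S)"
  have L: "\<bar>l\<bar> \<le> L" if "l \<in> S" for l unfolding L_def using S that by (intro Max_ge) auto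
  define G where "G = (\<Sum>l\<in>S. norm (\<mu> l))"
  \<comment> \<open>The width \<open>T\<close> is chosen last, depending on \<mu> and
    \<open>S\<close>: beyond it all poles are at distance at least 1 and the crude bound
    \<open>G * K * exp (2 - T\<^sup>2)\<close> is below the target.\<close>
  have "((\<lambda>T::real. exp (2 - T\<^sup>2)) \<longlongrightarrow> 0) at_top" by real_asymp
  then have "((\<lambda>T::real. G * K * exp (2 - T\<^sup>2)) \<longlongrightarrow> 0) at_top" by (rule tendsto_mult_right_zero)
  then have "eventually (\<lambda>T. G * K * exp (2 - T\<^sup>2) < 4 * exp (3 + pi * W) * \<eta>) at_top"
    using \<eta> by (intro order_tendstoD(2)) auto
  moreover have "eventually (\<lambda>T. T > L + 1) at_top" by (rule eventually_gt_at_top)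
  ultimately have "eventually (\<lambda>T. G * K * exp (2 - T\<^sup>2) < 4 * exp (3 + pi * W) * \<eta> \<and> T > L + 1) at_top"
    by (rule eventually_conj)
  then obtain T where T: "G * K * exp (2 - T\<^sup>2) < 4 * exp (3 + pi * W) * \<eta>" "T > L + 1"
    using eventually_happens'[OF trivial_limit_at_top_linorder] by blast
  define \<delta> :: "real \<Rightarrow> real" where "\<delta> x = exp (- (pi / 2) * \<bar>x\<bar>) / 4" for x
  have \<delta>: "\<delta> x > 0" "\<delta> x \<le> 1/4" for x by (auto simp: \<delta>_def)
  \<comment> \<open>The region is truncated to be bounded. Its closure lies in \<open>D'\<close>,
    hence in |Im z| <= 5/4, well inside the domain |Im z| < 2 of the factors.\<close>
  define D where "D = {z. \<bar>Im z\<bar> < 1 + \<delta> (Re z)} \<inter> {z. \<bar>Re z\<bar> < T}"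
  define D' where "D' = {z. \<bar>Im z\<bar> \<le> 1 + \<delta> (Re z)} \<inter> {z. \<bar>Re z\<bar> \<le> T}"
  have opD: "open D" unfolding D_def \<delta>_def
    by (intro open_Int open_Collect_less continuous_intros) auto
  have clD': "closed D'" unfolding D'_def \<delta>_def
    by (intro closed_Int closed_Collect_le continuous_intros) auto
  have DD': "D \<subseteq> D'" by (auto simp: D_def D'_def)
  then have clos: "closure D \<subseteq> D'" using clD' by (rule closure_minimal)
  have D'2: "D' \<subseteq> {z. \<bar>Im z\<bar> < 2}"
  proof
    fix z assume "z \<in> D'"
    then show "z \<in> {z. \<bar>Im z\<bar> < 2}" using \<delta>(2)[of "Re z"] by (auto simp: D'_def)
  qed
  have bD: "bounded D"
  proof (rule boundedI)
    fix z assume "z \<in> D"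
    then have "\<bar>Re z\<bar> < T" "\<bar>Im z\<bar> < 2" using DD' D'2 by (auto simp: D_def)
    then show "norm z \<le> T + 2" using cmod_le[of z] by linarith
  qed
  have x0T: "\<bar>x0\<bar> < T" using L[OF x0(1)] T(2) by simp
  then have x0D: "complex_of_real x0 \<in> D" using \<delta>(1)[of x0] by (simp add: D_def)
  have "norm (Q x0) \<le> 4 * exp (3 + pi * W) * \<eta>"
  proof (rule maximum_modulus_frontier[OF _ _ bD _ x0D])
    show "Q holomorphic_on interior D"
      using opD DD' D'2 holQ by (simp add: interior_open) (meson holomorphic_on_subset order_trans)
    show "continuous_on (closure D) Q"
      using holomorphic_on_imp_continuous_on[OF holQ] clos D'2 by (meson continuous_on_subset order_trans)
    fix z assume "z \<in> frontier D"
    then have zD': "z \<in> D'" and zD: "z \<notin> D"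
      using clos opD by (auto simp: frontier_def interior_open)
    have yle: "\<bar>Im z\<bar> \<le> 1 + exp (- (pi / 2) * \<bar>Re z\<bar>) / 4" using zD' by (simp add: D'_def \<delta>_def)
    have y54: "\<bar>Im z\<bar> \<le> 5/4" using yle \<delta>(2)[of "Re z"] unfolding \<delta>_def by linarith
    have pr: "norm (\<Prod>l\<in>S. strip_factor l z) \<le> K"
      using prod_norm_strip_factor_le[OF S yle W] by (simp only: prod_norm K_def)
    show "norm (Q z) \<le> 4 * exp (3 + pi * W) * \<eta>"
    proof (cases "\<bar>Re z\<bar> < T")
      case True
      then have y: "\<bar>Im z\<bar> = 1 + \<delta> (Re z)" using zD zD' by (auto simp: D_def D'_def)
      then have y1: "\<bar>Im z\<bar> > 1" using \<delta> by simp
      have zS: "z \<notin> complex_of_real ` S" using y1 by auto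
      have "norm (M z) \<le> \<eta> / \<delta> (Re z)"
        using cauchy_sum_bound[OF S y1 E] y unfolding M_def by simp
      then have "norm (R z) \<le> \<eta> / \<delta> (Re z) * K"
        unfolding RM[OF zS] norm_mult using pr \<eta> \<delta>[of "Re z"]
        by (intro mult_mono) auto
      also have "\<dots> = 4 * K * \<eta> * exp (pi / 2 * \<bar>Re z\<bar>)"
        by (simp add: \<delta>_def exp_minus field_simps)
      finally have "norm (Q z) \<le> 4 * K * \<eta> * exp (pi / 2 * \<bar>Re z\<bar>) * exp ((Im z)\<^sup>2 - (Re z)\<^sup>2)"
        unfolding nQ by (intro mult_right_mono) auto
      also have "\<dots> = 4 * K * \<eta> * (exp (pi / 2 * \<bar>Re z\<bar>) * exp ((Im z)\<^sup>2 - (Re z)\<^sup>2))" by simp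
      also have "\<dots> \<le> 4 * K * \<eta> * exp 3"
        using K0 \<eta> by (intro mult_left_mono exp_quadratic_bound y54) auto
      also have "\<dots> = 4 * exp (3 + pi * W) * \<eta>" by (simp add: K_def exp_add)
      finally show ?thesis .
    next
      case False
      then have x: "\<bar>Re z\<bar> = T" using zD' by (auto simp: D'_def)
      have dist: "norm (z - complex_of_real l) \<ge> 1" if "l \<in> S" for l
      proof -
        have "1 \<le> \<bar>Re (z - complex_of_real l)\<bar>" using L[OF that] x T(2) by auto
        also have "\<dots> \<le> norm (z - complex_of_real l)" by (rule abs_Re_le_cmod)
        finally show ?thesis .
      qed
      have zS: "z \<notin> complex_of_real ` S" using dist by fastforce
      have "norm (M z) \<le> (\<Sum>l\<in>S. norm (\<mu> l / (z - complex_of_real l)))"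
        unfolding M_def by (rule norm_sum)
      also have "\<dots> \<le> G" unfolding G_def
      proof (rule sum_mono)
        fix l assume "l \<in> S"
        then show "norm (\<mu> l / (z - complex_of_real l)) \<le> norm (\<mu> l)"
          using dist[of l] mult_left_mono[OF dist[of l], of "norm (\<mu> l)"]
          by (auto simp: norm_divide intro!: divide_le_eq[THEN iffD2])
      qed
      finally have "norm (R z) \<le> G * K"
        unfolding RM[OF zS] norm_mult using pr by (intro mult_mono) (auto simp: G_def sum_nonneg)
      moreover have "exp ((Im z)\<^sup>2 - (Re z)\<^sup>2) \<le> exp (2 - T\<^sup>2)"
      proof -
        have "(Re z)\<^sup>2 = T\<^sup>2" using x by (metis power2_abs)
        moreover have "(Im z)\<^sup>2 \<le> (5/4)\<^sup>2" using power_mono[OF y54, of 2] by simp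
        moreover have "(5/4)\<^sup>2 \<le> (2::real)" by (simp add: power2_eq_square)
        ultimately show ?thesis by simp
      qed
      ultimately have "norm (Q z) \<le> G * K * exp (2 - T\<^sup>2)"
        unfolding nQ by (intro mult_mono) (auto simp: G_def K_def sum_nonneg)
      then show ?thesis using T(1) by simp
    qed
  qed
  moreover have "norm (Q x0) = pi / 4 * (\<Prod>l\<in>S - {x0}. norm (strip_factor l x0)) * exp (- x0\<^sup>2)"
    unfolding nQ Rx0 by (simp add: norm_mult prod_norm)
  ultimately show ?thesis by simp
qed

section \<open>Blaschke factors at real points\<close>

lemma norm_strip_factor_real:
  "norm (strip_factor l (complex_of_real x)) =
     \<bar>exp (pi / 2 * x) - exp (pi / 2 * l)\<bar> / (exp (pi / 2 * x) + exp (pi / 2 * l))"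
proof -
  have "strip_factor l x = complex_of_real ((exp (pi / 2 * x) - exp (pi / 2 * l)) / (exp (pi / 2 * x) + exp (pi / 2 * l)))"
    by (simp add: strip_factor_def exp_of_real[symmetric])
  then have "norm (strip_factor l x) = \<bar>(exp (pi / 2 * x) - exp (pi / 2 * l)) / (exp (pi / 2 * x) + exp (pi / 2 * l))\<bar>"
    by (simp only: norm_of_real)
  then show ?thesis
    using add_pos_pos[OF exp_gt_zero[of "pi / 2 * x"] exp_gt_zero[of "pi / 2 * l"]]
    by (simp only: abs_divide abs_of_pos)
qed

text \<open>The defect equals 2 min(m, a) / (m + a), hence is at most twice either ratio of m =
  exp(pi x / 2) and a = exp(pi l / 2). Summability of the weights is therefore the Blaschke
  condition at x.\<close>

lemma norm_strip_factor_real_ge: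
  "1 - norm (strip_factor l (complex_of_real x)) \<le> 2 * exp (pi / 2 * \<bar>x\<bar>) * exp (- (pi / 2) * \<bar>l\<bar>)"
proof -
  define m where "m = exp (pi / 2 * x)"
  define a where "a = exp (pi / 2 * l)"
  have pos: "m > 0" "a > 0" by (auto simp: m_def a_def)
  have n: "norm (strip_factor l x) = \<bar>m - a\<bar> / (m + a)"
    unfolding m_def a_def by (rule norm_strip_factor_real)
  have E0: "1 - norm (strip_factor l x) = 2 * min m a / (m + a)"
    unfolding n using pos add_pos_pos[OF pos] by (auto simp: field_simps)
  have "2 * min m a / (m + a) \<le> 2 * a / (m + a)" "2 * min m a / (m + a) \<le> 2 * m / (m + a)"
    using pos by (auto intro!: divide_right_mono)
  moreover have "2 * a / (m + a) \<le> 2 * a / m" "2 * m / (m + a) \<le> 2 * m / a"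
    using pos by (auto intro!: divide_left_mono mult_pos_pos)
  ultimately have E: "1 - norm (strip_factor l x) \<le> 2 * a / m" "1 - norm (strip_factor l x) \<le> 2 * m / a"
    unfolding E0 by linarith+
  show ?thesis
  proof (cases "l \<ge> 0")
    case True
    have "2 * m / a = 2 * exp (pi / 2 * x - pi / 2 * l)" by (simp add: m_def a_def exp_diff)
    also have "\<dots> \<le> 2 * exp (pi / 2 * \<bar>x\<bar> + - (pi / 2) * \<bar>l\<bar>)" using True by simp
    also have "\<dots> = 2 * exp (pi / 2 * \<bar>x\<bar>) * exp (- (pi / 2) * \<bar>l\<bar>)" unfolding exp_add by simp
    finally show ?thesis using E(2) by linarith
  next
    case False
    have "pi * x \<ge> - (pi * \<bar>x\<bar>)" using pi_gt_zero by (cases "x \<ge> 0") auto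
    have "2 * a / m = 2 * exp (pi / 2 * l - pi / 2 * x)" by (simp add: m_def a_def exp_diff)
    also have "\<dots> \<le> 2 * exp (pi / 2 * \<bar>x\<bar> + - (pi / 2) * \<bar>l\<bar>)"
      using False \<open>pi * x \<ge> _\<close> by simp
    also have "\<dots> = 2 * exp (pi / 2 * \<bar>x\<bar>) * exp (- (pi / 2) * \<bar>l\<bar>)" unfolding exp_add by simp
    finally show ?thesis using E(1) by linarith
  qed
qed

lemma strip_factor_real_nonzero:
  assumes "x \<noteq> l"
  shows "strip_factor l (complex_of_real x) \<noteq> 0"
proof -
  have "norm (strip_factor l (complex_of_real x)) > 0"
    unfolding norm_strip_factor_real using assms by (intro divide_pos_pos add_pos_pos) auto
  then show ?thesis by auto
qed

lemma norm_strip_factor_real_le_1: "norm (strip_factor l (complex_of_real x)) \<le> 1"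
proof -
  have "\<bar>m - a\<bar> / (m + a) \<le> 1" if "m > 0" "a > 0" for m a :: real
    using that by (auto simp: field_simps)
  from this[OF exp_gt_zero exp_gt_zero] show ?thesis unfolding norm_strip_factor_real .
qed

lemma one_minus_ge_exp_neg_double:
  fixes t :: real
  assumes "0 \<le> t" "t \<le> 1/2"
  shows "exp (- 2 * t) \<le> 1 - t"
proof -
  have "0 \<le> t * (1 - 2 * t)" using assms by simp
  then have "1 \<le> (1 - t) * (1 + 2 * t)" by (simp add: algebra_simps)
  also have "\<dots> \<le> (1 - t) * exp (2 * t)" using assms exp_ge_add_one_self[of "2 * t"] by (intro mult_left_mono) auto
  finally show ?thesis by (simp add: exp_minus field_simps)
qed

text \<open>Discreteness leaves finitely many points with |l| <= r, whose factors are nonzero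
  because x is not in \<Lambda>. Beyond r every defect is at most 1/2, and 1 - t >= exp(-2 t) turns
  the product into the exponential of a convergent sum. Uniformity in \<open>F\<close> matters: the
  tolerance must be fixed before the approximating sum is known.\<close>

lemma strip_factor_prod_lower_bound:
  assumes disc: "discrete_set \<Lambda>" and x: "x \<notin> \<Lambda>"
    and sm: "(\<lambda>l. exp (- (pi / 2) * \<bar>l\<bar>)) summable_on \<Lambda>"
  shows "\<exists>c>0. \<forall>F. finite F \<and> F \<subseteq> \<Lambda> \<longrightarrow> c \<le> (\<Prod>l\<in>F. norm (strip_factor l (complex_of_real x)))"
proof -
  define w where "w l = exp (- (pi / 2) * \<bar>l\<bar>)" for l
  define b where "b l = norm (strip_factor l (complex_of_real x))" for l
  define C where "C = 2 * exp (pi / 2 * \<bar>x\<bar>)"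
  have C0: "C > 0" by (simp add: C_def)
  have bw: "1 - b l \<le> C * w l" for l
    unfolding b_def C_def w_def by (rule norm_strip_factor_real_ge)
  have b1: "b l \<le> 1" for l unfolding b_def by (rule norm_strip_factor_real_le_1)
  have "((\<lambda>r::real. exp (- (pi / 2) * r)) \<longlongrightarrow> 0) at_top" by real_asymp
  then have "((\<lambda>r::real. C * exp (- (pi / 2) * r)) \<longlongrightarrow> 0) at_top" by (rule tendsto_mult_right_zero)
  then have "eventually (\<lambda>r. C * exp (- (pi / 2) * r) < 1/2) at_top"
    by (intro order_tendstoD(2)) auto
  then obtain r where r: "C * exp (- (pi / 2) * r) < 1/2"
    using eventually_happens'[OF trivial_limit_at_top_linorder] by blast
  define F0 where "F0 = \<Lambda> \<inter> {-r..r}"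
  have F0: "finite F0" using disc by (auto simp: F0_def discrete_set_def)
  \<comment> \<open>All of \<open>F0\<close> is used although \<open>F\<close> may miss some of it:
    the factors are at most 1, so extra ones only lower the product.\<close>
  define c where "c = (\<Prod>l\<in>F0. b l) * exp (- 2 * C * infsum w \<Lambda>)"
  have bpos: "b l > 0" if "l \<in> \<Lambda>" for l
    unfolding b_def using strip_factor_real_nonzero[of x l] x that by auto
  have c0: "c > 0" unfolding c_def
    by (intro mult_pos_pos prod_pos) (auto intro: bpos simp: F0_def)
  moreover have "c \<le> (\<Prod>l\<in>F. b l)" if F: "finite F" "F \<subseteq> \<Lambda>" for F
  proof -
    have "(\<Prod>l\<in>F0. b l) \<le> (\<Prod>l\<in>F \<inter> F0. b l)"
    proof -
      have "(\<Prod>l\<in>F0. b l) = (\<Prod>l\<in>F \<inter> F0. b l) * (\<Prod>l\<in>F0 - F. b l)"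
        using F0 by (subst prod.Int_Diff[of F0 b F]) (auto simp: Int_commute)
      also have "\<dots> \<le> (\<Prod>l\<in>F \<inter> F0. b l) * 1"
        by (intro mult_left_mono prod_le_1 prod_nonneg) (auto simp: b1 b_def norm_strip_factor_real_le_1)
      finally show ?thesis by simp
    qed
    moreover have "exp (- 2 * C * infsum w \<Lambda>) \<le> (\<Prod>l\<in>F - F0. b l)"
    proof -
      have "(\<Sum>l\<in>F - F0. w l) \<le> infsum w \<Lambda>"
        using F sm by (intro finite_sum_le_infsum) (auto simp: w_def)
      then have "exp (- 2 * C * infsum w \<Lambda>) \<le> exp (- 2 * C * (\<Sum>l\<in>F - F0. w l))"
        using C0 by simp
      also have "\<dots> = (\<Prod>l\<in>F - F0. exp (- 2 * (C * w l)))"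
        using F by (simp add: exp_sum[symmetric] sum_distrib_left mult.assoc)
      also have "\<dots> \<le> (\<Prod>l\<in>F - F0. b l)"
      proof (intro prod_mono conjI)
        fix l assume "l \<in> F - F0"
        then have "\<bar>l\<bar> > r" using F by (auto simp: F0_def)
        then have "C * w l \<le> C * exp (- (pi / 2) * r)"
          unfolding w_def using C0 by (intro mult_left_mono) auto
        then have "C * w l \<le> 1/2" using r by linarith
        then have "exp (- 2 * (C * w l)) \<le> 1 - C * w l"
          using C0 by (intro one_minus_ge_exp_neg_double) (auto simp: w_def)
        then show "exp (- 2 * (C * w l)) \<le> b l" using bw[of l] by linarith
      qed auto
      finally show ?thesis .
    qed
    ultimately have "c \<le> (\<Prod>l\<in>F \<inter> F0. b l) * (\<Prod>l\<in>F - F0. b l)"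
      unfolding c_def by (intro mult_mono prod_nonneg) (auto simp: b_def)
    also have "\<dots> = (\<Prod>l\<in>F. b l)" using F prod.Int_Diff[of F b F0] by simp
    finally show ?thesis .
  qed
  ultimately show ?thesis unfolding b_def by blast
qed

subsection \<open>Blaschke products in a half-plane\<close>

text \<open>Schwarz's lemma transported by the Cayley map \<open>\<psi>\<close>, which sends the
  disc to the half-plane and 0 to a; its inverse is w = (zeta - a) / (zeta + a).\<close>

lemma half_plane_schwarz:
  assumes hol: "f holomorphic_on {\<zeta>. Re \<zeta> > 0}" and bd: "\<And>\<zeta>. Re \<zeta> > 0 \<Longrightarrow> norm (f \<zeta>) \<le> M"
    and a: "a > 0" "f (complex_of_real a) = 0" and M: "M > 0" and z: "Re \<zeta> > 0"
  shows "norm (f \<zeta>) * norm (\<zeta> + a) \<le> M * norm (\<zeta> - a)"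
proof -
  define \<psi> where "\<psi> w = complex_of_real a * (1 + w) / (1 - w)" for w
  have \<psi>pos: "Re (\<psi> w) > 0" if "norm w < 1" for w
  proof -
    have w1: "w \<noteq> 1" using that by auto
    then have "norm (1 - w) > 0" by simp
    have "Re ((1 + w) / (1 - w)) = (1 - (norm w)\<^sup>2) / (norm (1 - w))\<^sup>2"
      unfolding Re_divide cmod_power2 by (simp add: power2_eq_square algebra_simps)
    also have "\<dots> > 0" using that \<open>norm (1 - w) > 0\<close>
      by (intro divide_pos_pos) (auto simp: abs_square_less_1)
    finally have "Re ((1 + w) / (1 - w)) > 0" .
    then have "a * Re ((1 + w) / (1 - w)) > 0" using a by simp
    moreover have "Re (complex_of_real a * u) = a * Re u" for u by simp
    ultimately show ?thesis unfolding \<psi>_def times_divide_eq_right[symmetric] by (simp only:)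
  qed
  have hol\<psi>: "\<psi> holomorphic_on ball 0 1" unfolding \<psi>_def by (intro holomorphic_intros) auto
  define w where "w = (\<zeta> - a) / (\<zeta> + a)"
  have za: "\<zeta> + a \<noteq> 0" using z a by (auto simp: complex_eq_iff)
  have w: "norm w < 1"
  proof -
    have "(norm (\<zeta> - a))\<^sup>2 < (norm (\<zeta> + a))\<^sup>2"
      unfolding cmod_power2 using z a by (simp add: power2_eq_square algebra_simps)
    then have "norm (\<zeta> - a) < norm (\<zeta> + a)" by (rule power2_less_imp_less) simp
    then show ?thesis using za by (simp add: w_def norm_divide)
  qed
  have \<psi>w: "\<psi> w = \<zeta>"
  proof -
    have "1 + w = 2 * \<zeta> / (\<zeta> + a)" "1 - w = 2 * a / (\<zeta> + a)"
      using za by (auto simp: w_def field_simps)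
    then show ?thesis using za a by (simp add: \<psi>_def)
  qed
  \<comment> \<open>\<open>Schwarz_Lemma\<close> wants modulus strictly below 1, so f is divided by
    some M' > M and M' then decreases to M.\<close>
  have key: "norm (f \<zeta>) \<le> M' * norm w" if "M' > M" for M'
  proof -
    have M'0: "M' > 0" using that M by simp
    define g where "g w = f (\<psi> w) / M'" for w
    have "norm (g w) \<le> norm w"
    proof (rule Schwarz_Lemma(1)[OF _ _ _ w])
      have "f \<circ> \<psi> holomorphic_on ball 0 1"
        by (rule holomorphic_on_compose_gen[OF hol\<psi> hol]) (use \<psi>pos in auto)
      then show "g holomorphic_on ball 0 1"
        unfolding g_def o_def using M'0 by (intro holomorphic_intros) auto
      show "g 0 = 0" by (simp add: g_def \<psi>_def a)
      show "norm (g v) < 1" if "norm v < 1" for v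
        using bd[OF \<psi>pos[OF that]] \<open>M' > M\<close> M'0 by (simp add: g_def norm_divide)
    qed
    then show ?thesis using M'0 by (simp add: g_def \<psi>w norm_divide pos_divide_le_eq mult.commute)
  qed
  have "norm (f \<zeta>) \<le> M * norm w"
  proof (rule field_le_epsilon)
    fix e :: real assume e: "e > 0"
    have "norm (f \<zeta>) \<le> (M + e) * norm w" using e by (intro key) auto
    also have "\<dots> \<le> M * norm w + e" using w e by (simp add: distrib_right mult_left_le)
    finally show "norm (f \<zeta>) \<le> M * norm w + e" .
  qed
  then show ?thesis using za by (simp add: w_def norm_divide field_simps)
qed

text \<open>Blaschke factors are divided out one at a time. By Schwarz the quotient \<open>g\<close>
  keeps the bound M, and it keeps the other zeros, so the induction hypothesis applies to
  \<open>g\<close> in place of \<open>f\<close>.\<close>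

lemma half_plane_blaschke_bound:
  assumes "finite Z" and "Z \<subseteq> {0<..}" and "f holomorphic_on {\<zeta>. Re \<zeta> > 0}"
    and "\<And>\<zeta>. Re \<zeta> > 0 \<Longrightarrow> norm (f \<zeta>) \<le> M" and M: "M > 0" and "\<And>a. a \<in> Z \<Longrightarrow> f (complex_of_real a) = 0"
    and "Re \<zeta> > 0"
  shows "norm (f \<zeta>) \<le> M * (\<Prod>a\<in>Z. norm (\<zeta> - complex_of_real a) / norm (\<zeta> + complex_of_real a))"
  using assms(1-4,6-7)
proof (induction Z arbitrary: f \<zeta> rule: finite_induct)
  case (insert a Z)
  have a: "a > 0" using insert.prems by auto
  define H where "H = {\<zeta>::complex. Re \<zeta> > 0}"
  have opH: "open H" unfolding H_def by (intro open_Collect_less continuous_intros)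
  have holf: "f holomorphic_on H" using insert.prems by (simp add: H_def)
  define h where "h \<zeta> = (if \<zeta> = complex_of_real a then deriv f a else f \<zeta> / (\<zeta> - a))" for \<zeta>
  have holh: "h holomorphic_on H"
    by (rule pole_theorem_open_0[OF holf opH]) (use insert.prems in \<open>auto simp: h_def\<close>)
  define g where "g \<zeta> = h \<zeta> * (\<zeta> + a)" for \<zeta>
  have holg: "g holomorphic_on H" unfolding g_def by (intro holomorphic_intros holh)
  have fg: "f \<zeta> * (\<zeta> + a) = g \<zeta> * (\<zeta> - a)" if "Re \<zeta> > 0" for \<zeta>
    using insert.prems by (auto simp: g_def h_def)
  have gM0: "norm (g \<zeta>) \<le> M" if "Re \<zeta> > 0" "\<zeta> \<noteq> a" for \<zeta>
  proof -
    have "norm (f \<zeta>) * norm (\<zeta> + a) \<le> M * norm (\<zeta> - a)"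
      by (rule half_plane_schwarz[OF _ _ a _ M that(1)]) (use insert.prems in auto)
    then have "norm (g \<zeta>) * norm (\<zeta> - a) \<le> M * norm (\<zeta> - a)"
      using fg[OF that(1)] by (metis norm_mult)
    then show ?thesis using that by simp
  qed
  \<comment> \<open>At a itself the Schwarz inequality reads 0 <= 0, so the bound there comes from
    continuity.\<close>
  have gM: "norm (g \<zeta>) \<le> M" if z: "Re \<zeta> > 0" for \<zeta>
  proof (cases "\<zeta> = a")
    case True
    have "isCont g \<zeta>"
      using holomorphic_on_imp_continuous_on[OF holg] opH z by (simp add: continuous_on_eq_continuous_at H_def)
    then have lim: "((\<lambda>z. norm (g z)) \<longlongrightarrow> norm (g \<zeta>)) (at \<zeta>)"
      by (intro tendsto_norm) (simp add: isCont_def)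
    have "eventually (\<lambda>z. z \<in> H) (nhds \<zeta>)" using opH z by (intro eventually_nhds_in_open) (auto simp: H_def)
    then have "eventually (\<lambda>z. norm (g z) \<le> M) (at \<zeta>)"
      unfolding eventually_at_filter by eventually_elim (use gM0 True in \<open>auto simp: H_def\<close>)
    then show ?thesis using tendsto_upperbound[OF lim] by simp
  qed (use gM0 that in auto)
  have "norm (g \<zeta>) \<le> M * (\<Prod>a\<in>Z. norm (\<zeta> - complex_of_real a) / norm (\<zeta> + complex_of_real a))"
  proof (rule insert.IH)
    show "g holomorphic_on {\<zeta>. Re \<zeta> > 0}" using holg by (simp add: H_def)
    fix b assume b: "b \<in> Z"
    then have "b \<noteq> a" "b > 0" "f b = 0" using insert by auto
    then show "g b = 0" using fg[of b] by simp
  qed (use gM insert.prems in auto)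
  then have "norm (g \<zeta>) * (norm (\<zeta> - a) / norm (\<zeta> + a)) \<le>
      M * (\<Prod>a\<in>Z. norm (\<zeta> - complex_of_real a) / norm (\<zeta> + complex_of_real a)) * (norm (\<zeta> - a) / norm (\<zeta> + a))"
    by (rule mult_right_mono) simp
  moreover have "norm (f \<zeta>) = norm (g \<zeta>) * (norm (\<zeta> - a) / norm (\<zeta> + a))"
  proof -
    have "\<zeta> + a \<noteq> 0" using insert.prems a by (auto simp: complex_eq_iff)
    moreover have "norm (f \<zeta>) * norm (\<zeta> + a) = norm (g \<zeta>) * norm (\<zeta> - a)"
      using fg[of \<zeta>] insert.prems by (metis norm_mult)
    ultimately show ?thesis by (simp add: field_simps)
  qed
  ultimately show ?case using insert.hyps by (simp add: mult_ac)
qed auto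

subsection \<open>The Sobolev form on trigonometric sums\<close>

text \<open>Splitting at 0 gives two half-line integrals with exponents s1, s2 = 4 pi +- 2 pi i w;
  both converge exactly when |Im w| < 2, and 1/s1 + 1/s2 is the stated value.\<close>

lemma has_bochner_integral_laplace_kernel:
  assumes "\<bar>Im w\<bar> < 2"
  shows "has_bochner_integral lborel
     (\<lambda>\<xi>. exp (- (4 * pi * \<bar>\<xi>\<bar>)) * exp (- (2 * pi * \<i> * w * complex_of_real \<xi>))) (2 / complex_of_real pi / (4 + w\<^sup>2))"
proof -
  define s1 where "s1 = 4 * pi + 2 * pi * \<i> * w"
  define s2 where "s2 = 4 * pi - 2 * pi * \<i> * w"
  have pos: "Re s1 > 0" "Re s2 > 0"
  proof -
    have "Im w < 2" "- Im w < 2" using assms by linarith+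
    from this[THEN mult_strict_left_mono[OF _ pi_gt_zero]] show "Re s1 > 0" "Re s2 > 0" by (auto simp: s1_def s2_def)
  qed
  have h1: "has_bochner_integral lborel (\<lambda>x. indicator {0<..} x *\<^sub>R exp (-(s1 * complex_of_real x))) (1 / s1)"
    by (rule has_bochner_integral_exp_half_line[OF pos(1)])
  \<comment> \<open>The negative half-line is the reflection of the positive one, written as
    \<open>0 + (-1) * x\<close> to match the affine substitution rule.\<close>
  have h2: "has_bochner_integral lborel (\<lambda>x. indicator {0<..} (0 + (-1) * x) *\<^sub>R exp (-(s2 * complex_of_real (0 + (-1) * x)))) ((1 / s2) /\<^sub>R \<bar>-1\<bar>)"
    by (subst lborel_has_bochner_integral_real_affine_iff[symmetric])
       (auto intro: has_bochner_integral_exp_half_line[OF pos(2)])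
  have "has_bochner_integral lborel (\<lambda>x. indicator {0<..} x *\<^sub>R exp (-(s1 * complex_of_real x))
      + indicator {0<..} (0 + (-1) * x) *\<^sub>R exp (-(s2 * complex_of_real (0 + (-1) * x))))
      (1 / s1 + (1 / s2) /\<^sub>R \<bar>-1\<bar>)"
    by (rule has_bochner_integral_add[OF h1 h2])
  moreover have "1 / s1 + (1 / s2) /\<^sub>R \<bar>-1\<bar> = 2 / complex_of_real pi / (4 + w\<^sup>2)"
  proof -
    have "s1 \<noteq> 0" "s2 \<noteq> 0" using pos by auto
    have s12: "s1 * s2 = 4 * complex_of_real pi ^ 2 * (4 + w\<^sup>2)"
      by (simp add: s1_def s2_def power2_eq_square algebra_simps)
    then have "4 + w\<^sup>2 \<noteq> 0" using \<open>s1 \<noteq> 0\<close> \<open>s2 \<noteq> 0\<close> by auto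
    have "1 / s1 + 1 / s2 = (s1 + s2) / (s1 * s2)" using \<open>s1 \<noteq> 0\<close> \<open>s2 \<noteq> 0\<close> by (simp add: field_simps)
    also have "\<dots> = 8 * pi / (4 * complex_of_real pi ^ 2 * (4 + w\<^sup>2))" unfolding s12 by (simp add: s1_def s2_def)
    also have "\<dots> = 2 / complex_of_real pi / (4 + w\<^sup>2)" by (simp add: power2_eq_square)
    finally show ?thesis by simp
  qed
  moreover have "AE x in lborel. indicator {0<..} x *\<^sub>R exp (-(s1 * complex_of_real x))
      + indicator {0<..} (0 + (-1) * x) *\<^sub>R exp (-(s2 * complex_of_real (0 + (-1) * x)))
      = exp (- (4 * pi * \<bar>x\<bar>)) * exp (- (2 * pi * \<i> * w * complex_of_real x))"
    using AE_lborel_singleton[of "0::real"]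
  proof eventually_elim
    case (elim x)
    then consider "x > 0" | "x < 0" by linarith
    then show ?case
      by cases (auto simp: s1_def s2_def exp_of_real[symmetric] algebra_simps simp flip: exp_add)
  qed
  ultimately show ?thesis
    by (subst (asm) has_bochner_integral_cong_AE) auto
qed

text \<open>
  With \<open>e\<^sub>z(\<xi>) = exp (- 2 pi i z \<xi>)\<close>, the kernel is the inner product
  \<open>\<integral> exp (- 4 pi \<bar>\<xi>\<bar>) (e\<^sub>z cnj e\<^sub>l + e\<^sub>z' cnj e\<^sub>l')\<close>; the factor \<open>4 pi\<^sup>2 z l\<close> comes from the derivatives.
\<close>

definition sob_kernel :: "complex \<Rightarrow> real \<Rightarrow> complex" where
  "sob_kernel z l =
     (1 + 4 * complex_of_real pi ^ 2 * z * complex_of_real l) *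
     (2 / complex_of_real pi / (4 + (z - complex_of_real l)\<^sup>2))"

text \<open>The inner product of e_z with the sum of coefficients r, as a function of z: analytic
  for |Im z| < 2, and zero at a real point a precisely when the sum is orthogonal to e_a.\<close>

definition sob_dual :: "real set \<Rightarrow> (real \<Rightarrow> complex) \<Rightarrow> complex \<Rightarrow> complex" where
  "sob_dual S r z = (\<Sum>l\<in>S. cnj (r l) * sob_kernel z l)"

definition sob_form :: "real set \<Rightarrow> (real \<Rightarrow> complex) \<Rightarrow> (real \<Rightarrow> complex) \<Rightarrow> complex" where
  "sob_form S r s = (\<Sum>a\<in>S. r a * sob_dual S s (complex_of_real a))"

definition trig_sum :: "real set \<Rightarrow> (real \<Rightarrow> complex) \<Rightarrow> real \<Rightarrow> complex" where
  "trig_sum S r \<xi> = (\<Sum>l\<in>S. r l * cis (-(2 * pi * l * \<xi>)))"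

lemma sob_dual_integral:
  assumes "finite S" and z: "\<bar>Im z\<bar> < 2"
  shows "has_bochner_integral lborel
    (\<lambda>\<xi>. exp (- (4 * pi * \<bar>\<xi>\<bar>)) * (exp (- (2 * pi * \<i> * z * complex_of_real \<xi>)) *
      (cnj (trig_sum S r \<xi>) + (- 2 * pi * \<i> * z) * cnj (trig_sum S (\<lambda>l. - 2 * pi * \<i> * l * r l) \<xi>))))
    (sob_dual S r z)"
proof -
  have "has_bochner_integral lborel
    (\<lambda>\<xi>. \<Sum>l\<in>S. cnj (r l) * (1 + 4 * complex_of_real pi ^ 2 * z * complex_of_real l) *
        (exp (- (4 * pi * \<bar>\<xi>\<bar>)) * exp (- (2 * pi * \<i> * (z - complex_of_real l) * complex_of_real \<xi>))))
    (\<Sum>l\<in>S. cnj (r l) * (1 + 4 * complex_of_real pi ^ 2 * z * complex_of_real l) * (2 / complex_of_real pi / (4 + (z - complex_of_real l)\<^sup>2)))"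
    by (intro has_bochner_integral_sum has_bochner_integral_mult_right has_bochner_integral_laplace_kernel)
       (use z in auto)
  moreover have "(\<lambda>\<xi>. \<Sum>l\<in>S. cnj (r l) * (1 + 4 * complex_of_real pi ^ 2 * z * complex_of_real l) *
        (exp (- (4 * pi * \<bar>\<xi>\<bar>)) * exp (- (2 * pi * \<i> * (z - complex_of_real l) * complex_of_real \<xi>))))
    = (\<lambda>\<xi>. exp (- (4 * pi * \<bar>\<xi>\<bar>)) * (exp (- (2 * pi * \<i> * z * complex_of_real \<xi>)) *
      (cnj (trig_sum S r \<xi>) + (- 2 * pi * \<i> * z) * cnj (trig_sum S (\<lambda>l. - 2 * pi * \<i> * l * r l) \<xi>))))"
    unfolding trig_sum_def cnj_sum sum_distrib_left sum.distrib[symmetric]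
  proof (intro ext sum.cong refl)
    fix \<xi> l
    have "exp (- (2 * pi * \<i> * (z - complex_of_real l) * complex_of_real \<xi>)) =
       exp (- (2 * pi * \<i> * z * complex_of_real \<xi>)) * cis (2 * pi * l * \<xi>)"
      by (simp add: cis_conv_exp algebra_simps flip: exp_add)
    then show "cnj (r l) * (1 + 4 * complex_of_real pi ^ 2 * z * complex_of_real l) *
        (exp (- (4 * pi * \<bar>\<xi>\<bar>)) * exp (- (2 * pi * \<i> * (z - complex_of_real l) * complex_of_real \<xi>))) =
      exp (- (4 * pi * \<bar>\<xi>\<bar>)) * (exp (- (2 * pi * \<i> * z * complex_of_real \<xi>)) *
      (cnj (r l * cis (- (2 * pi * l * \<xi>))) + (- 2 * pi * \<i> * z) * cnj (- 2 * pi * \<i> * l * r l * cis (- (2 * pi * l * \<xi>)))))"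
      by (simp add: cis_cnj algebra_simps power2_eq_square)
  qed
  ultimately show ?thesis by (simp add: sob_dual_def sob_kernel_def mult.assoc)
qed

text \<open>The algebraic form is a squared norm: the second trigonometric sum is the derivative of
  the first. This gives positivity, and it is the quantity to which the L1 norm is later
  compared.\<close>

lemma sob_form_integral:
  assumes S: "finite S"
  shows "has_bochner_integral lborel
    (\<lambda>\<xi>. exp (- (4 * pi * \<bar>\<xi>\<bar>)) * ((norm (trig_sum S r \<xi>))\<^sup>2 + (norm (trig_sum S (\<lambda>l. - 2 * pi * \<i> * l * r l) \<xi>))\<^sup>2))
    (Re (sob_form S r r))"
proof -
  define D where "D = trig_sum S (\<lambda>l. - 2 * pi * \<i> * l * r l)"
  have "has_bochner_integral lborel
    (\<lambda>\<xi>. \<Sum>a\<in>S. r a * (exp (- (4 * pi * \<bar>\<xi>\<bar>)) * (exp (- (2 * pi * \<i> * complex_of_real a * complex_of_real \<xi>)) *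
      (cnj (trig_sum S r \<xi>) + (- 2 * pi * \<i> * complex_of_real a) * cnj (D \<xi>)))))
    (sob_form S r r)"
    unfolding sob_form_def D_def
    by (intro has_bochner_integral_sum has_bochner_integral_mult_right sob_dual_integral) (use S in auto)
  then have "has_bochner_integral lborel
    (\<lambda>\<xi>. Re (\<Sum>a\<in>S. r a * (exp (- (4 * pi * \<bar>\<xi>\<bar>)) * (exp (- (2 * pi * \<i> * complex_of_real a * complex_of_real \<xi>)) *
      (cnj (trig_sum S r \<xi>) + (- 2 * pi * \<i> * complex_of_real a) * cnj (D \<xi>))))))
    (Re (sob_form S r r))"
    by (rule has_bochner_integral_Re)
  moreover have "Re (\<Sum>a\<in>S. r a * (exp (- (4 * pi * \<bar>\<xi>\<bar>)) * (exp (- (2 * pi * \<i> * complex_of_real a * complex_of_real \<xi>)) *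
      (cnj (trig_sum S r \<xi>) + (- 2 * pi * \<i> * complex_of_real a) * cnj (D \<xi>)))))
    = exp (- (4 * pi * \<bar>\<xi>\<bar>)) * ((norm (trig_sum S r \<xi>))\<^sup>2 + (norm (D \<xi>))\<^sup>2)" for \<xi>
  proof -
    have e: "exp (- (2 * pi * \<i> * complex_of_real a * complex_of_real \<xi>)) = cis (- (2 * pi * a * \<xi>))" for a
      by (simp add: cis_conv_exp algebra_simps)
    have "(\<Sum>a\<in>S. r a * (exp (- (4 * pi * \<bar>\<xi>\<bar>)) * (exp (- (2 * pi * \<i> * complex_of_real a * complex_of_real \<xi>)) *
      (cnj (trig_sum S r \<xi>) + (- 2 * pi * \<i> * complex_of_real a) * cnj (D \<xi>)))))
      = exp (- (4 * pi * \<bar>\<xi>\<bar>)) * ((\<Sum>a\<in>S. r a * cis (- (2 * pi * a * \<xi>))) * cnj (trig_sum S r \<xi>)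
          + (\<Sum>a\<in>S. - 2 * pi * \<i> * a * r a * cis (- (2 * pi * a * \<xi>))) * cnj (D \<xi>))"
      unfolding e sum_distrib_right sum_distrib_left sum.distrib[symmetric]
      by (intro sum.cong refl) (simp add: algebra_simps)
    also have "\<dots> = exp (- (4 * pi * \<bar>\<xi>\<bar>)) * (trig_sum S r \<xi> * cnj (trig_sum S r \<xi>) + D \<xi> * cnj (D \<xi>))"
      by (simp add: trig_sum_def D_def)
    also have "\<dots> = complex_of_real (exp (- (4 * pi * \<bar>\<xi>\<bar>)) * ((norm (trig_sum S r \<xi>))\<^sup>2 + (norm (D \<xi>))\<^sup>2))"
      by (simp only: complex_norm_square[symmetric] of_real_mult of_real_add)
    finally show ?thesis by (simp only: Re_complex_of_real)
  qed
  ultimately show ?thesis by (simp add: D_def)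
qed

text \<open>Cauchy-Schwarz with the geometric mean replaced by the arithmetic one. The first summand
  is the squared norm of e_z, finite only for |Im z| < 1; this is where the strip of half-width 1
  comes from. The set S enters only through the value of the form.\<close>

lemma norm_sob_dual_le:
  assumes S: "finite S" and z: "\<bar>Im z\<bar> < 1"
  shows "norm (sob_dual S r z) \<le> ((1 + 4 * pi\<^sup>2 * (norm z)\<^sup>2) * (1 / (2 * pi * (1 - (Im z)\<^sup>2))) + Re (sob_form S r r)) / 2"
proof -
  define D where "D = trig_sum S (\<lambda>l. - 2 * pi * \<i> * l * r l)"
  define f where "f \<xi> = exp (- (4 * pi * \<bar>\<xi>\<bar>)) * (exp (- (2 * pi * \<i> * z * complex_of_real \<xi>)) *
      (cnj (trig_sum S r \<xi>) + (- 2 * pi * \<i> * z) * cnj (D \<xi>)))" for \<xi>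
  have f: "has_bochner_integral lborel f (sob_dual S r z)"
    unfolding f_def D_def by (rule sob_dual_integral) (use S z in auto)
  \<comment> \<open>Taking w = 2 i Im z turns the oscillating factor of the Laplace kernel into
    |e_z|^2 = exp(4 pi Im z xi).\<close>
  have "has_bochner_integral lborel
     (\<lambda>\<xi>. exp (- (4 * pi * \<bar>\<xi>\<bar>)) * exp (- (2 * pi * \<i> * (2 * \<i> * Im z) * complex_of_real \<xi>))) (2 / complex_of_real pi / (4 + (2 * \<i> * Im z)\<^sup>2))"
    by (rule has_bochner_integral_laplace_kernel) (use z in auto)
  then have "has_bochner_integral lborel
     (\<lambda>\<xi>. Re (exp (- (4 * pi * \<bar>\<xi>\<bar>)) * exp (- (2 * pi * \<i> * (2 * \<i> * Im z) * complex_of_real \<xi>)))) (Re (2 / complex_of_real pi / (4 + (2 * \<i> * Im z)\<^sup>2)))"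
    by (rule has_bochner_integral_Re)
  moreover have "Re (2 / complex_of_real pi / (4 + (2 * \<i> * Im z)\<^sup>2)) = 1 / (2 * pi * (1 - (Im z)\<^sup>2))"
  proof -
    have "2 / complex_of_real pi / (4 + (2 * \<i> * Im z)\<^sup>2) = complex_of_real (2 / pi / (4 - 4 * (Im z)\<^sup>2))"
      by (simp add: power_mult_distrib)
    then have "Re (2 / complex_of_real pi / (4 + (2 * \<i> * Im z)\<^sup>2)) = 2 / pi / (4 - 4 * (Im z)\<^sup>2)"
      by (metis Re_complex_of_real)
    also have "4 - 4 * (Im z)\<^sup>2 = 4 * (1 - (Im z)\<^sup>2)" by simp
    also have "2 / pi / (4 * t) = 1 / (2 * pi * t)" for t :: real by (cases "t = 0") (auto simp: field_simps)
    finally show ?thesis .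
  qed
  ultimately have g: "has_bochner_integral lborel (\<lambda>\<xi>. exp (- (4 * pi * \<bar>\<xi>\<bar>)) * exp (4 * pi * Im z * \<xi>)) (1 / (2 * pi * (1 - (Im z)\<^sup>2)))"
    by (simp add: Re_exp algebra_simps)
  have h: "has_bochner_integral lborel
     (\<lambda>\<xi>. ((1 + 4 * pi\<^sup>2 * (norm z)\<^sup>2) * (exp (- (4 * pi * \<bar>\<xi>\<bar>)) * exp (4 * pi * Im z * \<xi>))
       + exp (- (4 * pi * \<bar>\<xi>\<bar>)) * ((norm (trig_sum S r \<xi>))\<^sup>2 + (norm (D \<xi>))\<^sup>2)) / 2)
     (((1 + 4 * pi\<^sup>2 * (norm z)\<^sup>2) * (1 / (2 * pi * (1 - (Im z)\<^sup>2))) + Re (sob_form S r r)) / 2)"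
    unfolding D_def
    by (intro has_bochner_integral_divide_zero has_bochner_integral_add has_bochner_integral_mult_right g sob_form_integral S)
  have "norm (f \<xi>) \<le> ((1 + 4 * pi\<^sup>2 * (norm z)\<^sup>2) * (exp (- (4 * pi * \<bar>\<xi>\<bar>)) * exp (4 * pi * Im z * \<xi>))
       + exp (- (4 * pi * \<bar>\<xi>\<bar>)) * ((norm (trig_sum S r \<xi>))\<^sup>2 + (norm (D \<xi>))\<^sup>2)) / 2" for \<xi>
  proof -
    define p where "p = exp (2 * pi * Im z * \<xi>)"
    define A where "A = norm (trig_sum S r \<xi>)"
    define B where "B = norm (D \<xi>)"
    define n where "n = 2 * pi * norm z"
    have "norm (f \<xi>) = exp (- (4 * pi * \<bar>\<xi>\<bar>)) * (p * norm (cnj (trig_sum S r \<xi>) + (- 2 * pi * \<i> * z) * cnj (D \<xi>)))"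
      by (simp add: f_def norm_mult p_def)
    also have "\<dots> \<le> exp (- (4 * pi * \<bar>\<xi>\<bar>)) * (p * (A + n * B))"
      by (intro mult_left_mono norm_triangle_le) (auto simp: A_def B_def n_def norm_mult p_def)
    also have "p * (A + n * B) \<le> ((1 + n\<^sup>2) * p\<^sup>2 + A\<^sup>2 + B\<^sup>2) / 2"
      using sum_squares_bound[of p A] sum_squares_bound[of "n * p" B]
      by (simp add: power2_eq_square algebra_simps)
    also have "p\<^sup>2 = exp (4 * pi * Im z * \<xi>)" by (simp add: p_def power2_eq_square flip: exp_add)
    finally show ?thesis by (simp add: A_def B_def n_def power_mult_distrib algebra_simps)
  qed
  then have "(\<integral>\<xi>. norm (f \<xi>) \<partial>lborel) \<le> (\<integral>\<xi>. ((1 + 4 * pi\<^sup>2 * (norm z)\<^sup>2) * (exp (- (4 * pi * \<bar>\<xi>\<bar>)) * exp (4 * pi * Im z * \<xi>))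
       + exp (- (4 * pi * \<bar>\<xi>\<bar>)) * ((norm (trig_sum S r \<xi>))\<^sup>2 + (norm (D \<xi>))\<^sup>2)) / 2 \<partial>lborel)"
    using f h by (intro integral_mono) (auto simp: has_bochner_integral_iff)
  also have "\<dots> = ((1 + 4 * pi\<^sup>2 * (norm z)\<^sup>2) * (1 / (2 * pi * (1 - (Im z)\<^sup>2))) + Re (sob_form S r r)) / 2"
    by (rule has_bochner_integral_integral_eq[OF h])
  finally have "(\<integral>\<xi>. norm (f \<xi>) \<partial>lborel) \<le> ((1 + 4 * pi\<^sup>2 * (norm z)\<^sup>2) * (1 / (2 * pi * (1 - (Im z)\<^sup>2))) + Re (sob_form S r r)) / 2" .
  moreover have "norm (integral\<^sup>L lborel f) \<le> (\<integral>\<xi>. norm (f \<xi>) \<partial>lborel)" by simp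
  ultimately show ?thesis unfolding has_bochner_integral_integral_eq[OF f] by (rule order_trans[rotated])
qed

lemma sob_form_nonneg: "finite S \<Longrightarrow> Re (sob_form S r r) \<ge> 0"
  by (subst has_bochner_integral_integral_eq[OF sob_form_integral, symmetric])
     (auto intro!: Bochner_Integration.integral_nonneg)

section \<open>Hermitian algebra of the form and orthogonal projection\<close>

lemma sob_kernel_symmetric: "sob_kernel (complex_of_real a) b = sob_kernel (complex_of_real b) a"
  by (simp add: sob_kernel_def power2_commute mult_ac)

lemma cnj_sob_kernel: "cnj (sob_kernel (complex_of_real a) b) = sob_kernel (complex_of_real a) b"
  by (simp add: sob_kernel_def)

lemma sob_form_double_sum:
  "sob_form S r s = (\<Sum>a\<in>S. \<Sum>b\<in>S. r a * cnj (s b) * sob_kernel (complex_of_real a) b)"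
  by (simp add: sob_form_def sob_dual_def sum_distrib_left mult.assoc)

lemma cnj_sob_form: "cnj (sob_form S r s) = sob_form S s r"
  unfolding sob_form_double_sum
  by (subst sum.swap) (auto intro!: sum.cong simp: cnj_sob_kernel sob_kernel_symmetric[of _ "_::real"] mult_ac)

lemma sob_dual_lincomb:
  "sob_dual S (\<lambda>l. r l + c * s l) z = sob_dual S r z + cnj c * sob_dual S s z"
  by (simp add: sob_dual_def sum_distrib_left sum.distrib[symmetric] algebra_simps)

lemma sob_form_lincomb_left:
  "sob_form S (\<lambda>l. r l + c * s l) t = sob_form S r t + c * sob_form S s t"
  by (simp add: sob_form_def sum_distrib_left sum.distrib[symmetric] algebra_simps)

lemma sob_form_lincomb_right:
  "sob_form S t (\<lambda>l. r l + c * s l) = sob_form S t r + cnj c * sob_form S t s"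
  by (simp add: sob_form_def sob_dual_lincomb sum_distrib_left sum.distrib[symmetric] algebra_simps)

text \<open>The form is only known to be semidefinite. A vector a of length 0 must be orthogonal to
  every u, since otherwise moving far from u in the direction of a would make the form
  negative.\<close>

lemma sob_form_degenerate:
  assumes S: "finite S" and 0: "Re (sob_form S a a) = 0"
  shows "sob_form S a u = 0"
proof (rule ccontr)
  define q where "q = sob_form S a u"
  assume "sob_form S a u \<noteq> 0"
  then have q: "norm q > 0" by (simp add: q_def)
  have swap: "sob_form S u a = cnj q" by (simp add: q_def cnj_sob_form)
  have "2 * n * (norm q)\<^sup>2 \<le> Re (sob_form S u u)" for n :: real
  proof -
    \<comment> \<open>The phase of q is cancelled, so that both cross terms equal -n |q|^2.\<close>
    define c where "c = - (n * cnj q)"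
    have "0 \<le> Re (sob_form S (\<lambda>l. u l + c * a l) (\<lambda>l. u l + c * a l))"
      by (rule sob_form_nonneg[OF S])
    also have "sob_form S (\<lambda>l. u l + c * a l) (\<lambda>l. u l + c * a l) =
        sob_form S u u + cnj c * cnj q + c * q + c * cnj c * sob_form S a a"
      by (simp add: sob_form_lincomb_left sob_form_lincomb_right swap q_def[symmetric] algebra_simps)
    also have "c * cnj c = complex_of_real ((norm c)\<^sup>2)" by (simp only: complex_norm_square)
    also have "c * q = complex_of_real (- n * (norm q)\<^sup>2)"
      by (simp add: c_def complex_norm_square mult_ac del: of_real_power)
    also have "cnj c * cnj q = complex_of_real (- n * (norm q)\<^sup>2)"
      by (simp add: c_def complex_norm_square mult_ac del: of_real_power)
    finally show ?thesis using 0 by simp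
  qed
  from this[of "(Re (sob_form S u u) + 1) / (2 * (norm q)\<^sup>2)"] show False using q by simp
qed

text \<open>Gram-Schmidt, one constraint at a time, in a form that tolerates degeneracy. The
  residual \<open>d\<close> of the new exponential has its own dual value at x as squared length. If
  that is 0 then \<open>r\<close> already satisfies the new constraint by
  \<open>sob_form_degenerate\<close>; otherwise a multiple of \<open>d\<close> corrects it.\<close>

lemma sob_projection:
  assumes "finite F" and S: "finite S" and "F \<subseteq> S"
  shows "\<exists>r. (\<forall>l. l \<notin> F \<longrightarrow> r l = u l) \<and> (\<forall>a\<in>F. sob_dual S r (complex_of_real a) = 0)"
  using assms(1,3)
proof (induction F arbitrary: u rule: finite_induct)
  case (insert x F)
  have xS: "x \<in> S" using insert by auto
  obtain r where r: "\<And>l. l \<notin> F \<Longrightarrow> r l = u l" "\<And>a. a \<in> F \<Longrightarrow> sob_dual S r (complex_of_real a) = 0"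
    using insert.IH[of u] insert.prems by auto
  obtain d where d: "\<And>l. l \<notin> F \<Longrightarrow> d l = (if l = x then 1 else 0)" "\<And>a. a \<in> F \<Longrightarrow> sob_dual S d (complex_of_real a) = 0"
    using insert.IH[of "\<lambda>l. if l = x then 1 else 0"] insert.prems by auto
  \<comment> \<open>Within S, \<open>d\<close> lives on F and x, and \<open>s\<close> has zero dual
    value on F, so only the term at x, with coefficient 1, remains.\<close>
  have form_d: "sob_form S d s = sob_dual S s (complex_of_real x)"
    if "\<And>a. a \<in> F \<Longrightarrow> sob_dual S s (complex_of_real a) = 0" for s
  proof -
    have "sob_form S d s = (\<Sum>a\<in>S. if a = x then sob_dual S s (complex_of_real x) else 0)"
      unfolding sob_form_def
    proof (intro sum.cong refl)
      fix a show "d a * sob_dual S s (complex_of_real a) = (if a = x then sob_dual S s (complex_of_real x) else 0)"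
        using that[of a] d(1)[of a] d(1)[of x] insert.hyps by (cases "a \<in> F") auto
    qed
    then show ?thesis using S xS by simp
  qed
  show ?case
  proof (cases "sob_dual S d (complex_of_real x) = 0")
    case True
    then have "sob_form S d d = 0" using form_d[OF d(2)] by simp
    then have "sob_form S d r = 0" by (intro sob_form_degenerate[OF S]) simp
    then have "sob_dual S r (complex_of_real x) = 0" using form_d[OF r(2)] by simp
    then show ?thesis using r by (intro exI[of _ r]) auto
  next
    case False
    \<comment> \<open>The conjugate appears because the dual is conjugate linear in the
      coefficients.\<close>
    define c where "c = cnj (- sob_dual S r (complex_of_real x) / sob_dual S d (complex_of_real x))"
    have "sob_dual S (\<lambda>l. r l + c * d l) (complex_of_real a) = 0" if "a \<in> insert x F" for a
      unfolding sob_dual_lincomb using that r(2) d(2) False by (auto simp: c_def)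
    moreover have "r l + c * d l = u l" if "l \<notin> insert x F" for l
      using that r(1) d(1) by auto
    ultimately show ?thesis by (intro exI[of _ "\<lambda>l. r l + c * d l"]) auto
  qed
qed auto

text \<open>The residual of e_x after projection onto the exponentials of F. Orthogonality
  identifies its squared length with the dual value at x, and Pythagoras bounds it by the squared
  length of e_x, independently of F.\<close>

lemma sob_extremal:
  assumes F: "finite F" and x: "x \<notin> F"
  obtains r where "r x = 1" "\<And>a. a \<in> F \<Longrightarrow> sob_dual (insert x F) r (complex_of_real a) = 0"
    "Re (sob_form (insert x F) r r) = Re (sob_dual (insert x F) r (complex_of_real x))"
    "Re (sob_form (insert x F) r r) \<le> Re (sob_kernel (complex_of_real x) x)"
proof -
  define S where "S = insert x F"
  define u where "u l = (if l = x then 1 else 0 :: complex)" for l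
  have S: "finite S" "F \<subseteq> S" using F by (auto simp: S_def)
  obtain r where r: "\<And>l. l \<notin> F \<Longrightarrow> r l = u l" "\<And>a. a \<in> F \<Longrightarrow> sob_dual S r (complex_of_real a) = 0"
    using sob_projection[OF F S, of u] by auto
  have rx: "r x = 1" using r(1)[OF x] by (simp add: u_def)
  have form: "sob_form S s r = s x * sob_dual S r (complex_of_real x)" for s
    using F x r(2) by (simp add: sob_form_def S_def)
  \<comment> \<open>The difference is supported on F, where \<open>r\<close> has zero dual value, so
    \<open>u\<close> splits orthogonally into \<open>r\<close> and \<open>d\<close>.\<close>
  define d where "d l = u l + (- 1) * r l" for l
  have "d x = 0" by (simp add: d_def rx u_def)
  then have dr: "sob_form S d r = 0" by (simp add: form)
  then have rd: "sob_form S r d = 0" using cnj_sob_form[of S d r] by simp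
  have "u = (\<lambda>l. r l + 1 * d l)" by (simp add: d_def)
  then have "sob_form S u u = sob_form S r r + sob_form S d d"
    by (simp only: sob_form_lincomb_left sob_form_lincomb_right dr rd) simp
  then have le: "Re (sob_form S r r) \<le> Re (sob_form S u u)" using sob_form_nonneg[OF S(1), of d] by simp
  have u0: "u x = 1" "\<And>l. l \<in> F \<Longrightarrow> u l = 0" using x by (auto simp: u_def)
  then have "sob_form S u u = sob_kernel (complex_of_real x) x"
    using F x by (simp add: sob_form_def sob_dual_def S_def)
  then show thesis using that[of r] rx r(2) form[of r] le by (simp add: S_def)
qed

section \<open>Analyticity in the strip and decay of the distance\<close>

lemma holomorphic_sob_dual: "sob_dual S r holomorphic_on {z. \<bar>Im z\<bar> < 2}"
proof -
  have "4 + (z - complex_of_real l)\<^sup>2 \<noteq> 0" if "\<bar>Im z\<bar> < 2" for z l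
  proof
    assume eq: "4 + (z - complex_of_real l)\<^sup>2 = 0"
    have "(z - complex_of_real l - 2 * \<i>) * (z - complex_of_real l + 2 * \<i>) = 4 + (z - complex_of_real l)\<^sup>2"
      by (simp add: power2_eq_square algebra_simps)
    then have "z - complex_of_real l - 2 * \<i> = 0 \<or> z - complex_of_real l + 2 * \<i> = 0" using eq by simp
    then have "\<bar>Im z\<bar> = 2" by (auto simp: complex_eq_iff)
    then show False using that by simp
  qed
  then show ?thesis
    unfolding sob_dual_def sob_kernel_def by (intro holomorphic_intros) auto
qed

text \<open>
  Shifting the half-plane by \<open>s\<close> before taking the logarithm keeps the image at distance at least
  \<open>s / norm (s + \<zeta>)\<close> (up to a constant) from the boundary of the strip, so that the kernel grows only
  polynomially in \<open>s + \<zeta>\<close>.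
\<close>

lemma log_strip_bound:
  assumes s: "s > 0" and z: "Re \<zeta> > 0"
  defines "w \<equiv> (2 / pi) * Ln (complex_of_real s + \<zeta>)" and "\<rho> \<equiv> norm (complex_of_real s + \<zeta>)"
  shows "\<bar>Im w\<bar> < 1"
    and "(1 + 4 * pi\<^sup>2 * (norm w)\<^sup>2) * (1 / (2 * pi * (1 - (Im w)\<^sup>2)))
       \<le> ((1 + 4 * pi\<^sup>2) / s\<^sup>2 + 16 * (1 + 1 / s\<^sup>2)\<^sup>2) / (4 * s) * \<rho> ^ 3"
proof -
  define L where "L = Ln (complex_of_real s + \<zeta>)"
  define \<theta> where "\<theta> = Im L"
  have Re: "Re (complex_of_real s + \<zeta>) > 0" using s z by simp
  then have nz: "complex_of_real s + \<zeta> \<noteq> 0" by (metis less_irrefl zero_complex.simps(1))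
  have \<rho>s: "\<rho> \<ge> s"
    using complex_Re_le_cmod[of "complex_of_real s + \<zeta>"] z by (simp add: \<rho>_def)
  have \<rho>: "\<rho> > 0" using \<rho>s s by simp
  have \<theta>: "\<bar>\<theta>\<bar> < pi / 2" unfolding \<theta>_def L_def using Re_Ln_pos_lt[OF nz] Re by simp
  have ImW: "Im w = 2 / pi * \<theta>" by (simp add: w_def \<theta>_def L_def)
  show y1: "\<bar>Im w\<bar> < 1" using \<theta> by (simp add: ImW abs_mult field_simps)
  have ReL: "Re L = ln \<rho>" unfolding L_def \<rho>_def using nz by (rule Re_Ln)
  have "exp L = complex_of_real s + \<zeta>" unfolding L_def using nz by (rule exp_Ln)
  then have "Re (exp L) = Re (complex_of_real s + \<zeta>)" by simp
  then have "\<rho> * cos \<theta> = s + Re \<zeta>" using \<rho> by (simp add: Re_exp ReL \<theta>_def)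
  then have cos: "cos \<theta> \<ge> s / \<rho>" using z \<rho> by (simp add: field_simps)
  \<comment> \<open>The distance of Im w from +-1 is (2/pi) (pi/2 - |theta|); sin y <= y converts
    the lower bound s / rho on the cosine into a lower bound on this distance.\<close>
  have "cos \<theta> = sin (pi / 2 - \<bar>\<theta>\<bar>)" by (simp add: sin_diff)
  also have "\<dots> \<le> pi / 2 - \<bar>\<theta>\<bar>" using \<theta> by (intro sin_x_le_x) auto
  finally have "s / \<rho> \<le> pi / 2 - \<bar>\<theta>\<bar>" using cos by simp
  moreover have "1 - \<bar>Im w\<bar> = 2 / pi * (pi / 2 - \<bar>\<theta>\<bar>)" by (simp add: ImW abs_mult field_simps)
  moreover have "2 / pi * (s / \<rho>) \<le> 2 / pi * t" if "s / \<rho> \<le> t" for t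
    using that by (intro mult_left_mono) auto
  ultimately have "2 / pi * (s / \<rho>) \<le> 1 - \<bar>Im w\<bar>" by metis
  also have "1 - \<bar>Im w\<bar> \<le> 1 - (Im w)\<^sup>2"
  proof -
    have "\<bar>Im w\<bar> * \<bar>Im w\<bar> \<le> \<bar>Im w\<bar>" using y1 by (intro mult_left_le) auto
    then show ?thesis by (simp add: power2_eq_square)
  qed
  finally have d: "2 / pi * (s / \<rho>) \<le> 1 - (Im w)\<^sup>2" .
  have dpos: "2 / pi * (s / \<rho>) > 0" using s \<rho> by simp
  have "2 * pi * (2 / pi * (s / \<rho>)) \<le> 2 * pi * (1 - (Im w)\<^sup>2)" using d by (intro mult_left_mono) auto
  then have "4 * (s / \<rho>) \<le> 2 * pi * (1 - (Im w)\<^sup>2)" by simp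
  moreover have yy: "1 - (Im w)\<^sup>2 > 0" using dpos d by linarith
  ultimately have inv: "1 / (2 * pi * (1 - (Im w)\<^sup>2)) \<le> 1 / (4 * (s / \<rho>))"
    using s \<rho> by (intro divide_left_mono mult_pos_pos) auto
  \<comment> \<open>Both signs of the logarithm follow from ln y <= y - 1, and s <= rho replaces 1 /
    rho by rho / s^2.\<close>
  have lnb: "\<bar>ln \<rho>\<bar> \<le> \<rho> * (1 + 1 / s\<^sup>2)"
  proof -
    have "ln \<rho> \<le> \<rho> - 1" using \<rho> by (rule ln_le_minus_one)
    moreover have "- ln \<rho> = ln (1 / \<rho>)" using \<rho> by (simp add: ln_div)
    moreover have "ln (1 / \<rho>) \<le> 1 / \<rho> - 1" using \<rho> by (intro ln_le_minus_one) auto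
    moreover have "1 / \<rho> \<le> \<rho> / s\<^sup>2"
    proof -
      have "s\<^sup>2 \<le> \<rho>\<^sup>2" using \<rho>s s by (intro power_mono) auto
      then show ?thesis using s \<rho> by (simp add: field_simps power2_eq_square)
    qed
    moreover have "\<rho> / s\<^sup>2 \<ge> 0" using \<rho> by simp
    moreover have "\<rho> * (1 + 1 / s\<^sup>2) = \<rho> + \<rho> / s\<^sup>2" by (simp add: distrib_left)
    ultimately show ?thesis using \<rho> by linarith
  qed
  have "(norm w)\<^sup>2 = (2 / pi)\<^sup>2 * (norm L)\<^sup>2"
    unfolding w_def L_def[symmetric] norm_mult power_mult_distrib by (simp add: norm_divide)
  also have "(norm L)\<^sup>2 = (ln \<rho>)\<^sup>2 + \<theta>\<^sup>2" unfolding cmod_power2 by (simp add: ReL \<theta>_def)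
  finally have "4 * pi\<^sup>2 * (norm w)\<^sup>2 = 16 * (ln \<rho>)\<^sup>2 + 16 * \<theta>\<^sup>2"
    by (simp add: power2_eq_square field_simps)
  moreover have "(ln \<rho>)\<^sup>2 \<le> (\<rho> * (1 + 1 / s\<^sup>2))\<^sup>2" using power_mono[OF lnb, of 2] by simp
  moreover have "\<theta>\<^sup>2 \<le> (pi / 2)\<^sup>2" using power_mono[of "\<bar>\<theta>\<bar>" "pi / 2" 2] \<theta> by simp
  ultimately have "1 + 4 * pi\<^sup>2 * (norm w)\<^sup>2 \<le> (1 + 4 * pi\<^sup>2) * 1 + 16 * (\<rho> * (1 + 1 / s\<^sup>2))\<^sup>2"
    by (simp add: power_divide)
  \<comment> \<open>Inserting 1 <= rho^2 / s^2 makes the bound homogeneous of degree 2; the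
    reciprocal of the distance supplies the third power.\<close>
  also have "\<dots> \<le> (1 + 4 * pi\<^sup>2) * (\<rho>\<^sup>2 / s\<^sup>2) + 16 * (\<rho> * (1 + 1 / s\<^sup>2))\<^sup>2"
    using \<rho>s s by (intro add_right_mono mult_left_mono) (auto intro: power_mono)
  also have "\<dots> = ((1 + 4 * pi\<^sup>2) / s\<^sup>2 + 16 * (1 + 1 / s\<^sup>2)\<^sup>2) * \<rho>\<^sup>2"
    by (simp add: power_mult_distrib distrib_right)
  finally have "(1 + 4 * pi\<^sup>2 * (norm w)\<^sup>2) * (1 / (2 * pi * (1 - (Im w)\<^sup>2)))
     \<le> (((1 + 4 * pi\<^sup>2) / s\<^sup>2 + 16 * (1 + 1 / s\<^sup>2)\<^sup>2) * \<rho>\<^sup>2) * (1 / (4 * (s / \<rho>)))"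
    using inv yy s by (intro mult_mono) (auto intro!: mult_nonneg_nonneg add_nonneg_nonneg)
  also have "\<dots> = ((1 + 4 * pi\<^sup>2) / s\<^sup>2 + 16 * (1 + 1 / s\<^sup>2)\<^sup>2) / (4 * s) * \<rho> ^ 3"
    using s \<rho> by (simp add: power2_eq_square power3_eq_cube)
  finally show "(1 + 4 * pi\<^sup>2 * (norm w)\<^sup>2) * (1 / (2 * pi * (1 - (Im w)\<^sup>2)))
       \<le> ((1 + 4 * pi\<^sup>2) / s\<^sup>2 + 16 * (1 + 1 / s\<^sup>2)\<^sup>2) / (4 * s) * \<rho> ^ 3" .
qed

text \<open>The dual function of the extremal residual vanishes on F and has a bound independent of
  F. Moved to the half-plane and divided by (s + zeta)^3 it stays below M, so its value at the image
  of x is at most M times a Blaschke product, which decays exponentially in the sum of weights. By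
  orthogonality this value is, up to a constant, the squared distance.\<close>

lemma sob_distance_decay:
  fixes x :: real
  shows "\<exists>C c. C > 0 \<and> c > 0 \<and> (\<forall>F. finite F \<and> F \<subseteq> {x<..} \<longrightarrow>
     (\<exists>r. r x = 1 \<and> Re (sob_form (insert x F) r r) \<le> C * exp (- c * (\<Sum>l\<in>F. exp (- (pi / 2) * l)))))"
proof -
  \<comment> \<open>With this shift the boundary point 0 of the half-plane corresponds to x - 1, so
    x and all points to its right have positive images \<open>a l\<close>.\<close>
  define s where "s = exp (pi / 2 * (x - 1))"
  have s: "s > 0" by (simp add: s_def)
  define a where "a l = exp (pi / 2 * l) - s" for l
  have apos: "a l > 0" if "l \<ge> x" for l
    using that by (simp add: a_def s_def)
  define K where "K = Re (sob_kernel (complex_of_real x) x)"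
  have "sob_kernel (complex_of_real x) x = complex_of_real ((1 + 4 * pi\<^sup>2 * x\<^sup>2) * (2 / pi / 4))"
    by (simp add: sob_kernel_def power2_eq_square)
  then have "K = (1 + 4 * pi\<^sup>2 * x\<^sup>2) * (2 / pi / 4)" unfolding K_def by (simp only: Re_complex_of_real)
  then have K: "K > 0" by (simp add: add_pos_nonneg)
  \<comment> \<open>Half the sum of the growth constant of \<open>log_strip_bound\<close> and of K /
    s^3; the latter lets K <= K rho^3 / s^3 share the factor rho^3.\<close>
  define M where "M = (((1 + 4 * pi\<^sup>2) / s\<^sup>2 + 16 * (1 + 1 / s\<^sup>2)\<^sup>2) / (4 * s) + K / s ^ 3) / 2"
  have M: "M > 0" unfolding M_def using s K
    by (intro divide_pos_pos add_pos_pos mult_pos_pos zero_less_power) auto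
  define w where "w \<zeta> = (2 / pi) * Ln (complex_of_real s + \<zeta>)" for \<zeta>
  have wa: "w (complex_of_real (a l)) = complex_of_real l" for l
  proof -
    have "complex_of_real s + complex_of_real (a l) = complex_of_real (exp (pi / 2 * l))"
      by (simp add: a_def)
    then show ?thesis by (simp only: w_def Ln_of_real exp_gt_zero ln_exp) simp
  qed
  have "\<exists>r. r x = 1 \<and> Re (sob_form (insert x F) r r) \<le> (M * exp (pi / 2 * x) ^ 3) * exp (- a x * (\<Sum>l\<in>F. exp (- (pi / 2) * l)))"
    if F: "finite F" "F \<subseteq> {x<..}" for F
  proof -
    define S where "S = insert x F"
    have S: "finite S" using F by (simp add: S_def)
    have xF: "x \<notin> F" using F by auto
    obtain r where r: "r x = 1" "\<And>a. a \<in> F \<Longrightarrow> sob_dual S r (complex_of_real a) = 0"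
      "Re (sob_form S r r) = Re (sob_dual S r (complex_of_real x))" "Re (sob_form S r r) \<le> K"
      using sob_extremal[OF F(1) xF] unfolding S_def K_def by blast
    define f where "f \<zeta> = sob_dual S r (w \<zeta>) / (complex_of_real s + \<zeta>) ^ 3" for \<zeta>
    define H where "H = {\<zeta>::complex. Re \<zeta> > 0}"
    have nz: "complex_of_real s + \<zeta> \<noteq> 0" if "\<zeta> \<in> H" for \<zeta>
      using that s by (auto simp: H_def complex_eq_iff)
    have holw: "w holomorphic_on H"
      unfolding w_def by (intro holomorphic_intros) (use s in \<open>auto simp: H_def complex_nonpos_Reals_iff\<close>)
    have wH: "\<bar>Im (w \<zeta>)\<bar> < 1" if "\<zeta> \<in> H" for \<zeta>
      using log_strip_bound(1)[OF s, of \<zeta>] that by (simp add: w_def H_def)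
    have "sob_dual S r \<circ> w holomorphic_on H"
      by (rule holomorphic_on_compose_gen[OF holw holomorphic_sob_dual]) (use wH in fastforce)
    then have holf: "f holomorphic_on H"
      unfolding f_def o_def by (intro holomorphic_intros) (use nz in auto)
    have fM: "norm (f \<zeta>) \<le> M" if z: "\<zeta> \<in> H" for \<zeta>
    proof -
      define \<rho> where "\<rho> = norm (complex_of_real s + \<zeta>)"
      have Rez: "Re \<zeta> > 0" using z by (simp add: H_def)
      have \<rho>s: "\<rho> \<ge> s" using complex_Re_le_cmod[of "complex_of_real s + \<zeta>"] Rez by (simp add: \<rho>_def)
      then have \<rho>: "\<rho> > 0" using s by simp
      have "norm (sob_dual S r (w \<zeta>)) \<le> ((1 + 4 * pi\<^sup>2 * (norm (w \<zeta>))\<^sup>2) * (1 / (2 * pi * (1 - (Im (w \<zeta>))\<^sup>2))) + Re (sob_form S r r)) / 2"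
        by (rule norm_sob_dual_le[OF S wH[OF z]])
      also have "\<dots> \<le> (((1 + 4 * pi\<^sup>2) / s\<^sup>2 + 16 * (1 + 1 / s\<^sup>2)\<^sup>2) / (4 * s) * \<rho> ^ 3 + K * (\<rho> ^ 3 / s ^ 3)) / 2"
      proof (intro divide_right_mono add_mono)
        show "(1 + 4 * pi\<^sup>2 * (norm (w \<zeta>))\<^sup>2) * (1 / (2 * pi * (1 - (Im (w \<zeta>))\<^sup>2))) \<le> ((1 + 4 * pi\<^sup>2) / s\<^sup>2 + 16 * (1 + 1 / s\<^sup>2)\<^sup>2) / (4 * s) * \<rho> ^ 3"
          using log_strip_bound(2)[OF s Rez] by (simp add: w_def \<rho>_def)
        have "1 \<le> \<rho> ^ 3 / s ^ 3" using \<rho>s s by (simp add: power_mono)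
        from mult_left_mono[OF this, of K] show "Re (sob_form S r r) \<le> K * (\<rho> ^ 3 / s ^ 3)"
          using r(4) K by simp
      qed simp
      also have "\<dots> = M * \<rho> ^ 3" by (simp add: M_def distrib_right)
      finally show ?thesis using \<rho> by (simp add: f_def norm_divide norm_power \<rho>_def[symmetric] pos_divide_le_eq)
    qed
    define Z where "Z = a ` F"
    have inj: "inj_on a F" by (rule inj_onI) (simp add: a_def)
    have "norm (f (a x)) \<le> M * (\<Prod>b\<in>Z. norm (complex_of_real (a x) - complex_of_real b) / norm (complex_of_real (a x) + complex_of_real b))"
    proof (rule half_plane_blaschke_bound[OF _ _ _ _ M])
      show "finite Z" using F by (simp add: Z_def)
      show "Z \<subseteq> {0<..}" using F apos by (force simp: Z_def)
      show "f holomorphic_on {\<zeta>. Re \<zeta> > 0}" using holf by (simp add: H_def)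
      show "norm (f \<zeta>) \<le> M" if "Re \<zeta> > 0" for \<zeta> using fM that by (simp add: H_def)
      show "f (complex_of_real b) = 0" if "b \<in> Z" for b
        using that r(2) by (auto simp: Z_def f_def wa)
      show "Re (complex_of_real (a x)) > 0" using apos[of x] by simp
    qed
    also have "(\<Prod>b\<in>Z. norm (complex_of_real (a x) - complex_of_real b) / norm (complex_of_real (a x) + complex_of_real b))
       \<le> (\<Prod>l\<in>F. exp (- a x * exp (- (pi / 2) * l)))"
      unfolding Z_def prod.reindex[OF inj] o_def
    proof (intro prod_mono conjI)
      fix l assume "l \<in> F"
      then have l: "l > x" using F by auto
      have al: "a l > a x" using l by (simp add: a_def)
      have a0: "a x > 0" "a l > 0" using apos[of x] al by auto
      have n1: "norm (complex_of_real (a x) - complex_of_real (a l)) = a l - a x"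
        using al by (simp flip: of_real_diff)
      have n2: "norm (complex_of_real (a x) + complex_of_real (a l)) = a l + a x"
        using a0 by (simp flip: of_real_add)
      \<comment> \<open>Each Blaschke factor is 1 - u <= exp(-u), and a l + a x <= 2 exp(pi l / 2)
        bounds u from below by a x times the weight of l.\<close>
      have "(a l - a x) / (a l + a x) = 1 + - (2 * a x / (a l + a x))" using a0 by (simp add: field_simps)
      also have "\<dots> \<le> exp (- (2 * a x / (a l + a x)))" by (rule exp_ge_add_one_self)
      also have "\<dots> \<le> exp (- a x * exp (- (pi / 2) * l))"
      proof -
        have "a l + a x \<le> 2 * exp (pi / 2 * l)" using al s unfolding a_def by linarith
        then have "2 * a x / (2 * exp (pi / 2 * l)) \<le> 2 * a x / (a l + a x)"
          using a0 by (intro divide_left_mono mult_pos_pos) auto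
        moreover have "2 * a x / (2 * exp (pi / 2 * l)) = a x * exp (- (pi / 2) * l)"
          by (simp add: exp_minus field_simps)
        ultimately show ?thesis by simp
      qed
      finally show "norm (complex_of_real (a x) - complex_of_real (a l)) / norm (complex_of_real (a x) + complex_of_real (a l)) \<le> exp (- a x * exp (- (pi / 2) * l))"
        unfolding n1 n2 .
    qed auto
    also have "(\<Prod>l\<in>F. exp (- a x * exp (- (pi / 2) * l))) = exp (- a x * (\<Sum>l\<in>F. exp (- (pi / 2) * l)))"
      using F by (simp add: exp_sum[symmetric] sum_distrib_left)
    finally have f: "norm (f (a x)) \<le> M * exp (- a x * (\<Sum>l\<in>F. exp (- (pi / 2) * l)))"
      using M by (simp add: mult_left_mono)
    have "complex_of_real s + complex_of_real (a x) = complex_of_real (exp (pi / 2 * x))"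
      by (simp add: a_def)
    then have "f (a x) = sob_dual S r (complex_of_real x) / complex_of_real (exp (pi / 2 * x)) ^ 3"
      by (simp only: f_def wa)
    then have "norm (sob_dual S r (complex_of_real x)) = norm (f (a x)) * exp (pi / 2 * x) ^ 3"
      by (simp add: norm_divide norm_power)
    also have "\<dots> \<le> M * exp (- a x * (\<Sum>l\<in>F. exp (- (pi / 2) * l))) * exp (pi / 2 * x) ^ 3"
      by (intro mult_right_mono f) simp
    finally have "Re (sob_form S r r) \<le> M * exp (- a x * (\<Sum>l\<in>F. exp (- (pi / 2) * l))) * exp (pi / 2 * x) ^ 3"
      unfolding r(3) using complex_Re_le_cmod[of "sob_dual S r (complex_of_real x)"] by linarith
    then show ?thesis using r(1) by (intro exI[of _ r]) (simp add: S_def mult_ac)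
  qed
  moreover have "M * exp (pi / 2 * x) ^ 3 > 0" using M by simp
  ultimately show ?thesis using apos[of x]
    by (intro exI[of _ "M * exp (pi / 2 * x) ^ 3"] exI[of _ "a x"]) auto
qed

text \<open>The kernel is unchanged when both arguments change sign, so points to the left of x may
  be treated as points to the right of -x.\<close>

lemma sob_form_reflect:
  "sob_form S (\<lambda>l. r (- l)) (\<lambda>l. r (- l)) = sob_form (uminus ` S) r r"
proof -
  have inj: "inj_on uminus S" for S :: "real set" by simp
  have K: "sob_kernel (- complex_of_real a) (- b) = sob_kernel (complex_of_real a) b" for a b
    by (simp add: sob_kernel_def power2_commute)
  show ?thesis
    unfolding sob_form_double_sum sum.reindex[OF inj] o_def by (simp add: K)
qed

subsection \<open>The Fourier transform of integrable functions\<close>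

text \<open>Taken over \<open>lborel\<close>, where Borel measurability and Fubini apply directly;
  \<open>fourier_transform_eq_ft\<close> connects it with the transform over Lebesgue
  measure.\<close>

definition ft :: "(real \<Rightarrow> complex) \<Rightarrow> real \<Rightarrow> complex" where
  "ft f \<xi> = (\<integral>t. f t * cis (- (2 * pi * t * \<xi>)) \<partial>lborel)"

lemma cis_measurable [measurable]: "cis \<in> borel_measurable borel"
  by (intro borel_measurable_continuous_onI continuous_intros)

lemma cnj_measurable [measurable]: "cnj \<in> borel_measurable borel"
  by (intro borel_measurable_continuous_onI continuous_intros)

lemma integrable_mult_unimodular:
  fixes f k :: "real \<Rightarrow> complex"
  assumes f: "integrable lborel f" and k: "k \<in> borel_measurable borel" "\<And>t. norm (k t) \<le> 1"
  shows "integrable lborel (\<lambda>t. f t * k t)"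
proof (rule Bochner_Integration.integrable_bound[OF f])
  show "(\<lambda>t. f t * k t) \<in> borel_measurable lborel"
    using borel_measurable_integrable[OF f] k(1) by measurable
  show "AE t in lborel. norm (f t * k t) \<le> norm (f t)"
    using k(2) by (auto simp: norm_mult mult_left_le)
qed

lemma integrable_ft_integrand:
  "integrable lborel f \<Longrightarrow> integrable lborel (\<lambda>t. f t * cis (- (2 * pi * t * \<xi>)))"
  by (rule integrable_mult_unimodular) auto

lemma norm_ft_le:
  assumes "integrable lborel f"
  shows "norm (ft f \<xi>) \<le> (\<integral>t. norm (f t) \<partial>lborel)"
proof -
  have "norm (ft f \<xi>) \<le> (\<integral>t. norm (f t * cis (- (2 * pi * t * \<xi>))) \<partial>lborel)"
    unfolding ft_def by (rule integral_norm_bound)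
  then show ?thesis by (simp add: norm_mult)
qed

lemma ft_measurable [measurable]:
  assumes [measurable]: "f \<in> borel_measurable borel"
  shows "ft f \<in> borel_measurable borel"
  unfolding ft_def[abs_def] by measurable

lemma integrable_pair_mult:
  fixes f g :: "real \<Rightarrow> complex" and k :: "real \<Rightarrow> real \<Rightarrow> complex"
  assumes f: "integrable lborel f" and g: "integrable lborel g"
    and k[measurable]: "case_prod k \<in> borel_measurable (borel \<Otimes>\<^sub>M borel)" and k1: "\<And>x y. norm (k x y) \<le> 1"
  shows "integrable (lborel \<Otimes>\<^sub>M lborel) (\<lambda>(x, y). f x * g y * k x y)"
proof -
  have [measurable]: "f \<in> borel_measurable borel" "g \<in> borel_measurable borel"
    using f g by (auto dest: borel_measurable_integrable)
  show ?thesis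
  proof (rule lborel_pair.Fubini_integrable)
    have int: "integrable lborel (\<lambda>y. f x * g y * k x y)" for x
    proof (rule Bochner_Integration.integrable_bound[of lborel "\<lambda>y. norm (f x) * norm (g y)"])
      show "AE y in lborel. norm (f x * g y * k x y) \<le> norm (norm (f x) * norm (g y))"
        using k1 by (auto simp: norm_mult mult_left_le)
      show "(\<lambda>y. f x * g y * k x y) \<in> borel_measurable lborel" by measurable
    qed (use g in auto)
    show "AE x in lborel. integrable lborel (\<lambda>y. case (x, y) of (x, y) \<Rightarrow> f x * g y * k x y)"
      using int by simp
    show "integrable lborel (\<lambda>x. \<integral>y. norm (case (x, y) of (x, y) \<Rightarrow> f x * g y * k x y) \<partial>lborel)"
    proof (rule Bochner_Integration.integrable_bound[of lborel "\<lambda>x. norm (f x) * (\<integral>y. norm (g y) \<partial>lborel)"])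
      show "AE x in lborel. norm (\<integral>y. norm (case (x, y) of (x, y) \<Rightarrow> f x * g y * k x y) \<partial>lborel)
          \<le> norm (norm (f x) * (\<integral>y. norm (g y) \<partial>lborel))"
      proof (intro AE_I2)
        fix x
        have "(\<integral>y. norm (f x * g y * k x y) \<partial>lborel) \<le> (\<integral>y. norm (f x) * norm (g y) \<partial>lborel)"
          by (intro integral_mono integrable_norm int integrable_mult_right g)
             (use k1 in \<open>auto simp: norm_mult mult_left_le\<close>)
        then show "norm (\<integral>y. norm (case (x, y) of (x, y) \<Rightarrow> f x * g y * k x y) \<partial>lborel)
          \<le> norm (norm (f x) * (\<integral>y. norm (g y) \<partial>lborel))" by simp
      qed
    qed (use f in auto)
  qed measurable
qed

text \<open>Fubini for a symmetric kernel. With a Gaussian as second function it is the source of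
  both the Plancherel bound and inversion.\<close>

lemma ft_multiplication:
  assumes f: "integrable lborel f" and g: "integrable lborel g"
  shows "(\<integral>\<xi>. ft f \<xi> * g \<xi> \<partial>lborel) = (\<integral>t. f t * ft g t \<partial>lborel)"
proof -
  have "integrable (lborel \<Otimes>\<^sub>M lborel) (\<lambda>(x, y). f x * g y * cis (- (2 * pi * x * y)))"
    by (rule integrable_pair_mult[OF f g]) auto
  then have "(\<integral>y. (\<integral>x. f x * g y * cis (- (2 * pi * x * y)) \<partial>lborel) \<partial>lborel)
    = (\<integral>x. (\<integral>y. f x * g y * cis (- (2 * pi * x * y)) \<partial>lborel) \<partial>lborel)"
    by (rule lborel_pair.Fubini_integral)
  moreover have "(\<integral>x. f x * g y * cis (- (2 * pi * x * y)) \<partial>lborel) = ft f y * g y" for y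
    unfolding ft_def by (simp add: mult_ac flip: integral_mult_right_zero)
  moreover have "(\<integral>y. f x * g y * cis (- (2 * pi * x * y)) \<partial>lborel) = f x * ft g x" for x
    unfolding ft_def by (simp add: mult_ac flip: integral_mult_right_zero)
  ultimately show ?thesis by simp
qed

lemma ft_modulation: "ft (\<lambda>t. f t * cis (2 * pi * t * s)) \<xi> = ft f (\<xi> - s)"
  unfolding ft_def by (intro Bochner_Integration.integral_cong refl) (simp add: mult.assoc cis_mult algebra_simps)

lemma ft_translation: "ft (\<lambda>t. f (t - l)) \<xi> = cis (- (2 * pi * l * \<xi>)) * ft f \<xi>"
proof -
  have "ft (\<lambda>t. f (t - l)) \<xi> = (\<integral>t. f (l + 1 * t - l) * cis (- (2 * pi * (l + 1 * t) * \<xi>)) \<partial>lborel)"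
    unfolding ft_def by (subst lborel_integral_real_affine[of 1 _ l]) auto
  also have "\<dots> = (\<integral>t. cis (- (2 * pi * l * \<xi>)) * (f t * cis (- (2 * pi * t * \<xi>))) \<partial>lborel)"
    by (intro Bochner_Integration.integral_cong refl) (simp add: cis_mult algebra_simps)
  finally show ?thesis by (simp add: ft_def)
qed

section \<open>Gaussians and the Plancherel inequality\<close>

definition gauss :: "real \<Rightarrow> real \<Rightarrow> real" where
  "gauss \<sigma> \<xi> = exp (- 2 * (pi * \<sigma> * \<xi>)\<^sup>2)"

lemma normal_density_scale:
  "\<sigma> > 0 \<Longrightarrow> \<sigma> * normal_density 0 \<sigma> (\<sigma> * x) = std_normal_density x"
  by (simp add: normal_density_def real_sqrt_mult power_mult_distrib)

lemma normal_density_commute: "normal_density 0 \<sigma> (x - y) = normal_density 0 \<sigma> (y - x)"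
  by (simp add: normal_density_def power2_commute)

text \<open>Rescaling by sigma reduces to the characteristic function of the standard normal law at
  -2 pi sigma xi.\<close>

lemma ft_normal_density:
  assumes "\<sigma> > 0"
  shows "ft (\<lambda>t. complex_of_real (normal_density 0 \<sigma> t)) \<xi> = complex_of_real (gauss \<sigma> \<xi>)"
proof -
  define s where "s = - (2 * pi * \<sigma> * \<xi>)"
  have "ft (\<lambda>t. complex_of_real (normal_density 0 \<sigma> t)) \<xi> =
    \<bar>\<sigma>\<bar> *\<^sub>R (\<integral>x. complex_of_real (normal_density 0 \<sigma> (0 + \<sigma> * x)) * cis (- (2 * pi * (0 + \<sigma> * x) * \<xi>)) \<partial>lborel)"
    unfolding ft_def using assms by (intro lborel_integral_real_affine) auto
  also have "\<dots> = (\<integral>x. \<sigma> *\<^sub>R (complex_of_real (normal_density 0 \<sigma> (0 + \<sigma> * x)) * cis (- (2 * pi * (0 + \<sigma> * x) * \<xi>))) \<partial>lborel)"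
    using assms by simp
  also have "\<dots> = (\<integral>x. std_normal_density x *\<^sub>R iexp (s * x) \<partial>lborel)"
  proof (intro Bochner_Integration.integral_cong refl)
    fix x
    have "\<sigma> * normal_density 0 \<sigma> (0 + \<sigma> * x) = std_normal_density x"
      using normal_density_scale[OF assms] by simp
    moreover have "cis (- (2 * pi * (0 + \<sigma> * x) * \<xi>)) = iexp (s * x)"
      by (simp add: s_def cis_conv_exp algebra_simps)
    ultimately show "\<sigma> *\<^sub>R (complex_of_real (normal_density 0 \<sigma> (0 + \<sigma> * x)) * cis (- (2 * pi * (0 + \<sigma> * x) * \<xi>))) = std_normal_density x *\<^sub>R iexp (s * x)"
      by (simp only: scaleR_conv_of_real mult.assoc[symmetric] of_real_mult[symmetric])
  qed
  also have "\<dots> = char std_normal_distribution s"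
    unfolding char_def by (subst integral_density) auto
  also have "\<dots> = complex_of_real (exp (- (s^2) / 2))" by (simp add: char_std_normal_distribution)
  also have "- (s^2) / 2 = - 2 * (pi * \<sigma> * \<xi>)\<^sup>2" by (simp add: s_def power2_eq_square)
  finally show ?thesis by (simp add: gauss_def)
qed

lemma gauss_as_normal_density:
  assumes "\<sigma> > 0"
  shows "gauss \<sigma> \<xi> = 1 / sqrt (2 * pi * \<sigma>\<^sup>2) * normal_density 0 (1 / (2 * pi * \<sigma>)) \<xi>"
proof -
  have "2 * pi * (1 / (2 * pi * \<sigma>))\<^sup>2 = 1 / (2 * pi * \<sigma>\<^sup>2)"
    using assms by (simp add: power2_eq_square field_simps)
  then have "1 / sqrt (2 * pi * (1 / (2 * pi * \<sigma>))\<^sup>2) = sqrt (2 * pi * \<sigma>\<^sup>2)"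
    by (simp add: real_sqrt_divide)
  moreover have "(\<xi> - 0)\<^sup>2 / (2 * (1 / (2 * pi * \<sigma>))\<^sup>2) = 2 * (pi * \<sigma> * \<xi>)\<^sup>2"
    using assms by (simp add: power2_eq_square field_simps)
  moreover have "sqrt (2 * pi * \<sigma>\<^sup>2) > 0" using assms by simp
  ultimately show ?thesis using assms by (simp add: gauss_def normal_density_def)
qed

lemma integrable_gauss: "\<sigma> > 0 \<Longrightarrow> integrable lborel (\<lambda>\<xi>. gauss \<sigma> \<xi>)"
  unfolding gauss_as_normal_density by (intro integrable_mult_right integrable_normal_density) auto

text \<open>Up to normalisation \<open>gauss \<sigma>\<close> is itself a normal density, of
  standard deviation 1 / (2 pi sigma), so this direction also comes from
  \<open>ft_normal_density\<close>.\<close>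

lemma ft_gauss:
  assumes "\<sigma> > 0"
  shows "ft (\<lambda>\<xi>. complex_of_real (gauss \<sigma> \<xi>)) t = complex_of_real (normal_density 0 \<sigma> t)"
proof -
  define c where "c = 1 / sqrt (2 * pi * \<sigma>\<^sup>2)"
  have "ft (\<lambda>\<xi>. complex_of_real (gauss \<sigma> \<xi>)) t = of_real c * ft (\<lambda>\<xi>. complex_of_real (normal_density 0 (1 / (2 * pi * \<sigma>)) \<xi>)) t"
    unfolding gauss_as_normal_density[OF assms] ft_def c_def[symmetric] by (simp add: mult.assoc)
  also have "\<dots> = of_real (c * gauss (1 / (2 * pi * \<sigma>)) t)"
    using assms by (subst ft_normal_density) auto
  also have "c * gauss (1 / (2 * pi * \<sigma>)) t = normal_density 0 \<sigma> t"
    using assms by (simp add: c_def gauss_def normal_density_def power2_eq_square field_simps)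
  finally show ?thesis .
qed

lemma gauss_measurable [measurable]: "gauss \<sigma> \<in> borel_measurable borel"
  unfolding gauss_def[abs_def] by measurable

lemma gauss_bounds: "0 < gauss \<sigma> \<xi>" "gauss \<sigma> \<xi> \<le> 1"
  by (auto simp: gauss_def)

lemma gauss_tendsto_1: "(\<lambda>n. gauss (1 / real (Suc n)) \<xi>) \<longlonglongrightarrow> 1"
proof -
  have "(\<lambda>n. exp (- 2 * (pi * (1 / real (Suc n)) * \<xi>)\<^sup>2)) \<longlonglongrightarrow> exp (- 2 * (pi * 0 * \<xi>)\<^sup>2)"
    using LIMSEQ_inverse_real_of_nat by (intro tendsto_intros) (simp add: inverse_eq_divide)
  then show ?thesis by (simp add: gauss_def)
qed

lemma nn_integral_normal_density_shift:
  assumes "\<sigma> > 0"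
  shows "(\<integral>\<^sup>+x. ennreal (normal_density 0 \<sigma> (x - y)) \<partial>lborel) = 1"
    and "(\<integral>\<^sup>+x. ennreal (normal_density 0 \<sigma> (y - x)) \<partial>lborel) = 1"
proof -
  have "normal_density 0 \<sigma> (x - y) = normal_density y \<sigma> x" "normal_density 0 \<sigma> (y - x) = normal_density y \<sigma> x" for x y
    by (auto simp: normal_density_def power2_commute)
  moreover have "(\<integral>\<^sup>+x. ennreal (normal_density y \<sigma> x) \<partial>lborel) = 1"
    using assms integrable_normal_density[OF assms, of y] integral_normal_density[OF assms, of y]
    by (subst nn_integral_eq_integral) auto
  ultimately show "(\<integral>\<^sup>+x. ennreal (normal_density 0 \<sigma> (x - y)) \<partial>lborel) = 1"
    "(\<integral>\<^sup>+x. ennreal (normal_density 0 \<sigma> (y - x)) \<partial>lborel) = 1" by simp_all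
qed

lemma normal_density_le_const: "normal_density 0 \<sigma> x \<le> normal_density 0 \<sigma> 0"
  by (simp add: normal_density_def divide_right_mono mult_left_le)

text \<open>The Gaussian makes the inverse transform absolutely convergent; the multiplication
  formula with a modulated Gaussian evaluates it as u smoothed by a normal density.\<close>

lemma ft_gauss_regularised:
  fixes u :: "real \<Rightarrow> complex"
  assumes u: "integrable lborel u" and \<sigma>: "\<sigma> > 0"
  shows "(\<integral>t. ft u t * (gauss \<sigma> t * cis (2 * pi * t * \<xi>)) \<partial>lborel) = (\<integral>\<eta>. u \<eta> * normal_density 0 \<sigma> (\<eta> - \<xi>) \<partial>lborel)"
proof -
  have "(\<integral>t. ft u t * (complex_of_real (gauss \<sigma> t) * cis (2 * pi * t * \<xi>)) \<partial>lborel) =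
    (\<integral>\<eta>. u \<eta> * ft (\<lambda>t. complex_of_real (gauss \<sigma> t) * cis (2 * pi * t * \<xi>)) \<eta> \<partial>lborel)"
    using integrable_gauss[OF \<sigma>] by (intro ft_multiplication u integrable_mult_unimodular) auto
  then show ?thesis by (simp add: ft_modulation ft_gauss[OF \<sigma>])
qed

text \<open>Use 2 a b <= a^2 + b^2 under the integral; each half then integrates the kernel over one
  variable to 1.\<close>

lemma schur_normal_density:
  fixes u :: "real \<Rightarrow> complex"
  assumes [measurable]: "u \<in> borel_measurable borel" and \<sigma>: "\<sigma> > 0"
  shows "(\<integral>\<^sup>+\<xi>. \<integral>\<^sup>+\<eta>. ennreal (norm (u \<xi>) * norm (u \<eta>) * normal_density 0 \<sigma> (\<eta> - \<xi>)) \<partial>lborel \<partial>lborel)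
    \<le> (\<integral>\<^sup>+\<xi>. ennreal ((norm (u \<xi>))\<^sup>2) \<partial>lborel)"
proof -
  define N where "N x = normal_density 0 \<sigma> x" for x
  have N0: "N x \<ge> 0" for x by (simp add: N_def)
  have [measurable]: "N \<in> borel_measurable borel" unfolding N_def[abs_def] by measurable
  have "(\<integral>\<^sup>+\<xi>. \<integral>\<^sup>+\<eta>. ennreal (norm (u \<xi>) * norm (u \<eta>) * N (\<eta> - \<xi>)) \<partial>lborel \<partial>lborel)
    \<le> (\<integral>\<^sup>+\<xi>. \<integral>\<^sup>+\<eta>. (ennreal ((norm (u \<xi>))\<^sup>2 / 2) * ennreal (N (\<eta> - \<xi>)) + ennreal ((norm (u \<eta>))\<^sup>2 / 2) * ennreal (N (\<eta> - \<xi>))) \<partial>lborel \<partial>lborel)"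
  proof (intro nn_integral_mono)
    fix \<xi> \<eta>
    have "norm (u \<xi>) * norm (u \<eta>) \<le> (norm (u \<xi>))\<^sup>2 / 2 + (norm (u \<eta>))\<^sup>2 / 2"
      using sum_squares_bound[of "norm (u \<xi>)" "norm (u \<eta>)"] by simp
    from mult_right_mono[OF this N0[of "\<eta> - \<xi>"]]
    have "norm (u \<xi>) * norm (u \<eta>) * N (\<eta> - \<xi>) \<le> (norm (u \<xi>))\<^sup>2 / 2 * N (\<eta> - \<xi>) + (norm (u \<eta>))\<^sup>2 / 2 * N (\<eta> - \<xi>)"
      by (simp only: distrib_right)
    then show "ennreal (norm (u \<xi>) * norm (u \<eta>) * N (\<eta> - \<xi>)) \<le> ennreal ((norm (u \<xi>))\<^sup>2 / 2) * ennreal (N (\<eta> - \<xi>)) + ennreal ((norm (u \<eta>))\<^sup>2 / 2) * ennreal (N (\<eta> - \<xi>))"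
      using N0 by (simp add: ennreal_leI flip: ennreal_mult ennreal_plus)
  qed
  also have "\<dots> = (\<integral>\<^sup>+\<xi>. (\<integral>\<^sup>+\<eta>. ennreal ((norm (u \<xi>))\<^sup>2 / 2) * ennreal (N (\<eta> - \<xi>)) \<partial>lborel) \<partial>lborel)
     + (\<integral>\<^sup>+\<xi>. (\<integral>\<^sup>+\<eta>. ennreal ((norm (u \<eta>))\<^sup>2 / 2) * ennreal (N (\<eta> - \<xi>)) \<partial>lborel) \<partial>lborel)"
    by (subst nn_integral_add, measurable, subst nn_integral_add, measurable)
  also have "(\<integral>\<^sup>+\<xi>. (\<integral>\<^sup>+\<eta>. ennreal ((norm (u \<eta>))\<^sup>2 / 2) * ennreal (N (\<eta> - \<xi>)) \<partial>lborel) \<partial>lborel)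
     = (\<integral>\<^sup>+\<eta>. (\<integral>\<^sup>+\<xi>. ennreal ((norm (u \<eta>))\<^sup>2 / 2) * ennreal (N (\<eta> - \<xi>)) \<partial>lborel) \<partial>lborel)"
    by (intro lborel_pair.Fubini') measurable
  also have "(\<lambda>\<xi>. \<integral>\<^sup>+\<eta>. ennreal ((norm (u \<xi>))\<^sup>2 / 2) * ennreal (N (\<eta> - \<xi>)) \<partial>lborel) = (\<lambda>\<xi>. ennreal ((norm (u \<xi>))\<^sup>2 / 2))"
    using nn_integral_normal_density_shift(1)[OF \<sigma>] by (simp add: nn_integral_cmult N_def)
  also have "(\<lambda>\<eta>. \<integral>\<^sup>+\<xi>. ennreal ((norm (u \<eta>))\<^sup>2 / 2) * ennreal (N (\<eta> - \<xi>)) \<partial>lborel) = (\<lambda>\<xi>. ennreal ((norm (u \<xi>))\<^sup>2 / 2))"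
    using nn_integral_normal_density_shift(2)[OF \<sigma>] by (simp add: nn_integral_cmult N_def)
  also have "(\<integral>\<^sup>+\<xi>. ennreal ((norm (u \<xi>))\<^sup>2 / 2) \<partial>lborel) + (\<integral>\<^sup>+\<xi>. ennreal ((norm (u \<xi>))\<^sup>2 / 2) \<partial>lborel)
    = (\<integral>\<^sup>+\<xi>. ennreal ((norm (u \<xi>))\<^sup>2) \<partial>lborel)"
    by (subst nn_integral_add[symmetric]) (auto simp flip: ennreal_plus)
  finally show ?thesis by (simp add: N_def)
qed

text \<open>
  Only the inequality half of Plancherel's theorem is needed; after inserting a Gaussian it is
  Schur's test for a positive kernel of total mass 1.
\<close>

lemma plancherel_gauss_bound:
  assumes u: "integrable lborel u" and \<sigma>: "\<sigma> > 0"
  shows "(\<integral>\<^sup>+t. ennreal ((norm (ft u t))\<^sup>2 * gauss \<sigma> t) \<partial>lborel) \<le> (\<integral>\<^sup>+\<xi>. ennreal ((norm (u \<xi>))\<^sup>2) \<partial>lborel)"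
proof -
  have um[measurable]: "u \<in> borel_measurable borel" using borel_measurable_integrable[OF u] by simp
  \<comment> \<open>\<open>h\<close> is chosen so that \<open>ft u t * h t\<close> is the
    nonnegative integrand. The multiplication formula then moves the transform onto
    \<open>h\<close>, where it is the conjugate of u smoothed by a normal density.\<close>
  define h where "h t = complex_of_real (gauss \<sigma> t) * cnj (ft u t)" for t
  define C where "C = (\<integral>t. norm (u t) \<partial>lborel)"
  have C: "norm (ft u t) \<le> C" for t unfolding C_def by (rule norm_ft_le[OF u])
  have hi: "integrable lborel h"
  proof (rule Bochner_Integration.integrable_bound[of lborel "\<lambda>t. C * gauss \<sigma> t"])
    show "AE t in lborel. norm (h t) \<le> norm (C * gauss \<sigma> t)"
      using C gauss_bounds(1)[of \<sigma>] norm_ge_zero order_trans[OF norm_ge_zero C]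
      by (intro AE_I2) (auto simp: h_def norm_mult abs_mult less_imp_le mult.commute intro!: mult_mono)
    show "h \<in> borel_measurable lborel" unfolding h_def[abs_def] by measurable
  qed (use integrable_gauss[OF \<sigma>] in auto)
  have eqh: "ft u t * h t = complex_of_real ((norm (ft u t))\<^sup>2 * gauss \<sigma> t)" for t
    by (simp add: h_def complex_norm_square mult_ac del: of_real_power)
  have fth: "norm (ft h \<xi>) \<le> (\<integral>\<eta>. norm (u \<eta>) * normal_density 0 \<sigma> (\<eta> - \<xi>) \<partial>lborel)" for \<xi>
  proof -
    have "ft h \<xi> = cnj (\<integral>t. ft u t * (complex_of_real (gauss \<sigma> t) * cis (2 * pi * t * \<xi>)) \<partial>lborel)"
      unfolding ft_def[of h] Bochner_Integration.integral_cnj[symmetric]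
      by (intro Bochner_Integration.integral_cong refl) (simp add: h_def cis_cnj mult_ac)
    also have "\<dots> = cnj (\<integral>\<eta>. u \<eta> * normal_density 0 \<sigma> (\<eta> - \<xi>) \<partial>lborel)"
      by (simp only: ft_gauss_regularised[OF u \<sigma>])
    finally have "norm (ft h \<xi>) = norm (\<integral>\<eta>. u \<eta> * normal_density 0 \<sigma> (\<eta> - \<xi>) \<partial>lborel)" by simp
    also have "\<dots> \<le> (\<integral>\<eta>. norm (u \<eta> * normal_density 0 \<sigma> (\<eta> - \<xi>)) \<partial>lborel)" by (rule integral_norm_bound)
    finally show ?thesis by (simp add: norm_mult)
  qed
  have uN: "integrable lborel (\<lambda>\<eta>. norm (u \<eta>) * normal_density 0 \<sigma> (\<eta> - \<xi>))" for \<xi>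
    by (rule Bochner_Integration.integrable_bound[of lborel "\<lambda>\<eta>. normal_density 0 \<sigma> 0 * norm (u \<eta>)"])
       (use u in \<open>auto intro!: mult_mono normal_density_le_const AE_I2 simp: abs_mult mult.commute\<close>)
  have "(\<integral>\<^sup>+t. ennreal ((norm (ft u t))\<^sup>2 * gauss \<sigma> t) \<partial>lborel) = ennreal (\<integral>t. (norm (ft u t))\<^sup>2 * gauss \<sigma> t \<partial>lborel)"
  proof (rule nn_integral_eq_integral)
    have "integrable lborel (\<lambda>t. ft u t * h t)"
      by (rule Bochner_Integration.integrable_bound[of lborel "\<lambda>t. C * norm (h t)"])
         (use hi C order_trans[OF norm_ge_zero C] in \<open>auto simp: norm_mult intro!: mult_right_mono AE_I2\<close>)
    then have "integrable lborel (\<lambda>t. Re (ft u t * h t))" by (rule integrable_Re)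
    moreover have "Re (ft u t * h t) = (norm (ft u t))\<^sup>2 * gauss \<sigma> t" for t
      by (simp only: eqh Re_complex_of_real)
    ultimately show "integrable lborel (\<lambda>t. (norm (ft u t))\<^sup>2 * gauss \<sigma> t)" by simp
  qed (use gauss_bounds[of \<sigma>] in \<open>auto simp: less_imp_le\<close>)
  also have "\<dots> \<le> ennreal (\<integral>t. norm (u t) * norm (ft h t) \<partial>lborel)"
  proof (rule ennreal_leI)
    define X where "X = (\<integral>t. (norm (ft u t))\<^sup>2 * gauss \<sigma> t \<partial>lborel)"
    have "complex_of_real X = (\<integral>t. ft u t * h t \<partial>lborel)"
      unfolding X_def integral_complex_of_real[symmetric] by (simp only: eqh)
    also have "\<dots> = (\<integral>t. u t * ft h t \<partial>lborel)" by (rule ft_multiplication[OF u hi])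
    finally have "norm (complex_of_real X) \<le> (\<integral>t. norm (u t) * norm (ft h t) \<partial>lborel)"
      using integral_norm_bound[of lborel "\<lambda>t. u t * ft h t"] by (simp add: norm_mult)
    then show "X \<le> (\<integral>t. norm (u t) * norm (ft h t) \<partial>lborel)" by simp
  qed
  also have "\<dots> = (\<integral>\<^sup>+t. ennreal (norm (u t) * norm (ft h t)) \<partial>lborel)"
  proof (rule nn_integral_eq_integral[symmetric])
    have [measurable]: "h \<in> borel_measurable borel" using borel_measurable_integrable[OF hi] by simp
    show "integrable lborel (\<lambda>t. norm (u t) * norm (ft h t))"
      by (rule Bochner_Integration.integrable_bound[of lborel "\<lambda>t. (\<integral>t. norm (h t) \<partial>lborel) * norm (u t)"])
         (use u norm_ft_le[OF hi] in \<open>auto intro!: mult_mono AE_I2 simp: abs_mult mult.commute\<close>)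
  qed auto
  also have "\<dots> \<le> (\<integral>\<^sup>+\<xi>. \<integral>\<^sup>+\<eta>. ennreal (norm (u \<xi>) * norm (u \<eta>) * normal_density 0 \<sigma> (\<eta> - \<xi>)) \<partial>lborel \<partial>lborel)"
  proof (intro nn_integral_mono)
    fix \<xi>
    have "ennreal (norm (u \<xi>) * norm (ft h \<xi>)) \<le> ennreal (norm (u \<xi>) * (\<integral>\<eta>. norm (u \<eta>) * normal_density 0 \<sigma> (\<eta> - \<xi>) \<partial>lborel))"
      by (intro ennreal_leI mult_left_mono fth) auto
    also have "\<dots> = ennreal (\<integral>\<eta>. norm (u \<xi>) * (norm (u \<eta>) * normal_density 0 \<sigma> (\<eta> - \<xi>)) \<partial>lborel)" by simp
    also have "\<dots> = (\<integral>\<^sup>+\<eta>. ennreal (norm (u \<xi>) * (norm (u \<eta>) * normal_density 0 \<sigma> (\<eta> - \<xi>))) \<partial>lborel)"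
      by (rule nn_integral_eq_integral[symmetric]) (use uN in auto)
    finally show "ennreal (norm (u \<xi>) * norm (ft h \<xi>)) \<le> (\<integral>\<^sup>+\<eta>. ennreal (norm (u \<xi>) * norm (u \<eta>) * normal_density 0 \<sigma> (\<eta> - \<xi>)) \<partial>lborel)"
      by (simp add: mult.assoc)
  qed
  also have "\<dots> \<le> (\<integral>\<^sup>+\<xi>. ennreal ((norm (u \<xi>))\<^sup>2) \<partial>lborel)" by (rule schur_normal_density[OF um \<sigma>])
  finally show ?thesis .
qed

text \<open>Let sigma = 1 / (n + 1) tend to 0 in the Gaussian bound; Fatou gives the
  inequality.\<close>

lemma plancherel_bound:
  assumes u: "integrable lborel u"
  shows "(\<integral>\<^sup>+t. ennreal ((norm (ft u t))\<^sup>2) \<partial>lborel) \<le> (\<integral>\<^sup>+\<xi>. ennreal ((norm (u \<xi>))\<^sup>2) \<partial>lborel)"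
proof -
  have [measurable]: "u \<in> borel_measurable borel" using borel_measurable_integrable[OF u] by simp
  define G where "G n t = ennreal ((norm (ft u t))\<^sup>2 * gauss (1 / real (Suc n)) t)" for n t
  have lim: "(\<lambda>n. G n t) \<longlonglongrightarrow> ennreal ((norm (ft u t))\<^sup>2)" for t
    unfolding G_def using tendsto_mult[OF tendsto_const gauss_tendsto_1, of "(norm (ft u t))\<^sup>2" t]
    by (intro tendsto_ennrealI) simp
  have "(\<integral>\<^sup>+t. ennreal ((norm (ft u t))\<^sup>2) \<partial>lborel) = (\<integral>\<^sup>+t. liminf (\<lambda>n. G n t) \<partial>lborel)"
    by (intro nn_integral_cong) (simp add: lim_imp_Liminf[OF trivial_limit_sequentially lim])
  also have "\<dots> \<le> liminf (\<lambda>n. \<integral>\<^sup>+t. G n t \<partial>lborel)"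
    by (rule nn_integral_liminf) (simp add: G_def)
  also have "\<dots> \<le> (\<integral>\<^sup>+\<xi>. ennreal ((norm (u \<xi>))\<^sup>2) \<partial>lborel)"
  proof (rule Liminf_le)
    show "\<forall>\<^sub>F n in sequentially. (\<integral>\<^sup>+t. G n t \<partial>lborel) \<le> (\<integral>\<^sup>+\<xi>. ennreal ((norm (u \<xi>))\<^sup>2) \<partial>lborel)"
      unfolding G_def by (intro always_eventually allI plancherel_gauss_bound u) simp
  qed simp
  finally show ?thesis .
qed

section \<open>Integrable transforms from one derivative\<close>

lemma integrable_exp_neg_abs:
  assumes "c > 0"
  shows "integrable lborel (\<lambda>x::real. exp (- (c * \<bar>x\<bar>)))"
proof -
  have 1: "integrable lborel (\<lambda>x. indicator {0<..} x *\<^sub>R exp (- (x * c)))"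
    using integrable_I0i_exp_mscale[OF assms] by (simp add: set_integrable_def)
  then have 2: "integrable lborel (\<lambda>x. indicator {0<..} (0 + (-1) * x) *\<^sub>R exp (- ((0 + (-1) * x) * c)))"
    by (rule lborel_integrable_real_affine) simp
  have "integrable lborel (\<lambda>x. indicator {0<..} x *\<^sub>R exp (- (x * c)) + indicator {0<..} (0 + (-1) * x) *\<^sub>R exp (- ((0 + (-1) * x) * c)))"
    by (rule Bochner_Integration.integrable_add[OF 1 2])
  then show ?thesis
  proof (rule Bochner_Integration.integrable_bound)
    show "AE x in lborel. norm (exp (- (c * \<bar>x\<bar>))) \<le> norm (indicator {0<..} x *\<^sub>R exp (- (x * c)) + indicator {0<..} (0 + (-1) * x) *\<^sub>R exp (- ((0 + (-1) * x) * c)))"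
      using AE_lborel_singleton[of "0::real"]
      by eventually_elim (auto simp: indicator_def abs_if mult.commute)
  qed simp
qed

lemma integrable_Cauchy_density: "integrable lborel (\<lambda>t::real. 1 / (1 + t\<^sup>2))"
proof -
  have "einterval (-\<infinity>) \<infinity> = UNIV" by (auto simp: einterval_def)
  then show ?thesis
    using integrable_inverse_1_plus_square by (simp add: set_integrable_def inverse_eq_divide)
qed

text \<open>The function \<open>v\<close> may have a corner at 0, where \<open>D\<close> takes the arbitrary value 0.\<close>

locale sobolev_function =
  fixes v D :: "real \<Rightarrow> complex" and M :: real and \<rho> :: "real \<Rightarrow> real"
  assumes cont: "continuous_on UNIV v"
    and deriv: "\<And>\<xi>. \<xi> \<noteq> 0 \<Longrightarrow> (v has_vector_derivative D \<xi>) (at \<xi>)"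
    and D0: "D 0 = 0"
    and decay: "\<And>\<xi>. norm (v \<xi>) \<le> M * exp (- \<bar>\<xi>\<bar>)" "\<And>\<xi>. norm (D \<xi>) \<le> M * exp (- \<bar>\<xi>\<bar>)"
    and \<rho>: "integrable lborel \<rho>" "\<And>\<xi>. (norm (v \<xi>))\<^sup>2 + (norm (D \<xi>))\<^sup>2 \<le> \<rho> \<xi>"
begin

lemma v_measurable [measurable]: "v \<in> borel_measurable borel"
  by (rule borel_measurable_continuous_onI[OF cont])

text \<open>\<open>D\<close> is given pointwise only, so it is exhibited as a limit of difference
  quotients, with the sequence set to \<open>D 0 = 0\<close> at the corner.\<close>

lemma D_measurable [measurable]: "D \<in> borel_measurable borel"
proof (rule borel_measurable_LIMSEQ_metric)
  fix n :: nat
  show "(\<lambda>\<xi>. if \<xi> = 0 then 0 else (v (\<xi> + 1 / real (Suc n)) - v \<xi>) /\<^sub>R (1 / real (Suc n))) \<in> borel_measurable borel"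
    by measurable
next
  fix \<xi> :: real
  show "(\<lambda>n. if \<xi> = 0 then 0 else (v (\<xi> + 1 / real (Suc n)) - v \<xi>) /\<^sub>R (1 / real (Suc n))) \<longlonglongrightarrow> D \<xi>"
  proof (cases "\<xi> = 0")
    case False
    have "((\<lambda>h. (v (\<xi> + h) - v \<xi>) /\<^sub>R h) \<longlongrightarrow> D \<xi>) (at 0)"
    proof (rule LIM_zero_cancel, rule tendsto_norm_zero_cancel)
      have "((\<lambda>h. norm (v (\<xi> + h) - v \<xi> - h *\<^sub>R D \<xi>) / norm h) \<longlongrightarrow> 0) (at 0)"
        using deriv[OF False] by (simp add: has_vector_derivative_def has_derivative_at)
      then show "((\<lambda>h. norm ((v (\<xi> + h) - v \<xi>) /\<^sub>R h - D \<xi>)) \<longlongrightarrow> 0) (at 0)"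
      proof (rule Lim_transform_eventually)
        have "norm (v (\<xi> + h) - v \<xi> - h *\<^sub>R D \<xi>) / norm h = norm ((v (\<xi> + h) - v \<xi>) /\<^sub>R h - D \<xi>)"
          if "h \<noteq> 0" for h :: real
        proof -
          have "(v (\<xi> + h) - v \<xi>) /\<^sub>R h - D \<xi> = (v (\<xi> + h) - v \<xi> - h *\<^sub>R D \<xi>) /\<^sub>R h"
            using that by (simp add: scaleR_diff_right)
          then show ?thesis by (simp add: divide_inverse mult.commute)
        qed
        then show "\<forall>\<^sub>F h in at 0. norm (v (\<xi> + h) - v \<xi> - h *\<^sub>R D \<xi>) / norm h = norm ((v (\<xi> + h) - v \<xi>) /\<^sub>R h - D \<xi>)"
          by (simp add: eventually_at_filter)
      qed
    qed
    moreover have "filterlim (\<lambda>n. 1 / real (Suc n)) (at 0) sequentially"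
      using LIMSEQ_inverse_real_of_nat by (auto simp: filterlim_at inverse_eq_divide)
    ultimately show ?thesis using False by (auto dest: filterlim_compose)
  qed (simp add: D0)
qed

lemma M_exp_integrable: "integrable lborel (\<lambda>\<xi>. M * exp (- \<bar>\<xi>\<bar>))"
  using integrable_exp_neg_abs[of 1] by simp

lemma M_nonneg: "M \<ge> 0"
  using order_trans[OF norm_ge_zero decay(1)[of 0]] by simp

lemma v_integrable: "integrable lborel v"
  by (rule Bochner_Integration.integrable_bound[OF M_exp_integrable])
     (use decay M_nonneg in \<open>auto simp: abs_mult\<close>)

lemma D_integrable: "integrable lborel D"
  by (rule Bochner_Integration.integrable_bound[OF M_exp_integrable])
     (use decay M_nonneg in \<open>auto simp: abs_mult\<close>)

lemma ft_derivative: "ft D t = 2 * pi * \<i> * t * ft v t"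
proof -
  define e where "e \<xi> = cis (- (2 * pi * \<xi> * t))" for \<xi>
  define W where "W \<xi> = v \<xi> * e \<xi>" for \<xi>
  define w where "w \<xi> = D \<xi> * e \<xi> + (- (2 * pi * \<i> * t)) * (v \<xi> * e \<xi>)" for \<xi>
  have i1: "integrable lborel (\<lambda>\<xi>. D \<xi> * e \<xi>)" and i2: "integrable lborel (\<lambda>\<xi>. v \<xi> * e \<xi>)"
    unfolding e_def by (intro integrable_ft_integrand D_integrable v_integrable)+
  then have wi: "integrable lborel w" unfolding w_def by (intro Bochner_Integration.integrable_add integrable_mult_right)
  have [measurable]: "w \<in> borel_measurable borel" using borel_measurable_integrable[OF wi] by simp
  have e': "(e has_vector_derivative (- (2 * pi * \<i> * t)) * e \<xi>) (at \<xi>)" for \<xi>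
  proof -
    have "((\<lambda>\<xi>. exp (\<i> * (complex_of_real (- (2 * pi * t)) * complex_of_real \<xi>))) has_vector_derivative
       (\<i> * complex_of_real (- (2 * pi * t))) * exp (\<i> * (complex_of_real (- (2 * pi * t)) * complex_of_real \<xi>))) (at \<xi>)"
      by (rule has_vector_derivative_real_field) (auto intro!: derivative_eq_intros)
    then show ?thesis by (simp add: e_def[abs_def] cis_conv_exp mult_ac)
  qed
  have W': "(W has_vector_derivative w \<xi>) (at \<xi>)" if "\<xi> \<noteq> 0" for \<xi>
    unfolding W_def w_def
    by (rule has_vector_derivative_eq_rhs[OF has_vector_derivative_mult[OF deriv[OF that] e']]) (simp add: algebra_simps)
  have contW: "continuous_on S W" for S
    unfolding W_def e_def by (intro continuous_intros continuous_on_subset[OF cont]) auto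
  have int: "(\<integral>\<xi>. indicator {- real n..real n} \<xi> *\<^sub>R w \<xi> \<partial>lborel) = W (real n) - W (- real n)" for n :: nat
  proof -
    have "(w has_integral W (real n) - W (- real n)) {- real n..real n}"
      by (rule fundamental_theorem_of_calculus_interior_strong[where S = "{0}"]) (use W' contW in auto)
    then have "integral {- real n..real n} w = W (real n) - W (- real n)" by (rule integral_unique)
    moreover have "set_integrable lborel {- real n..real n} w"
      unfolding set_integrable_def using wi by (intro integrable_mult_indicator) auto
    then have "(LINT \<xi>:{- real n..real n}|lborel. w \<xi>) = integral {- real n..real n} w"
      by (rule set_borel_integral_eq_integral(2))
    ultimately show ?thesis by (simp add: set_lebesgue_integral_def)
  qed
  have "(\<lambda>n. \<integral>\<xi>. indicator {- real n..real n} \<xi> *\<^sub>R w \<xi> \<partial>lborel) \<longlonglongrightarrow> (\<integral>\<xi>. w \<xi> \<partial>lborel)"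
  proof (rule integral_dominated_convergence[where w = "\<lambda>\<xi>. norm (w \<xi>)"])
    show "AE \<xi> in lborel. (\<lambda>n. indicator {- real n..real n} \<xi> *\<^sub>R w \<xi>) \<longlonglongrightarrow> w \<xi>"
    proof (intro AE_I2 tendsto_eventually)
      fix \<xi> :: real
      obtain N :: nat where "\<bar>\<xi>\<bar> \<le> real N" using real_arch_simple by blast
      then show "\<forall>\<^sub>F n in sequentially. indicator {- real n..real n} \<xi> *\<^sub>R w \<xi> = w \<xi>"
        unfolding eventually_sequentially by (intro exI[of _ N]) (auto simp: indicator_def)
    qed
  qed (use wi in \<open>auto split: split_indicator\<close>)
  moreover have "(\<lambda>n. W (real n) - W (- real n)) \<longlonglongrightarrow> 0"
  proof (rule tendsto_0_le[where K = 1])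
    have "(\<lambda>n. exp (- real n)) \<longlonglongrightarrow> 0" by real_asymp
    from tendsto_mult[OF tendsto_const this, of "2 * M"]
    show "(\<lambda>n. 2 * M * exp (- real n)) \<longlonglongrightarrow> 0" by simp
    show "\<forall>\<^sub>F n in sequentially. norm (W (real n) - W (- real n)) \<le> norm (2 * M * exp (- real n)) * 1"
    proof (intro always_eventually allI)
      fix n
      have "norm (W (real n) - W (- real n)) \<le> norm (W (real n)) + norm (W (- real n))" by (rule norm_triangle_ineq4)
      also have "\<dots> \<le> M * exp (- \<bar>real n\<bar>) + M * exp (- \<bar>- real n\<bar>)"
        using decay(1)[of "real n"] decay(1)[of "- real n"] by (intro add_mono) (auto simp: W_def e_def norm_mult)
      finally show "norm (W (real n) - W (- real n)) \<le> norm (2 * M * exp (- real n)) * 1"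
        using M_nonneg by simp
    qed
  qed
  ultimately have "(\<integral>\<xi>. w \<xi> \<partial>lborel) = 0" unfolding int by (rule LIMSEQ_unique)
  moreover have "(\<integral>\<xi>. w \<xi> \<partial>lborel) = ft D t - (2 * pi * \<i> * t) * ft v t"
    unfolding w_def using i1 i2 by (simp add: ft_def e_def)
  ultimately show ?thesis by simp
qed

text \<open>Plancherel for v and for its derivative: since 2 pi >= 1, |t| |ft v t| is at most |ft D
  t|.\<close>

lemma nn_integral_weighted_ft_le:
  "(\<integral>\<^sup>+t. ennreal ((1 + t\<^sup>2) * (norm (ft v t))\<^sup>2) \<partial>lborel) \<le> ennreal (\<integral>\<xi>. \<rho> \<xi> \<partial>lborel)"
proof -
  have [measurable]: "\<rho> \<in> borel_measurable borel" using borel_measurable_integrable[OF \<rho>(1)] by simp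
  have "(\<integral>\<^sup>+t. ennreal ((1 + t\<^sup>2) * (norm (ft v t))\<^sup>2) \<partial>lborel)
     \<le> (\<integral>\<^sup>+t. ennreal ((norm (ft v t))\<^sup>2) + ennreal ((norm (ft D t))\<^sup>2) \<partial>lborel)"
  proof (intro nn_integral_mono)
    fix t :: real
    have "norm (ft D t) = 2 * pi * \<bar>t\<bar> * norm (ft v t)" by (simp add: ft_derivative norm_mult)
    then have "(norm (ft D t))\<^sup>2 = (2 * pi)\<^sup>2 * (t\<^sup>2 * (norm (ft v t))\<^sup>2)" by (simp add: power_mult_distrib)
    moreover have "1 * (t\<^sup>2 * (norm (ft v t))\<^sup>2) \<le> (2 * pi)\<^sup>2 * (t\<^sup>2 * (norm (ft v t))\<^sup>2)"
      using pi_gt3 by (intro mult_right_mono one_le_power) auto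
    ultimately have "(1 + t\<^sup>2) * (norm (ft v t))\<^sup>2 \<le> (norm (ft v t))\<^sup>2 + (norm (ft D t))\<^sup>2"
      by (simp add: algebra_simps)
    then show "ennreal ((1 + t\<^sup>2) * (norm (ft v t))\<^sup>2) \<le> ennreal ((norm (ft v t))\<^sup>2) + ennreal ((norm (ft D t))\<^sup>2)"
      by (simp add: ennreal_leI flip: ennreal_plus)
  qed
  also have "\<dots> = (\<integral>\<^sup>+t. ennreal ((norm (ft v t))\<^sup>2) \<partial>lborel) + (\<integral>\<^sup>+t. ennreal ((norm (ft D t))\<^sup>2) \<partial>lborel)"
    by (rule nn_integral_add) auto
  also have "\<dots> \<le> (\<integral>\<^sup>+t. ennreal ((norm (v t))\<^sup>2) \<partial>lborel) + (\<integral>\<^sup>+t. ennreal ((norm (D t))\<^sup>2) \<partial>lborel)"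
    by (intro add_mono plancherel_bound v_integrable D_integrable)
  also have "\<dots> = (\<integral>\<^sup>+t. ennreal ((norm (v t))\<^sup>2) + ennreal ((norm (D t))\<^sup>2) \<partial>lborel)"
    by (rule nn_integral_add[symmetric]) auto
  also have "\<dots> \<le> (\<integral>\<^sup>+t. ennreal (\<rho> t) \<partial>lborel)"
    using \<rho>(2) by (intro nn_integral_mono) (simp add: ennreal_leI flip: ennreal_plus)
  also have "\<dots> = ennreal (\<integral>\<xi>. \<rho> \<xi> \<partial>lborel)"
    using \<rho> order_trans[OF _ \<rho>(2)] by (intro nn_integral_eq_integral) auto
  finally show ?thesis .
qed

text \<open>Cauchy-Schwarz against 1 / (1 + t^2), in the linearised form q <= s / (2 b) + b q^2 / (2
  s). The free parameter s is balanced later, and v is measured only by the integral of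
  \<rho>.\<close>

lemma ft_integrable_bound:
  shows "integrable lborel (ft v)"
    and "s > 0 \<Longrightarrow> (\<integral>t. norm (ft v t) \<partial>lborel) \<le> (s * (\<integral>t. 1 / (1 + t\<^sup>2) \<partial>lborel) + (\<integral>\<xi>. \<rho> \<xi> \<partial>lborel) / s) / 2"
proof -
  define I where "I = (\<integral>t. 1 / (1 + (t::real)\<^sup>2) \<partial>lborel)"
  have I0: "I \<ge> 0" unfolding I_def by (rule Bochner_Integration.integral_nonneg) auto
  have R0: "(\<integral>\<xi>. \<rho> \<xi> \<partial>lborel) \<ge> 0" using order_trans[OF _ \<rho>(2)] by (intro Bochner_Integration.integral_nonneg) auto
  have key: "(\<integral>\<^sup>+t. ennreal (norm (ft v t)) \<partial>lborel) \<le> ennreal ((s * I + (\<integral>\<xi>. \<rho> \<xi> \<partial>lborel) / s) / 2)" if s: "s > 0" for s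
  proof -
    have "(\<integral>\<^sup>+t. ennreal (norm (ft v t)) \<partial>lborel)
       \<le> (\<integral>\<^sup>+t. ennreal (s / 2) * ennreal (1 / (1 + t\<^sup>2)) + ennreal (1 / (2 * s)) * ennreal ((1 + t\<^sup>2) * (norm (ft v t))\<^sup>2) \<partial>lborel)"
    proof (intro nn_integral_mono)
      fix t :: real
      define q where "q = norm (ft v t)"
      define b where "b = 1 + t\<^sup>2"
      have b: "b > 0" by (simp add: b_def add_pos_nonneg)
      have "0 \<le> (s - b * q)\<^sup>2 / (2 * s * b)" using s b by simp
      also have "\<dots> = s / 2 * (1 / b) + 1 / (2 * s) * (b * q\<^sup>2) - q"
        using s b by (simp add: field_simps power2_eq_square)
      finally have "q \<le> s / 2 * (1 / b) + 1 / (2 * s) * (b * q\<^sup>2)" by simp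
      then show "ennreal (norm (ft v t)) \<le> ennreal (s / 2) * ennreal (1 / (1 + t\<^sup>2)) + ennreal (1 / (2 * s)) * ennreal ((1 + t\<^sup>2) * (norm (ft v t))\<^sup>2)"
        using s b unfolding b_def[symmetric] q_def[symmetric]
        by (simp add: ennreal_leI flip: ennreal_mult ennreal_plus)
    qed
    also have "\<dots> = ennreal (s / 2) * (\<integral>\<^sup>+t. ennreal (1 / (1 + t\<^sup>2)) \<partial>lborel) + ennreal (1 / (2 * s)) * (\<integral>\<^sup>+t. ennreal ((1 + t\<^sup>2) * (norm (ft v t))\<^sup>2) \<partial>lborel)"
      by (subst nn_integral_add) (auto simp: nn_integral_cmult)
    also have "(\<integral>\<^sup>+t. ennreal (1 / (1 + t\<^sup>2)) \<partial>lborel) = ennreal I"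
      unfolding I_def by (intro nn_integral_eq_integral integrable_Cauchy_density) auto
    also have "ennreal (s / 2) * ennreal I + ennreal (1 / (2 * s)) * (\<integral>\<^sup>+t. ennreal ((1 + t\<^sup>2) * (norm (ft v t))\<^sup>2) \<partial>lborel)
       \<le> ennreal (s / 2) * ennreal I + ennreal (1 / (2 * s)) * ennreal (\<integral>\<xi>. \<rho> \<xi> \<partial>lborel)"
      by (intro add_left_mono mult_left_mono nn_integral_weighted_ft_le) auto
    also have "\<dots> = ennreal ((s * I + (\<integral>\<xi>. \<rho> \<xi> \<partial>lborel) / s) / 2)"
      using s I0 R0 by (simp add: add_divide_distrib mult.commute flip: ennreal_mult ennreal_plus)
    finally show ?thesis .
  qed
  show int: "integrable lborel (ft v)"
  proof (rule integrableI_bounded)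
    show "(\<integral>\<^sup>+t. ennreal (norm (ft v t)) \<partial>lborel) < \<infinity>" using key[of 1] by (simp add: le_less_trans)
  qed simp
  assume s: "s > 0"
  have "ennreal (\<integral>t. norm (ft v t) \<partial>lborel) \<le> ennreal ((s * I + (\<integral>\<xi>. \<rho> \<xi> \<partial>lborel) / s) / 2)"
    using key[OF s] int by (subst (asm) nn_integral_eq_integral) auto
  then show "(\<integral>t. norm (ft v t) \<partial>lborel) \<le> (s * (\<integral>t. 1 / (1 + t\<^sup>2) \<partial>lborel) + (\<integral>\<xi>. \<rho> \<xi> \<partial>lborel) / s) / 2"
    using s I0 R0 by (subst (asm) ennreal_le_iff) (auto simp: I_def)
qed

end

subsection \<open>Density, translation continuity and inversion\<close>

lemma L1_dominated_convergence:
  fixes f :: "real \<Rightarrow> complex"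
  assumes f: "integrable lborel f" and s: "\<And>i. integrable lborel (s i)" and w: "integrable lborel w"
    and lim: "\<And>x. (\<lambda>i. s i x) \<longlonglongrightarrow> f x" and dom: "\<And>i x. norm (s i x) \<le> w x"
  shows "(\<lambda>i. \<integral>x. norm (f x - s i x) \<partial>lborel) \<longlonglongrightarrow> 0"
proof -
  have "(\<lambda>i. \<integral>x. norm (f x - s i x) \<partial>lborel) \<longlonglongrightarrow> (\<integral>x. 0 \<partial>(lborel :: real measure))"
  proof (rule integral_dominated_convergence[where w = "\<lambda>x. norm (f x) + w x"])
    show "AE x in lborel. (\<lambda>i. norm (f x - s i x)) \<longlonglongrightarrow> 0"
      using lim by (intro AE_I2) (auto intro!: tendsto_eq_intros)
    show "AE x in lborel. norm (norm (f x - s i x)) \<le> norm (f x) + w x" for i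
      using dom by (intro AE_I2) (auto intro: norm_triangle_le_diff order_trans[OF norm_triangle_ineq4])
  qed (use f s w in \<open>auto dest: borel_measurable_integrable\<close>)
  then show ?thesis by simp
qed

lemma integrable_interval_indicator:
  fixes c :: complex
  assumes "A \<in> sets borel"
  shows "integrable lborel (\<lambda>x. indicator (A \<inter> {a..b::real}) x *\<^sub>R c)"
proof -
  have "emeasure lborel (A \<inter> {a..b}) \<le> emeasure lborel {a..b}" by (intro emeasure_mono) auto
  also have "\<dots> < \<infinity>" using emeasure_lborel_Icc_eq[of a b] by auto
  finally show ?thesis using assms by (intro integrable_scaleR_left integrable_real_indicator) auto
qed

text \<open>Induction from intervals to all integrable functions. \<open>integrable_induct\<close>
  starts from sets of finite measure; Borel sets cut to [-n, n] are reached by Dynkin's argument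
  from half-lines, whose traces on [-n, n] are intervals. Closedness handles countable unions and
  removes the cut.\<close>

lemma L1_dense_induct:
  fixes P :: "(real \<Rightarrow> complex) \<Rightarrow> bool"
  assumes f: "integrable lborel f"
    and interval: "\<And>a b c. P (\<lambda>x. indicator {a..b::real} x *\<^sub>R c)"
    and add: "\<And>f g. integrable lborel f \<Longrightarrow> P f \<Longrightarrow> integrable lborel g \<Longrightarrow> P g \<Longrightarrow> P (\<lambda>x. f x + g x)"
    and closed: "\<And>f. integrable lborel f \<Longrightarrow>
      (\<And>e. e > 0 \<Longrightarrow> \<exists>g. integrable lborel g \<and> P g \<and> (\<integral>x. norm (f x - g x) \<partial>lborel) < e) \<Longrightarrow> P f"
  shows "P f"
proof -
  have limit: "P f" if f: "integrable lborel f" and s: "\<And>i. integrable lborel (s i)" and Ps: "\<And>i. P (s i)"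
    and w: "integrable lborel w" and lim: "\<And>x. (\<lambda>i. s i x) \<longlonglongrightarrow> f x" and dom: "\<And>i x. norm (s i x) \<le> w x"
    for f w and s :: "nat \<Rightarrow> real \<Rightarrow> complex"
  proof (rule closed[OF f])
    fix e :: real assume "e > 0"
    then have "\<forall>\<^sub>F i in sequentially. (\<integral>x. norm (f x - s i x) \<partial>lborel) < e"
      using order_tendstoD(2)[OF L1_dominated_convergence[OF f s w lim dom]] by blast
    then obtain i where "(\<integral>x. norm (f x - s i x) \<partial>lborel) < e"
      using eventually_happens'[OF trivial_limit_sequentially] by blast
    then show "\<exists>g. integrable lborel g \<and> P g \<and> (\<integral>x. norm (f x - g x) \<partial>lborel) < e" using s Ps by blast
  qed
  have bounded_set: "P (\<lambda>x. indicator (A \<inter> {- real n..real n}) x *\<^sub>R c)" if "A \<in> sets borel" for A n and c :: complex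
  proof -
    define I where "I = {- real n..real n}"
    have sb: "sigma_sets UNIV (range atMost) = sets (borel :: real measure)"
      unfolding borel_eq_atMost by (simp add: sets_measure_of)
    have int: "integrable lborel (\<lambda>x. indicator (A \<inter> I) x *\<^sub>R c)" if "A \<in> sets borel" for A and c :: complex
      unfolding I_def by (rule integrable_interval_indicator[OF that])
    have "\<forall>c. P (\<lambda>x. indicator (A \<inter> I) x *\<^sub>R c)"
    proof (rule sigma_sets_induct_disjoint[where G = "range (atMost :: real \<Rightarrow> real set)" and \<Omega> = UNIV and A = A
          and P = "\<lambda>A. \<forall>c. P (\<lambda>x. indicator (A \<inter> I) x *\<^sub>R c)"])
      show "A \<in> sigma_sets UNIV (range atMost)" using that sb by simp
      show "Int_stable (range (atMost :: real \<Rightarrow> real set))"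
        by (auto simp: Int_stable_def)
    next
      fix A assume "A \<in> range (atMost :: real \<Rightarrow> real set)"
      then obtain a where "A = {..a}" by auto
      then have "A \<inter> I = {- real n..min a (real n)}" by (auto simp: I_def)
      then show "\<forall>c. P (\<lambda>x. indicator (A \<inter> I) x *\<^sub>R c)" using interval by simp
    next
      \<comment> \<open>The interval from 1 to 0 is empty, so the interval case supplies the zero
        function.\<close>
      show "\<forall>c. P (\<lambda>x. indicator ({} \<inter> I) x *\<^sub>R c)" using interval[of 1 0] by simp
    next
      fix A assume A: "A \<in> sigma_sets UNIV (range atMost)" and IH: "\<forall>c. P (\<lambda>x. indicator (A \<inter> I) x *\<^sub>R c)"
      show "\<forall>c. P (\<lambda>x. indicator ((UNIV - A) \<inter> I) x *\<^sub>R c)"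
      proof
        fix c
        \<comment> \<open>A complement within I is I minus the set, a sum with coefficient -c, so
          additivity of P suffices.\<close>
        have "P (\<lambda>x. indicator I x *\<^sub>R c + indicator (A \<inter> I) x *\<^sub>R (- c))"
        proof (rule add)
          show "integrable lborel (\<lambda>x. indicator I x *\<^sub>R c)" using int[of UNIV c] by simp
          show "P (\<lambda>x. indicator I x *\<^sub>R c)" unfolding I_def by (rule interval)
          show "P (\<lambda>x. indicator (A \<inter> I) x *\<^sub>R (- c))" using IH by blast
          show "integrable lborel (\<lambda>x. indicator (A \<inter> I) x *\<^sub>R (- c))" using A sb by (intro int) simp
        qed
        moreover have "(\<lambda>x. indicator I x *\<^sub>R c + indicator (A \<inter> I) x *\<^sub>R (- c)) = (\<lambda>x. indicator ((UNIV - A) \<inter> I) x *\<^sub>R c)"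
          by (rule ext) (auto simp: indicator_def)
        ultimately show "P (\<lambda>x. indicator ((UNIV - A) \<inter> I) x *\<^sub>R c)" by simp
      qed
    next
      fix A :: "nat \<Rightarrow> real set"
      assume disj: "disjoint_family A" and A: "range A \<subseteq> sigma_sets UNIV (range atMost)"
        and IH: "\<And>i. \<forall>c. P (\<lambda>x. indicator (A i \<inter> I) x *\<^sub>R c)"
      have Ab: "A i \<in> sets borel" for i using A sb by auto
      show "\<forall>c. P (\<lambda>x. indicator (\<Union> (range A) \<inter> I) x *\<^sub>R c)"
      proof
        fix c :: complex
        have fin: "P (\<lambda>x. indicator ((\<Union>i<k. A i) \<inter> I) x *\<^sub>R c)" for k
        proof (induction k)
          case 0
          then show ?case using interval[of 1 0] by simp
        next
          case (Suc k)
          have "P (\<lambda>x. indicator ((\<Union>i<k. A i) \<inter> I) x *\<^sub>R c + indicator (A k \<inter> I) x *\<^sub>R c)"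
            using Suc IH Ab by (intro add int) auto
          moreover have "(\<lambda>x. indicator ((\<Union>i<k. A i) \<inter> I) x *\<^sub>R c + indicator (A k \<inter> I) x *\<^sub>R c)
             = (\<lambda>x. indicator ((\<Union>i<Suc k. A i) \<inter> I) x *\<^sub>R c)"
          proof
            fix x
            have "x \<notin> A i" if "x \<in> A k" "i < k" for i
              using disjoint_family_onD[OF disj, of i k] that by auto
            then show "indicator ((\<Union>i<k. A i) \<inter> I) x *\<^sub>R c + indicator (A k \<inter> I) x *\<^sub>R c = indicator ((\<Union>i<Suc k. A i) \<inter> I) x *\<^sub>R c"
              by (auto simp: indicator_def lessThan_Suc)
          qed
          ultimately show ?case by simp
        qed
        show "P (\<lambda>x. indicator (\<Union> (range A) \<inter> I) x *\<^sub>R c)"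
        proof (rule limit[where s = "\<lambda>k x. indicator ((\<Union>i<k. A i) \<inter> I) x *\<^sub>R c" and w = "\<lambda>x. norm (indicator (UNIV \<inter> I) x *\<^sub>R c)"])
          show "integrable lborel (\<lambda>x. norm (indicator (UNIV \<inter> I) x *\<^sub>R c))"
            by (rule integrable_norm[OF int]) simp
          show "integrable lborel (\<lambda>x. indicator (\<Union> (range A) \<inter> I) x *\<^sub>R c)"
            "integrable lborel (\<lambda>x. indicator ((\<Union>i<k. A i) \<inter> I) x *\<^sub>R c)" for k
            using Ab by (intro int sets.countable_UN sets.finite_UN; auto)+
          show "P (\<lambda>x. indicator ((\<Union>i<k. A i) \<inter> I) x *\<^sub>R c)" for k by (rule fin)
          show "norm (indicator ((\<Union>i<k. A i) \<inter> I) x *\<^sub>R c) \<le> norm (indicator (UNIV \<inter> I) x *\<^sub>R c)" for k x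
            by (auto simp: indicator_def)
          fix x
          show "(\<lambda>k. indicator ((\<Union>i<k. A i) \<inter> I) x *\<^sub>R c) \<longlonglongrightarrow> indicator (\<Union> (range A) \<inter> I) x *\<^sub>R c"
          proof (cases "\<exists>j. x \<in> A j")
            case True
            then obtain j where "x \<in> A j" by blast
            then have "indicator ((\<Union>i<k. A i) \<inter> I) x *\<^sub>R c = indicator (\<Union> (range A) \<inter> I) x *\<^sub>R c" if "k \<ge> Suc j" for k
              using that by (auto simp: indicator_def)
            then show ?thesis by (intro tendsto_eventually eventually_sequentiallyI)
          qed (auto simp: indicator_def)
        qed
      qed
    qed auto
    then show ?thesis by (simp add: I_def)
  qed
  show ?thesis
    using f
  proof (induction rule: integrable_induct)
    case (base A c)
    have Ab: "A \<in> sets borel" using base by simp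
    have Ai: "integrable lborel (\<lambda>x. indicator A x *\<^sub>R c)"
      using base by (intro integrable_scaleR_left integrable_real_indicator) auto
    show ?case
    proof (rule limit[where s = "\<lambda>n x. indicator (A \<inter> {- real n..real n}) x *\<^sub>R c" and w = "\<lambda>x. norm (indicator A x *\<^sub>R c)"])
      fix x :: real
      obtain N :: nat where N: "\<bar>x\<bar> \<le> real N" using real_arch_simple by blast
      have "indicator (A \<inter> {- real n..real n}) x *\<^sub>R c = indicator A x *\<^sub>R c" if "n \<ge> N" for n
        using N that by (auto simp: indicator_def)
      then show "(\<lambda>n. indicator (A \<inter> {- real n..real n}) x *\<^sub>R c) \<longlonglongrightarrow> indicator A x *\<^sub>R c"
        by (intro tendsto_eventually eventually_sequentiallyI)
    qed (use Ai bounded_set[OF Ab] integrable_interval_indicator[OF Ab] in \<open>auto simp: indicator_def simp del: norm_scaleR intro!: integrable_norm\<close>)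
  next
    case (add f g)
    then show ?case by (intro assms(3)) auto
  next
    case (lim f s)
    then show ?case by (intro limit[of f s "\<lambda>x. 2 * norm (f x)"]) auto
  qed
qed

section \<open>Translation continuity and convolutions as limits of translates\<close>

lemma nn_integral_interval_shift_le:
  "(\<integral>\<^sup>+t. ennreal \<bar>indicator {a..b} t - indicator {a..b} (t + s)\<bar> \<partial>lborel) \<le> ennreal (4 * \<bar>s::real\<bar>)"
proof -
  have "(\<integral>\<^sup>+t. ennreal \<bar>indicator {a..b} t - indicator {a..b} (t + s)\<bar> \<partial>lborel)
     \<le> (\<integral>\<^sup>+t. indicator {a - \<bar>s\<bar>..a + \<bar>s\<bar>} t + indicator {b - \<bar>s\<bar>..b + \<bar>s\<bar>} t \<partial>lborel)"
    by (intro nn_integral_mono) (auto simp: indicator_def)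
  also have "\<dots> = ennreal (2 * \<bar>s\<bar>) + ennreal (2 * \<bar>s\<bar>)"
    by (subst nn_integral_add) auto
  also have "\<dots> = ennreal (4 * \<bar>s\<bar>)" by (simp flip: ennreal_plus)
  finally show ?thesis .
qed

lemma integral_shift:
  fixes f :: "real \<Rightarrow> 'a::{banach, second_countable_topology}"
  shows "(\<integral>t. f (t - x) \<partial>lborel) = (\<integral>t. f t \<partial>lborel)"
  using lborel_integral_real_affine[of 1 f "- x"] by (simp add: algebra_simps)

lemma integrable_shift:
  fixes f :: "real \<Rightarrow> 'a::{banach, second_countable_topology}"
  shows "integrable lborel f \<Longrightarrow> integrable lborel (\<lambda>t. f (t - x))"
  using lborel_integrable_real_affine[of f 1 "- x"] by (simp add: algebra_simps)

lemma L1_shift_diff_le: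
  fixes f :: "real \<Rightarrow> complex"
  assumes f: "integrable lborel f"
  shows "(\<integral>t. norm (f (t - h) - f t) \<partial>lborel) \<le> 2 * (\<integral>t. norm (f t) \<partial>lborel)"
proof -
  have "(\<integral>t. norm (f (t - h) - f t) \<partial>lborel) \<le> (\<integral>t. norm (f (t - h)) + norm (f t) \<partial>lborel)"
    using f integrable_shift[OF f, of h] by (intro integral_mono) (auto intro: norm_triangle_ineq4)
  also have "\<dots> = (\<integral>t. norm (f (t - h)) \<partial>lborel) + (\<integral>t. norm (f t) \<partial>lborel)"
    using f integrable_shift[OF f, of h] by (intro Bochner_Integration.integral_add) auto
  also have "(\<integral>t. norm (f (t - h)) \<partial>lborel) = (\<integral>t. norm (f t) \<partial>lborel)"
    by (rule integral_shift[of "\<lambda>t. norm (f t)"])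
  finally show ?thesis by simp
qed

text \<open>Intervals are covered by the preceding estimate, limits by an e/3 argument. The filter
  \<open>nhds 0\<close>, including 0 itself, allows composition with sequences of shifts that may
  vanish.\<close>

lemma L1_translation_continuous:
  fixes f :: "real \<Rightarrow> complex"
  assumes "integrable lborel f"
  shows "((\<lambda>h. \<integral>t. norm (f (t - h) - f t) \<partial>lborel) \<longlongrightarrow> 0) (nhds 0)"
  using assms
proof (rule L1_dense_induct)
  fix a b :: real and c :: complex
  define f where "f x = indicator {a..b} x *\<^sub>R c" for x
  have fi: "integrable lborel f" unfolding f_def using integrable_interval_indicator[of UNIV a b c] by simp
  have "((\<lambda>h. \<integral>t. norm (f (t - h) - f t) \<partial>lborel) \<longlongrightarrow> 0) (nhds 0)"
  proof (rule tendsto_sandwich[OF _ _ tendsto_const])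
    have "((\<lambda>h. norm c * (4 * \<bar>h\<bar>)) \<longlongrightarrow> norm c * (4 * \<bar>0\<bar>)) (nhds (0::real))"
      by (intro tendsto_intros filterlim_ident)
    then show "((\<lambda>h. norm c * (4 * \<bar>h\<bar>)) \<longlongrightarrow> 0) (nhds (0::real))" by simp
    have "(\<integral>t. norm (f (t - h) - f t) \<partial>lborel) \<le> norm c * (4 * \<bar>h\<bar>)" for h
    proof -
      have "ennreal (\<integral>t. norm (f (t - h) - f t) \<partial>lborel) = (\<integral>\<^sup>+t. ennreal (norm (f (t - h) - f t)) \<partial>lborel)"
        using fi integrable_shift[OF fi, of h] by (intro nn_integral_eq_integral[symmetric]) auto
      also have "\<dots> = (\<integral>\<^sup>+t. ennreal (norm c) * ennreal \<bar>indicator {a..b} t - indicator {a..b} (t + (- h))\<bar> \<partial>lborel)"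
        by (intro nn_integral_cong) (auto simp: f_def indicator_def)
      also have "\<dots> = ennreal (norm c) * (\<integral>\<^sup>+t. ennreal \<bar>indicator {a..b} t - indicator {a..b} (t + (- h))\<bar> \<partial>lborel)"
        by (rule nn_integral_cmult) measurable
      also have "\<dots> \<le> ennreal (norm c) * ennreal (4 * \<bar>- h\<bar>)"
        by (intro mult_left_mono nn_integral_interval_shift_le) auto
      also have "\<dots> = ennreal (norm c * (4 * \<bar>h\<bar>))" by (simp add: ennreal_mult)
      finally show ?thesis by (subst (asm) ennreal_le_iff) auto
    qed
    then show "\<forall>\<^sub>F h in nhds 0. (\<integral>t. norm (f (t - h) - f t) \<partial>lborel) \<le> norm c * (4 * \<bar>h\<bar>)"
      by (intro always_eventually allI)
  qed (auto intro!: always_eventually Bochner_Integration.integral_nonneg)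
  then show "((\<lambda>h. \<integral>t. norm (indicator {a..b} (t - h) *\<^sub>R c - indicator {a..b} t *\<^sub>R c) \<partial>lborel) \<longlongrightarrow> 0) (nhds 0)"
    by (simp only: f_def)
next
  fix f g :: "real \<Rightarrow> complex"
  assume f: "integrable lborel f" "((\<lambda>h. \<integral>t. norm (f (t - h) - f t) \<partial>lborel) \<longlongrightarrow> 0) (nhds 0)"
    and g: "integrable lborel g" "((\<lambda>h. \<integral>t. norm (g (t - h) - g t) \<partial>lborel) \<longlongrightarrow> 0) (nhds 0)"
  show "((\<lambda>h. \<integral>t. norm (f (t - h) + g (t - h) - (f t + g t)) \<partial>lborel) \<longlongrightarrow> 0) (nhds 0)"
  proof (rule tendsto_sandwich[OF _ _ tendsto_const tendsto_add_zero[OF f(2) g(2)]])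
    have "(\<integral>t. norm (f (t - h) + g (t - h) - (f t + g t)) \<partial>lborel)
      \<le> (\<integral>t. norm (f (t - h) - f t) \<partial>lborel) + (\<integral>t. norm (g (t - h) - g t) \<partial>lborel)" for h
    proof -
      have i: "integrable lborel (\<lambda>t. norm (f (t - h) - f t))" "integrable lborel (\<lambda>t. norm (g (t - h) - g t))"
        using f g integrable_shift[OF f(1), of h] integrable_shift[OF g(1), of h] by auto
      have "(\<integral>t. norm (f (t - h) + g (t - h) - (f t + g t)) \<partial>lborel) \<le> (\<integral>t. norm (f (t - h) - f t) + norm (g (t - h) - g t) \<partial>lborel)"
      proof (rule integral_mono)
        show "integrable lborel (\<lambda>t. norm (f (t - h) + g (t - h) - (f t + g t)))"
          using f g integrable_shift[OF f(1), of h] integrable_shift[OF g(1), of h] by auto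
        show "norm (f (t - h) + g (t - h) - (f t + g t)) \<le> norm (f (t - h) - f t) + norm (g (t - h) - g t)" for t
          using norm_triangle_ineq[of "f (t - h) - f t" "g (t - h) - g t"] by (simp add: algebra_simps)
      qed (use i in auto)
      then show ?thesis using i by simp
    qed
    then show "\<forall>\<^sub>F h in nhds 0. (\<integral>t. norm (f (t - h) + g (t - h) - (f t + g t)) \<partial>lborel)
      \<le> (\<integral>t. norm (f (t - h) - f t) \<partial>lborel) + (\<integral>t. norm (g (t - h) - g t) \<partial>lborel)"
      by (intro always_eventually allI)
  qed (auto intro!: always_eventually Bochner_Integration.integral_nonneg)
next
  fix f :: "real \<Rightarrow> complex"
  assume f: "integrable lborel f"
    and approx: "\<And>e. e > 0 \<Longrightarrow> \<exists>g. integrable lborel g \<and> ((\<lambda>h. \<integral>t. norm (g (t - h) - g t) \<partial>lborel) \<longlongrightarrow> 0) (nhds 0)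
        \<and> (\<integral>x. norm (f x - g x) \<partial>lborel) < e"
  show "((\<lambda>h. \<integral>t. norm (f (t - h) - f t) \<partial>lborel) \<longlongrightarrow> 0) (nhds 0)"
  proof (rule order_tendstoI)
    fix e :: real assume e: "0 < e"
    then obtain g where g: "integrable lborel g" "((\<lambda>h. \<integral>t. norm (g (t - h) - g t) \<partial>lborel) \<longlongrightarrow> 0) (nhds 0)"
      and fg: "(\<integral>x. norm (f x - g x) \<partial>lborel) < e / 3" using approx[of "e / 3"] by auto
    have fgi: "integrable lborel (\<lambda>x. f x - g x)" using f g by auto
    have "\<forall>\<^sub>F h in nhds 0. (\<integral>t. norm (g (t - h) - g t) \<partial>lborel) < e / 3"
      using e by (intro order_tendstoD(2)[OF g(2)]) auto
    then show "\<forall>\<^sub>F h in nhds 0. (\<integral>t. norm (f (t - h) - f t) \<partial>lborel) < e"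
    proof eventually_elim
      case (elim h)
      have i: "integrable lborel (\<lambda>t. norm (f (t - h) - g (t - h)))" "integrable lborel (\<lambda>t. norm (g (t - h) - g t))"
        "integrable lborel (\<lambda>t. norm (f t - g t))"
        using f g integrable_shift[OF f, of h] integrable_shift[OF g(1), of h] by auto
      have "(\<integral>t. norm (f (t - h) - f t) \<partial>lborel) \<le>
         (\<integral>t. norm (f (t - h) - g (t - h)) + norm (g (t - h) - g t) + norm (f t - g t) \<partial>lborel)"
      proof (rule integral_mono)
        show "integrable lborel (\<lambda>t. norm (f (t - h) - f t))" using f integrable_shift[OF f, of h] by auto
        show "norm (f (t - h) - f t) \<le> norm (f (t - h) - g (t - h)) + norm (g (t - h) - g t) + norm (f t - g t)" for t
        proof -
          have eq: "f (t - h) - f t = (f (t - h) - g (t - h)) + (g (t - h) - g t) - (f t - g t)" by simp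
          show ?thesis unfolding eq
            using norm_triangle_ineq4[of "(f (t - h) - g (t - h)) + (g (t - h) - g t)" "f t - g t"]
              norm_triangle_ineq[of "f (t - h) - g (t - h)" "g (t - h) - g t"] by linarith
        qed
      qed (use i in auto)
      also have "\<dots> = (\<integral>t. norm (f (t - h) - g (t - h)) \<partial>lborel) + (\<integral>t. norm (g (t - h) - g t) \<partial>lborel) + (\<integral>t. norm (f t - g t) \<partial>lborel)"
        using i by simp
      also have "(\<integral>t. norm (f (t - h) - g (t - h)) \<partial>lborel) = (\<integral>t. norm (f t - g t) \<partial>lborel)"
        by (rule integral_shift[of "\<lambda>t. norm (f t - g t)"])
      finally show ?case using fg elim by linarith
    qed
  next
    fix e :: real assume "e < 0"
    then show "\<forall>\<^sub>F h in nhds 0. e < (\<integral>t. norm (f (t - h) - f t) \<partial>lborel)"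
      by (intro always_eventually allI less_le_trans[OF _ Bochner_Integration.integral_nonneg]) auto
  qed
qed

text \<open>Rounding down to multiples of 1 / (n + 1) inside [-n, n], and 0 outside. The finite
  range is what later turns a convolution integral into a finite sum of translates.\<close>

lemma grid_approximation:
  "\<exists>k :: nat \<Rightarrow> real \<Rightarrow> real. (\<forall>n. finite (range (k n)) \<and> k n \<in> borel_measurable borel) \<and> (\<forall>x. (\<lambda>n. x - k n x) \<longlonglongrightarrow> 0)"
proof -
  define k where "k n x = (if \<bar>x\<bar> \<le> real n then of_int \<lfloor>real (Suc n) * x\<rfloor> / real (Suc n) else 0)" for n and x :: real
  have "finite (range (k n))" for n
  proof (rule finite_subset)
    show "range (k n) \<subseteq> insert 0 ((\<lambda>j. of_int j / real (Suc n)) ` {- int (Suc n * n)..int (Suc n * n)})"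
    proof
      fix y assume "y \<in> range (k n)"
      then obtain x where x: "y = k n x" by auto
      show "y \<in> insert 0 ((\<lambda>j. of_int j / real (Suc n)) ` {- int (Suc n * n)..int (Suc n * n)})"
      proof (cases "\<bar>x\<bar> \<le> real n")
        case True
        then have "\<bar>real (Suc n) * x\<bar> \<le> real (Suc n) * real n"
          unfolding abs_mult by (intro mult_mono) auto
        then have u1: "real (Suc n) * x \<le> real (Suc n * n)" and u2: "- real (Suc n * n) \<le> real (Suc n) * x"
          unfolding of_nat_mult by linarith+
        have "\<lfloor>real (Suc n) * x\<rfloor> \<le> int (Suc n * n)" using floor_mono[OF u1] by (simp only: floor_of_nat)
        moreover have "- int (Suc n * n) \<le> \<lfloor>real (Suc n) * x\<rfloor>"
          using u2 by (simp only: le_floor_iff of_int_minus of_int_of_nat_eq)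
        ultimately have "\<lfloor>real (Suc n) * x\<rfloor> \<in> {- int (Suc n * n)..int (Suc n * n)}"
          by (simp only: atLeastAtMost_iff simp_thms)
        then show ?thesis using True x by (auto simp: k_def)
      qed (use x in \<open>auto simp: k_def\<close>)
    qed
  qed simp
  moreover have "k n \<in> borel_measurable borel" for n unfolding k_def[abs_def] by measurable
  moreover have "(\<lambda>n. x - k n x) \<longlonglongrightarrow> 0" for x
  proof (rule tendsto_0_le[where K = 1])
    show "(\<lambda>n. 1 / real (Suc n)) \<longlonglongrightarrow> 0"
      using LIMSEQ_inverse_real_of_nat by (simp add: inverse_eq_divide)
    obtain N :: nat where N: "\<bar>x\<bar> \<le> real N" using real_arch_simple by blast
    show "\<forall>\<^sub>F n in sequentially. norm (x - k n x) \<le> norm (1 / real (Suc n)) * 1"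
    proof (rule eventually_sequentiallyI[of N])
      fix n assume "N \<le> n"
      then have "\<bar>x\<bar> \<le> real n" using N by linarith
      then have "x - k n x = (real (Suc n) * x - of_int \<lfloor>real (Suc n) * x\<rfloor>) / real (Suc n)"
        by (simp add: k_def field_simps)
      moreover have "\<bar>real (Suc n) * x - of_int \<lfloor>real (Suc n) * x\<rfloor>\<bar> \<le> 1" by linarith
      ultimately show "norm (x - k n x) \<le> norm (1 / real (Suc n)) * 1"
        by (simp add: divide_right_mono)
    qed
  qed
  ultimately show ?thesis by blast
qed

lemma convolution_pair_integrable:
  fixes \<psi> g :: "real \<Rightarrow> complex"
  assumes \<psi>: "integrable lborel \<psi>" and g: "integrable lborel g"
  shows "integrable (lborel \<Otimes>\<^sub>M lborel) (\<lambda>(x, t). g x * \<psi> (t - x))"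
proof -
  have [measurable]: "\<psi> \<in> borel_measurable borel" "g \<in> borel_measurable borel"
    using borel_measurable_integrable[OF \<psi>] borel_measurable_integrable[OF g] by auto
  have 1: "integrable lborel (\<lambda>t. g x * \<psi> (t - x))" for x by (intro integrable_mult_right integrable_shift \<psi>)
  have 2: "(\<integral>t. norm (g x * \<psi> (t - x)) \<partial>lborel) = norm (g x) * (\<integral>t. norm (\<psi> t) \<partial>lborel)" for x
    using integral_shift[of "\<lambda>t. norm (\<psi> t)" x] by (simp add: norm_mult)
  show ?thesis
    by (rule lborel_pair.Fubini_integrable) (use 1 2 g in auto)
qed

text \<open>Replace psi(t - x) by psi(t - K x) with K a grid approximation of the identity. The
  integral becomes a finite combination of translates, and by Tonelli the L1 error is at most the
  integral of |g(x)| \<omega>(x - K x), which tends to 0 by dominated convergence.\<close>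

lemma L1_convolution_approx:
  fixes \<psi> g :: "real \<Rightarrow> complex"
  assumes \<psi>: "integrable lborel \<psi>" and g: "integrable lborel g" and \<eta>: "\<eta> > 0"
  shows "\<exists>Y d. finite Y \<and> (\<integral>t. norm ((\<integral>x. g x * \<psi> (t - x) \<partial>lborel) - (\<Sum>y\<in>Y. d y * \<psi> (t - y))) \<partial>lborel) < \<eta>"
proof -
  have [measurable]: "\<psi> \<in> borel_measurable borel" "g \<in> borel_measurable borel"
    using borel_measurable_integrable[OF \<psi>] borel_measurable_integrable[OF g] by auto
  obtain k :: "nat \<Rightarrow> real \<Rightarrow> real" where kfin: "\<And>n. finite (range (k n))"
    and km[measurable]: "\<And>n. k n \<in> borel_measurable borel" and klim: "\<And>x. (\<lambda>n. x - k n x) \<longlonglongrightarrow> 0"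
    using grid_approximation by auto
  define \<omega> where "\<omega> h = (\<integral>t. norm (\<psi> (t - h) - \<psi> t) \<partial>lborel)" for h
  have [measurable]: "\<omega> \<in> borel_measurable borel" unfolding \<omega>_def[abs_def] by measurable
  have \<omega>0: "\<omega> h \<ge> 0" for h unfolding \<omega>_def by (rule Bochner_Integration.integral_nonneg) simp
  have \<omega>le: "\<omega> h \<le> 2 * (\<integral>t. norm (\<psi> t) \<partial>lborel)" for h unfolding \<omega>_def by (rule L1_shift_diff_le[OF \<psi>])
  have \<omega>lim: "(\<omega> \<longlongrightarrow> 0) (nhds 0)" unfolding \<omega>_def by (rule L1_translation_continuous[OF \<psi>])
  have "(\<lambda>n. \<integral>x. norm (g x) * \<omega> (x - k n x) \<partial>lborel) \<longlonglongrightarrow> (\<integral>x. 0 \<partial>(lborel :: real measure))"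
  proof (rule integral_dominated_convergence[where w = "\<lambda>x. 2 * (\<integral>t. norm (\<psi> t) \<partial>lborel) * norm (g x)"])
    show "AE x in lborel. (\<lambda>n. norm (g x) * \<omega> (x - k n x)) \<longlonglongrightarrow> 0"
      by (intro AE_I2 tendsto_mult_right_zero filterlim_compose[OF \<omega>lim] klim)
    show "AE x in lborel. norm (norm (g x) * \<omega> (x - k n x)) \<le> 2 * (\<integral>t. norm (\<psi> t) \<partial>lborel) * norm (g x)" for n
      using mult_right_mono[OF \<omega>le norm_ge_zero] \<omega>0 by (intro AE_I2) (simp add: mult.commute)
  qed (use g in auto)
  then have "\<forall>\<^sub>F n in sequentially. (\<integral>x. norm (g x) * \<omega> (x - k n x) \<partial>lborel) < \<eta>"
    using \<eta> by (intro order_tendstoD(2)) auto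
  then obtain n where n: "(\<integral>x. norm (g x) * \<omega> (x - k n x) \<partial>lborel) < \<eta>"
    using eventually_happens'[OF trivial_limit_sequentially] by blast
  define K where "K = k n"
  have [measurable]: "K \<in> borel_measurable borel" by (simp add: K_def)
  define Y where "Y = range K"
  have Y: "finite Y" using kfin by (simp add: Y_def K_def)
  \<comment> \<open>The coefficient of the translate by y is the mass of g on the cell where K takes
    the value y.\<close>
  define d where "d y = (\<integral>x. indicator {x. K x = y} x *\<^sub>R g x \<partial>lborel)" for y
  have di: "integrable lborel (\<lambda>x. indicator {x. K x = y} x *\<^sub>R g x)" for y
    using g by (intro integrable_mult_indicator) auto
  have eqK: "g x * \<psi> (t - K x) = (\<Sum>y\<in>Y. (indicator {x. K x = y} x *\<^sub>R g x) * \<psi> (t - y))" for x t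
  proof -
    have "(\<Sum>y\<in>Y. (indicator {x. K x = y} x *\<^sub>R g x) * \<psi> (t - y)) = (\<Sum>y\<in>Y. if y = K x then g x * \<psi> (t - y) else 0)"
      by (intro sum.cong refl) (auto simp: indicator_def)
    then show ?thesis using Y by (simp add: Y_def)
  qed
  have Ki: "integrable lborel (\<lambda>x. g x * \<psi> (t - K x))" for t
    unfolding eqK by (intro Bochner_Integration.integrable_sum integrable_mult_left di)
  have Keq: "(\<integral>x. g x * \<psi> (t - K x) \<partial>lborel) = (\<Sum>y\<in>Y. d y * \<psi> (t - y))" for t
    unfolding eqK d_def
    by (simp only: Bochner_Integration.integral_sum[OF integrable_mult_left[OF di]] integral_mult_left_zero)
  have gp: "integrable (lborel \<Otimes>\<^sub>M lborel) (\<lambda>(x, t). g x * \<psi> (t - x))"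
    by (rule convolution_pair_integrable[OF \<psi> g])
  have ci: "integrable lborel (\<lambda>t. \<integral>x. g x * \<psi> (t - x) \<partial>lborel)"
    using lborel_pair.integrable_snd[OF gp] .
  have si: "integrable lborel (\<lambda>t. \<Sum>y\<in>Y. d y * \<psi> (t - y))"
    by (intro Bochner_Integration.integrable_sum integrable_mult_right integrable_shift \<psi>)
  have shift: "(\<integral>\<^sup>+t. ennreal (norm (\<psi> (t - x) - \<psi> (t - y))) \<partial>lborel) = ennreal (\<omega> (x - y))" for x y
  proof -
    have "(\<integral>\<^sup>+t. ennreal (norm (\<psi> (t - x) - \<psi> (t - y))) \<partial>lborel) = ennreal (\<integral>t. norm (\<psi> (t - x) - \<psi> (t - y)) \<partial>lborel)"
      using integrable_shift[OF \<psi>] by (intro nn_integral_eq_integral) auto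
    also have "(\<integral>t. norm (\<psi> (t - x) - \<psi> (t - y)) \<partial>lborel) = (\<integral>t. norm (\<psi> (t - y - (x - y)) - \<psi> (t - y)) \<partial>lborel)" by simp
    also have "\<dots> = \<omega> (x - y)"
      unfolding \<omega>_def by (rule integral_shift[of "\<lambda>t. norm (\<psi> (t - (x - y)) - \<psi> t)"])
    finally show ?thesis .
  qed
  have "(\<integral>\<^sup>+t. ennreal (norm ((\<integral>x. g x * \<psi> (t - x) \<partial>lborel) - (\<Sum>y\<in>Y. d y * \<psi> (t - y)))) \<partial>lborel)
    \<le> (\<integral>\<^sup>+t. (\<integral>\<^sup>+x. ennreal (norm (g x)) * ennreal (norm (\<psi> (t - x) - \<psi> (t - K x))) \<partial>lborel) \<partial>lborel)"
  proof (rule nn_integral_mono_AE)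
    have "AE t in lborel. integrable lborel (\<lambda>x. g x * \<psi> (t - x))"
      using lborel_pair.AE_integrable_snd[OF gp] .
    then show "AE t in lborel. ennreal (norm ((\<integral>x. g x * \<psi> (t - x) \<partial>lborel) - (\<Sum>y\<in>Y. d y * \<psi> (t - y))))
      \<le> (\<integral>\<^sup>+x. ennreal (norm (g x)) * ennreal (norm (\<psi> (t - x) - \<psi> (t - K x))) \<partial>lborel)"
    proof eventually_elim
      case (elim t)
      have "(\<integral>x. g x * \<psi> (t - x) \<partial>lborel) - (\<Sum>y\<in>Y. d y * \<psi> (t - y)) = (\<integral>x. g x * \<psi> (t - x) - g x * \<psi> (t - K x) \<partial>lborel)"
        unfolding Keq[symmetric] using elim Ki by simp
      also have "ennreal (norm \<dots>) \<le> (\<integral>\<^sup>+x. ennreal (norm (g x * \<psi> (t - x) - g x * \<psi> (t - K x))) \<partial>lborel)"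
        by (intro integral_norm_bound_ennreal Bochner_Integration.integrable_diff elim Ki)
      also have "\<dots> = (\<integral>\<^sup>+x. ennreal (norm (g x)) * ennreal (norm (\<psi> (t - x) - \<psi> (t - K x))) \<partial>lborel)"
        by (intro nn_integral_cong) (simp add: norm_mult flip: right_diff_distrib ennreal_mult)
      finally show ?case .
    qed
  qed
  also have "\<dots> = (\<integral>\<^sup>+x. (\<integral>\<^sup>+t. ennreal (norm (g x)) * ennreal (norm (\<psi> (t - x) - \<psi> (t - K x))) \<partial>lborel) \<partial>lborel)"
    by (rule lborel_pair.Fubini'[symmetric]) measurable
  also have "\<dots> = (\<integral>\<^sup>+x. ennreal (norm (g x) * \<omega> (x - K x)) \<partial>lborel)"
    by (intro nn_integral_cong) (simp add: nn_integral_cmult shift ennreal_mult \<omega>0)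
  also have "\<dots> = ennreal (\<integral>x. norm (g x) * \<omega> (x - K x) \<partial>lborel)"
  proof (rule nn_integral_eq_integral)
    show "integrable lborel (\<lambda>x. norm (g x) * \<omega> (x - K x))"
      by (rule Bochner_Integration.integrable_bound[of lborel "\<lambda>x. 2 * (\<integral>t. norm (\<psi> t) \<partial>lborel) * norm (g x)"])
         (use g \<omega>0 mult_right_mono[OF \<omega>le norm_ge_zero] in
           \<open>auto intro!: AE_I2 order_trans[OF _ abs_ge_self] simp: mult.commute\<close>)
  qed (use \<omega>0 in auto)
  also have "\<dots> < ennreal \<eta>" using n \<eta> by (simp add: K_def ennreal_lessI)
  finally have "(\<integral>t. norm ((\<integral>x. g x * \<psi> (t - x) \<partial>lborel) - (\<Sum>y\<in>Y. d y * \<psi> (t - y))) \<partial>lborel) < \<eta>"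
    using ci si by (subst (asm) nn_integral_eq_integral) (auto simp: ennreal_less_iff Bochner_Integration.integral_nonneg)
  then show ?thesis using Y by blast
qed

section \<open>Normal densities as approximate identity, and Fourier inversion\<close>

definition gconv :: "real \<Rightarrow> (real \<Rightarrow> complex) \<Rightarrow> real \<Rightarrow> complex" where
  "gconv \<sigma> f t = (\<integral>x. f x * complex_of_real (normal_density 0 \<sigma> (t - x)) \<partial>lborel)"

lemma gconv_integrable:
  assumes f: "integrable lborel f" and \<sigma>: "\<sigma> > 0"
  shows "integrable lborel (gconv \<sigma> f)"
  unfolding gconv_def[abs_def]
  using integrable_normal_density[OF \<sigma>, of 0]
  by (intro lborel_pair.integrable_snd convolution_pair_integrable[OF _ f, of "\<lambda>t. complex_of_real (normal_density 0 \<sigma> t)"]) auto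

text \<open>Substituting x = t - sigma s frees the density of sigma, so the error becomes an average
  of translation differences of f.\<close>

lemma gconv_scaled:
  assumes f: "integrable lborel f" and \<sigma>: "\<sigma> > 0"
  shows "has_bochner_integral lborel (\<lambda>s. f (t - \<sigma> * s) * complex_of_real (std_normal_density s)) (gconv \<sigma> f t)"
proof -
  define g where "g x = f x * complex_of_real (normal_density 0 \<sigma> (t - x))" for x
  have gi: "integrable lborel g"
  proof (rule Bochner_Integration.integrable_bound[of lborel "\<lambda>x. normal_density 0 \<sigma> 0 * norm (f x)"])
    show "g \<in> borel_measurable lborel"
      unfolding g_def using borel_measurable_integrable[OF f] by simp
  qed (use f in \<open>auto intro!: mult_mono normal_density_le_const AE_I2 simp: g_def norm_mult mult.commute\<close>)
  have eq: "f (t - \<sigma> * s) * complex_of_real (std_normal_density s) = \<sigma> *\<^sub>R g (t + (- \<sigma>) * s)" for s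
    by (simp add: g_def scaleR_conv_of_real normal_density_scale[OF \<sigma>, symmetric])
  have "integrable lborel (\<lambda>s. g (t + (- \<sigma>) * s))"
    using \<sigma> by (intro lborel_integrable_real_affine gi) simp
  moreover have "gconv \<sigma> f t = \<sigma> *\<^sub>R (\<integral>s. g (t + (- \<sigma>) * s) \<partial>lborel)"
    unfolding gconv_def g_def[symmetric] using \<sigma> by (subst lborel_integral_real_affine[of "- \<sigma>" _ t]) auto
  ultimately show ?thesis unfolding has_bochner_integral_iff eq by simp
qed

lemma gconv_error_le:
  assumes f: "integrable lborel f" and \<sigma>: "\<sigma> > 0"
  shows "(\<integral>t. norm (f t - gconv \<sigma> f t) \<partial>lborel) \<le>
    (\<integral>s. std_normal_density s * (\<integral>t. norm (f (t - \<sigma> * s) - f t) \<partial>lborel) \<partial>lborel)"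
proof -
  have [measurable]: "f \<in> borel_measurable borel" using borel_measurable_integrable[OF f] by simp
  define N :: "real \<Rightarrow> real" where "N = std_normal_density"
  define \<omega> where "\<omega> h = (\<integral>t. norm (f (t - h) - f t) \<partial>lborel)" for h
  have N: "has_bochner_integral lborel N 1" "\<And>s. N s \<ge> 0"
    by (auto simp: N_def has_bochner_integral_iff)
  have [measurable]: "N \<in> borel_measurable borel" "\<omega> \<in> borel_measurable borel"
    unfolding N_def \<omega>_def[abs_def] by measurable
  have \<omega>: "\<omega> h \<ge> 0" "\<omega> h \<le> 2 * (\<integral>t. norm (f t) \<partial>lborel)" for h
    unfolding \<omega>_def by (auto intro: Bochner_Integration.integral_nonneg L1_shift_diff_le[OF f])
  have N\<omega>: "integrable lborel (\<lambda>s. N s * \<omega> (\<sigma> * s))"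
    by (rule Bochner_Integration.integrable_bound[of lborel "\<lambda>s. 2 * (\<integral>t. norm (f t) \<partial>lborel) * N s"])
       (use N \<omega>(1) mult_right_mono[OF \<omega>(2) N(2)] in
         \<open>auto intro!: AE_I2 order_trans[OF _ abs_ge_self] simp: has_bochner_integral_iff mult.commute\<close>)
  have pt: "ennreal (norm (f t - gconv \<sigma> f t)) \<le> (\<integral>\<^sup>+s. ennreal (N s) * ennreal (norm (f (t - \<sigma> * s) - f t)) \<partial>lborel)" for t
  proof -
    have h: "has_bochner_integral lborel (\<lambda>s. f t * complex_of_real (N s) - f (t - \<sigma> * s) * complex_of_real (N s)) (f t * complex_of_real 1 - gconv \<sigma> f t)"
      using gconv_scaled[OF f \<sigma>, of t] N(1) unfolding N_def
      by (intro has_bochner_integral_diff has_bochner_integral_mult_right has_bochner_integral_of_real)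
    then have "f t - gconv \<sigma> f t = (\<integral>s. f t * complex_of_real (N s) - f (t - \<sigma> * s) * complex_of_real (N s) \<partial>lborel)"
      by (simp add: has_bochner_integral_iff)
    also have "ennreal (norm \<dots>) \<le> (\<integral>\<^sup>+s. ennreal (norm (f t * complex_of_real (N s) - f (t - \<sigma> * s) * complex_of_real (N s))) \<partial>lborel)"
      using h by (intro integral_norm_bound_ennreal) (simp add: has_bochner_integral_iff)
    also have "\<dots> = (\<integral>\<^sup>+s. ennreal (N s) * ennreal (norm (f (t - \<sigma> * s) - f t)) \<partial>lborel)"
    proof -
      have "norm (a * complex_of_real k - b * complex_of_real k) = k * norm (b - a)" if "k \<ge> 0" for a b k
        unfolding left_diff_distrib[symmetric] norm_mult using that by (simp add: norm_minus_commute)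
      then show ?thesis using N(2) by (intro nn_integral_cong) (simp add: ennreal_mult)
    qed
    finally show ?thesis .
  qed
  have "(\<integral>\<^sup>+t. ennreal (norm (f t - gconv \<sigma> f t)) \<partial>lborel)
      \<le> (\<integral>\<^sup>+t. (\<integral>\<^sup>+s. ennreal (N s) * ennreal (norm (f (t - \<sigma> * s) - f t)) \<partial>lborel) \<partial>lborel)"
    by (intro nn_integral_mono pt)
  also have "\<dots> = (\<integral>\<^sup>+s. (\<integral>\<^sup>+t. ennreal (N s) * ennreal (norm (f (t - \<sigma> * s) - f t)) \<partial>lborel) \<partial>lborel)"
    by (rule lborel_pair.Fubini') measurable
  also have "\<dots> = (\<integral>\<^sup>+s. ennreal (N s * \<omega> (\<sigma> * s)) \<partial>lborel)"
  proof (intro nn_integral_cong)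
    fix s
    have "(\<integral>\<^sup>+t. ennreal (norm (f (t - \<sigma> * s) - f t)) \<partial>lborel) = ennreal (\<omega> (\<sigma> * s))"
      unfolding \<omega>_def using f integrable_shift[OF f, of "\<sigma> * s"] by (intro nn_integral_eq_integral) auto
    then show "(\<integral>\<^sup>+t. ennreal (N s) * ennreal (norm (f (t - \<sigma> * s) - f t)) \<partial>lborel) = ennreal (N s * \<omega> (\<sigma> * s))"
      using N(2) \<omega>(1) by (simp add: nn_integral_cmult ennreal_mult)
  qed
  also have "\<dots> = ennreal (\<integral>s. N s * \<omega> (\<sigma> * s) \<partial>lborel)"
    using N(2) \<omega>(1) by (intro nn_integral_eq_integral N\<omega>) auto
  finally have "ennreal (\<integral>t. norm (f t - gconv \<sigma> f t) \<partial>lborel) \<le> ennreal (\<integral>s. N s * \<omega> (\<sigma> * s) \<partial>lborel)"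
    using f gconv_integrable[OF f \<sigma>] by (subst (asm) nn_integral_eq_integral) auto
  then show ?thesis
    using N(2) \<omega>(1) by (subst (asm) ennreal_le_iff) (auto simp: N_def \<omega>_def intro!: Bochner_Integration.integral_nonneg)
qed

lemma gconv_tendsto_L1:
  assumes f: "integrable lborel f"
  shows "(\<lambda>n. \<integral>t. norm (f t - gconv (1 / real (Suc n)) f t) \<partial>lborel) \<longlonglongrightarrow> 0"
proof (rule tendsto_sandwich[OF _ _ tendsto_const])
  have [measurable]: "f \<in> borel_measurable borel" using borel_measurable_integrable[OF f] by simp
  define \<omega> where "\<omega> h = (\<integral>t. norm (f (t - h) - f t) \<partial>lborel)" for h
  have [measurable]: "\<omega> \<in> borel_measurable borel" unfolding \<omega>_def[abs_def] by measurable
  have \<omega>: "\<omega> h \<ge> 0" "\<omega> h \<le> 2 * (\<integral>t. norm (f t) \<partial>lborel)" for h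
    unfolding \<omega>_def by (auto intro: Bochner_Integration.integral_nonneg L1_shift_diff_le[OF f])
  have "(\<lambda>n. \<integral>s. std_normal_density s * \<omega> (1 / real (Suc n) * s) \<partial>lborel) \<longlonglongrightarrow> (\<integral>s. 0 \<partial>(lborel :: real measure))"
  proof (rule integral_dominated_convergence[where w = "\<lambda>s. 2 * (\<integral>t. norm (f t) \<partial>lborel) * std_normal_density s"])
    show "AE s in lborel. (\<lambda>n. std_normal_density s * \<omega> (1 / real (Suc n) * s)) \<longlonglongrightarrow> 0"
    proof (intro AE_I2 tendsto_mult_right_zero)
      fix s
      have "(\<lambda>n. 1 / real (Suc n) * s) \<longlonglongrightarrow> 0"
        using LIMSEQ_inverse_real_of_nat by (intro tendsto_mult_left_zero) (simp add: inverse_eq_divide)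
      then show "(\<lambda>n. \<omega> (1 / real (Suc n) * s)) \<longlonglongrightarrow> 0"
        unfolding \<omega>_def by (rule filterlim_compose[OF L1_translation_continuous[OF f]])
    qed
    show "AE s in lborel. norm (std_normal_density s * \<omega> (1 / real (Suc n) * s)) \<le> 2 * (\<integral>t. norm (f t) \<partial>lborel) * std_normal_density s" for n
      using \<omega>(1) mult_right_mono[OF \<omega>(2) normal_density_nonneg[of 0 1]]
      by (intro AE_I2) (simp only: real_norm_def abs_mult abs_of_nonneg normal_density_nonneg mult.commute[of "std_normal_density _"])
  qed auto
  then show "(\<lambda>n. \<integral>s. std_normal_density s * (\<integral>t. norm (f (t - 1 / real (Suc n) * s) - f t) \<partial>lborel) \<partial>lborel) \<longlonglongrightarrow> 0"
    by (simp add: \<omega>_def)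
  show "\<forall>\<^sub>F n in sequentially. (\<integral>t. norm (f t - gconv (1 / real (Suc n)) f t) \<partial>lborel)
      \<le> (\<integral>s. std_normal_density s * (\<integral>t. norm (f (t - 1 / real (Suc n) * s) - f t) \<partial>lborel) \<partial>lborel)"
    by (intro always_eventually allI gconv_error_le f) simp
qed (auto intro!: always_eventually Bochner_Integration.integral_nonneg)

text \<open>The Gaussian means of f converge to f in L1, and pointwise to the double transform by
  dominated convergence on the Fourier side. Fatou applied to the L1 errors identifies the two
  limits almost everywhere.\<close>

lemma ft_inversion_AE:
  assumes f: "integrable lborel f" and F: "integrable lborel (ft f)"
  shows "AE t in lborel. f t = ft (ft f) (- t)"
proof -
  have [measurable]: "f \<in> borel_measurable borel" using borel_measurable_integrable[OF f] by simp
  define g where "g t = ft (ft f) (- t)" for t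
  have [measurable]: "g \<in> borel_measurable borel" unfolding g_def[abs_def] by measurable
  have lim: "(\<lambda>n. gconv (1 / real (Suc n)) f t) \<longlonglongrightarrow> g t" for t
  proof -
    have "(\<lambda>n. \<integral>s. ft f s * (gauss (1 / real (Suc n)) s * cis (2 * pi * s * t)) \<partial>lborel) \<longlonglongrightarrow> (\<integral>s. ft f s * cis (2 * pi * s * t) \<partial>lborel)"
    proof (rule integral_dominated_convergence[where w = "\<lambda>s. norm (ft f s)"])
      show "AE s in lborel. (\<lambda>n. ft f s * (gauss (1 / real (Suc n)) s * cis (2 * pi * s * t))) \<longlonglongrightarrow> ft f s * cis (2 * pi * s * t)"
      proof (intro AE_I2)
        fix s
        have "(\<lambda>n. ft f s * (complex_of_real (gauss (1 / real (Suc n)) s) * cis (2 * pi * s * t))) \<longlonglongrightarrow> ft f s * (complex_of_real 1 * cis (2 * pi * s * t))"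
          by (intro tendsto_intros gauss_tendsto_1)
        then show "(\<lambda>n. ft f s * (gauss (1 / real (Suc n)) s * cis (2 * pi * s * t))) \<longlonglongrightarrow> ft f s * cis (2 * pi * s * t)" by simp
      qed
      show "AE s in lborel. norm (ft f s * (gauss (1 / real (Suc n)) s * cis (2 * pi * s * t))) \<le> norm (ft f s)" for n
        by (intro AE_I2) (simp only: norm_mult norm_of_real norm_cis mult_1_right abs_of_pos[OF gauss_bounds(1)]
            mult_left_le[OF gauss_bounds(2) norm_ge_zero])
    qed (use F in auto)
    moreover have "(\<integral>s. ft f s * cis (2 * pi * s * t) \<partial>lborel) = g t" by (simp add: g_def ft_def[of "ft f"])
    ultimately show ?thesis unfolding gconv_def by (simp add: ft_gauss_regularised[OF f] normal_density_commute)
  qed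
  have [measurable]: "gconv (1 / real (Suc n)) f \<in> borel_measurable borel" for n
    using borel_measurable_integrable[OF gconv_integrable[OF f, of "1 / real (Suc n)"]] by simp
  have "(\<integral>\<^sup>+t. ennreal (norm (f t - g t)) \<partial>lborel) = (\<integral>\<^sup>+t. liminf (\<lambda>n. ennreal (norm (f t - gconv (1 / real (Suc n)) f t))) \<partial>lborel)"
  proof (intro nn_integral_cong)
    fix t
    have "(\<lambda>n. ennreal (norm (f t - gconv (1 / real (Suc n)) f t))) \<longlonglongrightarrow> ennreal (norm (f t - g t))"
      by (intro tendsto_ennrealI tendsto_intros lim)
    then show "ennreal (norm (f t - g t)) = liminf (\<lambda>n. ennreal (norm (f t - gconv (1 / real (Suc n)) f t)))"
      by (rule lim_imp_Liminf[OF trivial_limit_sequentially, symmetric])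
  qed
  also have "\<dots> \<le> liminf (\<lambda>n. \<integral>\<^sup>+t. ennreal (norm (f t - gconv (1 / real (Suc n)) f t)) \<partial>lborel)"
    by (rule nn_integral_liminf) measurable
  also have "(\<lambda>n. \<integral>\<^sup>+t. ennreal (norm (f t - gconv (1 / real (Suc n)) f t)) \<partial>lborel) = (\<lambda>n. ennreal (\<integral>t. norm (f t - gconv (1 / real (Suc n)) f t) \<partial>lborel))"
    using f gconv_integrable[OF f] by (intro ext nn_integral_eq_integral) auto
  also have "liminf \<dots> = ennreal 0"
    by (intro lim_imp_Liminf tendsto_ennrealI gconv_tendsto_L1 f) simp
  finally have "(\<integral>\<^sup>+t. ennreal (norm (f t - g t)) \<partial>lborel) = 0" by simp
  then have "AE t in lborel. ennreal (norm (f t - g t)) = 0" by (subst (asm) nn_integral_0_iff_AE) auto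
  then show ?thesis by eventually_elim (auto simp: g_def)
qed

subsection \<open>The closed span of the translates\<close>

lemma continuous_on_ft:
  assumes f: "integrable lborel f"
  shows "continuous_on UNIV (ft f)"
  unfolding continuous_on_sequentially
proof (intro allI ballI impI)
  fix x :: "nat \<Rightarrow> real" and a assume "(\<forall>n. x n \<in> UNIV) \<and> x \<longlonglongrightarrow> a"
  then have x: "x \<longlonglongrightarrow> a" by simp
  show "(ft f \<circ> x) \<longlonglongrightarrow> ft f a"
    unfolding ft_def o_def
  proof (rule integral_dominated_convergence[where w = "\<lambda>t. norm (f t)"])
    show "AE t in lborel. (\<lambda>n. f t * cis (- (2 * pi * t * x n))) \<longlonglongrightarrow> f t * cis (- (2 * pi * t * a))"
      by (intro AE_I2 tendsto_intros x)
  qed (use f in \<open>auto simp: norm_mult dest: borel_measurable_integrable\<close>)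
qed

lemma integral_reflect:
  fixes f :: "real \<Rightarrow> 'a::{banach, second_countable_topology}"
  shows "(\<integral>t. f (- t) \<partial>lborel) = (\<integral>t. f t \<partial>lborel)"
  using lborel_integral_real_affine[of "-1" f 0] by simp

lemma integrable_reflect:
  fixes f :: "real \<Rightarrow> 'a::{banach, second_countable_topology}"
  shows "integrable lborel f \<Longrightarrow> integrable lborel (\<lambda>t. f (- t))"
  using lborel_integrable_real_affine[of f "-1" 0] by simp

lemma trig_sum_has_vector_derivative:
  "(trig_sum S r has_vector_derivative trig_sum S (\<lambda>l. - 2 * pi * \<i> * l * r l) \<xi>) (at \<xi>)"
proof -
  have "((\<lambda>\<xi>. r l * cis (- (2 * pi * l * \<xi>))) has_vector_derivative (- 2 * pi * \<i> * l * r l) * cis (- (2 * pi * l * \<xi>))) (at \<xi>)" for l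
  proof -
    have "((\<lambda>\<xi>. r l * exp (\<i> * (complex_of_real (- (2 * pi * l)) * complex_of_real \<xi>))) has_vector_derivative
       r l * ((\<i> * complex_of_real (- (2 * pi * l))) * exp (\<i> * (complex_of_real (- (2 * pi * l)) * complex_of_real \<xi>)))) (at \<xi>)"
      by (rule has_vector_derivative_real_field) (auto intro!: derivative_eq_intros)
    then show ?thesis by (simp add: cis_conv_exp mult_ac)
  qed
  then show ?thesis unfolding trig_sum_def[abs_def] by (intro has_vector_derivative_sum)
qed

lemma continuous_on_trig_sum: "continuous_on X (trig_sum S r)"
  unfolding trig_sum_def[abs_def] by (intro continuous_intros)

lemma norm_trig_sum_le: "norm (trig_sum S r \<xi>) \<le> (\<Sum>l\<in>S. norm (r l))"
  unfolding trig_sum_def by (rule order_trans[OF norm_sum]) (simp add: norm_mult)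

lemma exp_two_pi_le: "exp (- (2 * pi * \<bar>\<xi>\<bar>)) \<le> exp (- \<bar>\<xi>\<bar>)"
proof -
  have "1 * \<bar>\<xi>\<bar> \<le> 2 * pi * \<bar>\<xi>\<bar>" using pi_gt3 by (intro mult_right_mono) auto
  then show ?thesis by simp
qed

text \<open>The Poisson kernel is the model, with transform exp(-2 pi |xi|). Its corner explains why
  a derivative is requested only at nonzero points.\<close>

locale poisson_type =
  fixes \<phi> :: "real \<Rightarrow> complex" and A B C :: real
  assumes \<phi>: "integrable lborel \<phi>"
    and A: "A > 0"
    and lower: "\<And>\<xi>. A * exp (- (2 * pi * \<bar>\<xi>\<bar>)) \<le> norm (ft \<phi> \<xi>)"
    and upper: "\<And>\<xi>. norm (ft \<phi> \<xi>) \<le> B * exp (- (2 * pi * \<bar>\<xi>\<bar>))"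
    and deriv_ex: "\<And>\<xi>. \<xi> \<noteq> 0 \<Longrightarrow>
      \<exists>D. (ft \<phi> has_vector_derivative D) (at \<xi>) \<and> norm D \<le> C * exp (- (2 * pi * \<bar>\<xi>\<bar>))"
begin

text \<open>The value 0 at the origin makes the bound on the derivative hold everywhere.\<close>

definition ft_deriv :: "real \<Rightarrow> complex" where
  "ft_deriv \<xi> = (if \<xi> = 0 then 0 else
     SOME D. (ft \<phi> has_vector_derivative D) (at \<xi>) \<and> norm D \<le> C * exp (- (2 * pi * \<bar>\<xi>\<bar>)))"

lemma ft_deriv:
  assumes "\<xi> \<noteq> 0"
  shows "(ft \<phi> has_vector_derivative ft_deriv \<xi>) (at \<xi>)" "norm (ft_deriv \<xi>) \<le> C * exp (- (2 * pi * \<bar>\<xi>\<bar>))"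
  using someI_ex[OF deriv_ex[OF assms]] assms by (auto simp: ft_deriv_def)

lemma C_nonneg: "C \<ge> 0"
proof -
  have "0 \<le> C * exp (- (2 * pi * \<bar>1\<bar>))" using order_trans[OF norm_ge_zero ft_deriv(2)[of 1]] by simp
  then show ?thesis by (simp add: zero_le_mult_iff)
qed

lemma B_nonneg: "B \<ge> 0"
  using order_trans[OF norm_ge_zero upper[of 0]] by simp

lemma ft_deriv_le: "norm (ft_deriv \<xi>) \<le> C * exp (- (2 * pi * \<bar>\<xi>\<bar>))"
  using ft_deriv(2)[of \<xi>] C_nonneg by (cases "\<xi> = 0") (auto simp: ft_deriv_def)

lemma ft_nonzero: "ft \<phi> \<xi> \<noteq> 0"
  using lower[of \<xi>] mult_pos_pos[OF A exp_gt_zero[of "- (2 * pi * \<bar>\<xi>\<bar>)"]] by auto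

lemma ft_integrable: "integrable lborel (ft \<phi>)"
proof (rule Bochner_Integration.integrable_bound)
  show "integrable lborel (\<lambda>\<xi>. B * exp (- (2 * pi * \<bar>\<xi>\<bar>)))"
    using integrable_exp_neg_abs[of "2 * pi"] by simp
  show "ft \<phi> \<in> borel_measurable lborel" using borel_measurable_integrable[OF \<phi>] by simp
  show "AE \<xi> in lborel. norm (ft \<phi> \<xi>) \<le> norm (B * exp (- (2 * pi * \<bar>\<xi>\<bar>)))"
    using upper B_nonneg by (intro AE_I2) (auto simp: abs_mult)
qed

lemma inversion: "AE t in lborel. \<phi> t = ft (ft \<phi>) (- t)"
  by (rule ft_inversion_AE[OF \<phi> ft_integrable])

lemma inversion_affine:
  assumes "c \<noteq> 0"
  shows "AE t in lborel. \<phi> (x + c * t) = ft (ft \<phi>) (- (x + c * t))"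
proof -
  have [measurable]: "\<phi> \<in> borel_measurable borel" using borel_measurable_integrable[OF \<phi>] by simp
  have "Measurable.pred borel (\<lambda>t. \<phi> t = ft (ft \<phi>) (- t))" by measurable
  then show ?thesis using inversion assms by (intro AE_borel_affine) auto
qed

text \<open>Inversion of \<phi> rewrites a sum of translates as a transform of
  \<open>ft \<phi>\<close> times a trigonometric sum, the form to which the Sobolev estimate
  applies.\<close>

lemma sum_translates_AE:
  assumes S: "finite S"
  shows "AE t in lborel. (\<Sum>l\<in>S. r l * \<phi> (t - l)) = ft (\<lambda>\<xi>. ft \<phi> \<xi> * trig_sum S r \<xi>) (- t)"
proof -
  have "AE t in lborel. \<forall>l\<in>S. \<phi> (- l + 1 * t) = ft (ft \<phi>) (- (- l + 1 * t))"
    by (intro AE_finite_allI S inversion_affine) simp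
  then show ?thesis
  proof eventually_elim
    case (elim t)
    have int: "integrable lborel (\<lambda>\<xi>. r l * (ft \<phi> \<xi> * cis (- (2 * pi * \<xi> * (l - t)))))" for l
      by (intro integrable_mult_right integrable_ft_integrand ft_integrable)
    have "(\<Sum>l\<in>S. r l * \<phi> (t - l)) = (\<Sum>l\<in>S. r l * ft (ft \<phi>) (l - t))"
    proof (intro sum.cong refl)
      fix l assume "l \<in> S"
      then have "\<phi> (- l + 1 * t) = ft (ft \<phi>) (- (- l + 1 * t))" using elim by blast
      then show "r l * \<phi> (t - l) = r l * ft (ft \<phi>) (l - t)" by (simp add: algebra_simps)
    qed
    also have "\<dots> = (\<integral>\<xi>. (\<Sum>l\<in>S. r l * (ft \<phi> \<xi> * cis (- (2 * pi * \<xi> * (l - t))))) \<partial>lborel)"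
      using int by (simp add: ft_def[of "ft \<phi>"])
    also have "\<dots> = ft (\<lambda>\<xi>. ft \<phi> \<xi> * trig_sum S r \<xi>) (- t)"
      unfolding ft_def[of "\<lambda>\<xi>. ft \<phi> \<xi> * trig_sum S r \<xi>"]
    proof (intro Bochner_Integration.integral_cong refl)
      fix \<xi>
      have "(\<Sum>l\<in>S. r l * (ft \<phi> \<xi> * cis (- (2 * pi * \<xi> * (l - t))))) = (\<Sum>l\<in>S. ft \<phi> \<xi> * (r l * cis (- (2 * pi * l * \<xi>))) * cis (- (2 * pi * \<xi> * (- t))))"
        by (intro sum.cong refl) (simp add: cis_mult algebra_simps)
      then show "(\<Sum>l\<in>S. r l * (ft \<phi> \<xi> * cis (- (2 * pi * \<xi> * (l - t))))) = ft \<phi> \<xi> * trig_sum S r \<xi> * cis (- (2 * pi * \<xi> * - t))"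
        by (simp only: trig_sum_def sum_distrib_left sum_distrib_right)
    qed
    finally show ?case .
  qed
qed

text \<open>The product of \<open>ft \<phi>\<close> with the trigonometric sum E is a Sobolev
  function. By the product rule and the bounds B and C, its density is at most (2 B^2 + 2 C^2)
  exp(-4 pi |xi|) (|E|^2 + |E'|^2), whose integral is a multiple of the form.\<close>

lemma translates_L1_bound:
  assumes S: "finite S" and s: "s > 0"
  shows "(\<integral>t. norm (\<Sum>l\<in>S. r l * \<phi> (t - l)) \<partial>lborel) \<le>
    (s * (\<integral>t. 1 / (1 + t\<^sup>2) \<partial>lborel) + (2 * B\<^sup>2 + 2 * C\<^sup>2) * Re (sob_form S r r) / s) / 2"
proof -
  define E where "E = trig_sum S r"
  define E' where "E' = trig_sum S (\<lambda>l. - 2 * pi * \<i> * l * r l)"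
  define G where "G = (\<Sum>l\<in>S. norm (r l))"
  define G' where "G' = (\<Sum>l\<in>S. norm (- 2 * pi * \<i> * l * r l))"
  have E: "norm (E \<xi>) \<le> G" and E': "norm (E' \<xi>) \<le> G'" for \<xi>
    unfolding E_def E'_def G_def G'_def by (rule norm_trig_sum_le)+
  have G0: "G \<ge> 0" "G' \<ge> 0" by (auto simp: G_def G'_def sum_nonneg)
  define e where "e \<xi> = exp (- (2 * pi * \<bar>\<xi>\<bar>))" for \<xi>
  have e0: "e \<xi> > 0" for \<xi> by (simp add: e_def)
  define v where "v \<xi> = ft \<phi> \<xi> * E \<xi>" for \<xi>
  define D where "D \<xi> = (if \<xi> = 0 then 0 else ft \<phi> \<xi> * E' \<xi> + ft_deriv \<xi> * E \<xi>)" for \<xi>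
  define \<rho> where "\<rho> \<xi> = (2 * B\<^sup>2 + 2 * C\<^sup>2) * (exp (- (4 * pi * \<bar>\<xi>\<bar>)) * ((norm (E \<xi>))\<^sup>2 + (norm (E' \<xi>))\<^sup>2))" for \<xi>
  have has: "has_bochner_integral lborel \<rho> ((2 * B\<^sup>2 + 2 * C\<^sup>2) * Re (sob_form S r r))"
    unfolding \<rho>_def E_def E'_def by (intro has_bochner_integral_mult_right sob_form_integral S)
  have vb: "norm (v \<xi>) \<le> B * e \<xi> * norm (E \<xi>)" for \<xi>
    unfolding v_def norm_mult e_def by (intro mult_right_mono upper) simp
  have Db: "norm (D \<xi>) \<le> B * e \<xi> * norm (E' \<xi>) + C * e \<xi> * norm (E \<xi>)" for \<xi>
  proof (cases "\<xi> = 0")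
    case True
    then show ?thesis using B_nonneg C_nonneg e0 by (simp add: D_def less_imp_le)
  next
    case False
    have "norm (D \<xi>) \<le> norm (ft \<phi> \<xi>) * norm (E' \<xi>) + norm (ft_deriv \<xi>) * norm (E \<xi>)"
      using False norm_triangle_ineq[of "ft \<phi> \<xi> * E' \<xi>" "ft_deriv \<xi> * E \<xi>"] by (simp add: D_def norm_mult)
    also have "\<dots> \<le> B * e \<xi> * norm (E' \<xi>) + C * e \<xi> * norm (E \<xi>)"
      unfolding e_def by (intro add_mono mult_right_mono upper ft_deriv_le) auto
    finally show ?thesis .
  qed
  \<comment> \<open>This decay constant may depend on the coefficients r, because the final estimate
    sees only the integral of \<rho>.\<close>
  define M where "M = B * G + B * G' + C * G"
  interpret sobolev_function v D M \<rho>
  proof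
    show "continuous_on UNIV v"
      unfolding v_def E_def by (intro continuous_intros continuous_on_ft \<phi> continuous_on_trig_sum)
    show "(v has_vector_derivative D \<xi>) (at \<xi>)" if "\<xi> \<noteq> 0" for \<xi>
    proof -
      have "(v has_vector_derivative ft \<phi> \<xi> * E' \<xi> + ft_deriv \<xi> * E \<xi>) (at \<xi>)"
        unfolding v_def E_def E'_def
        by (intro has_vector_derivative_mult ft_deriv that trig_sum_has_vector_derivative)
      then show ?thesis using that by (simp add: D_def)
    qed
    show "D 0 = 0" by (simp add: D_def)
    have ee: "k * e \<xi> \<le> M * exp (- \<bar>\<xi>\<bar>)" if "k \<le> M" "k \<ge> 0" for k \<xi>
    proof -
      have "k * e \<xi> \<le> M * e \<xi>" using that e0[of \<xi>] by (intro mult_right_mono) auto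
      also have "\<dots> \<le> M * exp (- \<bar>\<xi>\<bar>)"
        unfolding e_def using that by (intro mult_left_mono exp_two_pi_le) auto
      finally show ?thesis .
    qed
    show "norm (v \<xi>) \<le> M * exp (- \<bar>\<xi>\<bar>)" for \<xi>
    proof -
      have "norm (v \<xi>) \<le> B * e \<xi> * G"
        by (rule order_trans[OF vb]) (use E B_nonneg e0[of \<xi>] in \<open>auto intro!: mult_left_mono\<close>)
      also have "\<dots> = (B * G) * e \<xi>" by simp
      also have "\<dots> \<le> M * exp (- \<bar>\<xi>\<bar>)"
        using B_nonneg C_nonneg G0 by (intro ee) (auto simp: M_def)
      finally show ?thesis .
    qed
    show "norm (D \<xi>) \<le> M * exp (- \<bar>\<xi>\<bar>)" for \<xi>
    proof -
      have "norm (D \<xi>) \<le> B * e \<xi> * G' + C * e \<xi> * G"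
        by (rule order_trans[OF Db]) (use E E' B_nonneg C_nonneg e0[of \<xi>] in \<open>auto intro!: add_mono mult_left_mono\<close>)
      also have "\<dots> = (B * G' + C * G) * e \<xi>" by (simp add: algebra_simps)
      also have "\<dots> \<le> M * exp (- \<bar>\<xi>\<bar>)"
        using B_nonneg C_nonneg G0 by (intro ee) (auto simp: M_def)
      finally show ?thesis .
    qed
    show "integrable lborel \<rho>" using has by (simp add: has_bochner_integral_iff)
    show "(norm (v \<xi>))\<^sup>2 + (norm (D \<xi>))\<^sup>2 \<le> \<rho> \<xi>" for \<xi>
    proof -
      define x where "x = norm (E \<xi>)"
      define y where "y = norm (E' \<xi>)"
      have e2: "(e \<xi>)\<^sup>2 = exp (- (4 * pi * \<bar>\<xi>\<bar>))" by (simp add: e_def power2_eq_square flip: exp_add)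
      have "(norm (v \<xi>))\<^sup>2 \<le> (B * e \<xi> * x)\<^sup>2" unfolding x_def by (intro power_mono vb) auto
      moreover have "(norm (D \<xi>))\<^sup>2 \<le> (B * e \<xi> * y + C * e \<xi> * x)\<^sup>2" unfolding x_def y_def by (intro power_mono Db) auto
      moreover have "(B * e \<xi> * y + C * e \<xi> * x)\<^sup>2 \<le> 2 * (B * e \<xi> * y)\<^sup>2 + 2 * (C * e \<xi> * x)\<^sup>2"
        using sum_squares_bound[of "B * e \<xi> * y" "C * e \<xi> * x"] by (simp add: power2_sum)
      moreover have "0 \<le> (B * e \<xi> * x)\<^sup>2" "0 \<le> (C * e \<xi> * y)\<^sup>2" by auto
      ultimately have "(norm (v \<xi>))\<^sup>2 + (norm (D \<xi>))\<^sup>2 \<le> 2 * (B * e \<xi> * x)\<^sup>2 + 2 * (B * e \<xi> * y)\<^sup>2 + 2 * (C * e \<xi> * x)\<^sup>2 + 2 * (C * e \<xi> * y)\<^sup>2"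
        by linarith
      also have "\<dots> = (2 * B\<^sup>2 + 2 * C\<^sup>2) * ((e \<xi>)\<^sup>2 * (x\<^sup>2 + y\<^sup>2))" by (simp add: power_mult_distrib algebra_simps)
      finally show ?thesis by (simp add: \<rho>_def x_def y_def e2)
    qed
  qed
  have "AE t in lborel. norm (\<Sum>l\<in>S. r l * \<phi> (t - l)) = norm (ft v (- t))"
    using sum_translates_AE[OF S, of r] by eventually_elim (simp add: v_def[abs_def] E_def)
  moreover have [measurable]: "\<phi> \<in> borel_measurable borel" using borel_measurable_integrable[OF \<phi>] by simp
  ultimately have "(\<integral>t. norm (\<Sum>l\<in>S. r l * \<phi> (t - l)) \<partial>lborel) = (\<integral>t. norm (ft v (- t)) \<partial>lborel)"
    by (intro integral_cong_AE) measurable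
  also have "\<dots> = (\<integral>t. norm (ft v t) \<partial>lborel)" by (rule integral_reflect[of "\<lambda>t. norm (ft v t)"])
  also have "\<dots> \<le> (s * (\<integral>t. 1 / (1 + t\<^sup>2) \<partial>lborel) + (\<integral>\<xi>. \<rho> \<xi> \<partial>lborel) / s) / 2"
    by (rule ft_integrable_bound(2)[OF s])
  finally show ?thesis using has by (simp add: has_bochner_integral_iff)
qed

end

text \<open>Complete the square in |xi|. Of the rate 2 pi + 1, the part 2 pi pays for the reciprocal
  of \<open>ft \<phi>\<close> and the extra 1 for the linear factor in the derivative of the
  Gaussian.\<close>

lemma gauss_exp_bound:
  assumes \<sigma>: "\<sigma> > 0"
  shows "gauss \<sigma> \<xi> * exp ((2 * pi + 1) * \<bar>\<xi>\<bar>) \<le> exp ((2 * pi + 2)\<^sup>2 / (8 * (pi * \<sigma>)\<^sup>2)) * exp (- \<bar>\<xi>\<bar>)"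
proof -
  define k where "k = (pi * \<sigma>)\<^sup>2"
  define m where "m = 2 * pi + 2"
  have k: "k > 0" using \<sigma> by (simp add: k_def)
  have "0 \<le> (4 * k * \<bar>\<xi>\<bar> - m)\<^sup>2 / (8 * k)" using k by simp
  also have "\<dots> = 2 * k * \<xi>\<^sup>2 - m * \<bar>\<xi>\<bar> + m\<^sup>2 / (8 * k)"
    using k by (simp add: power2_diff power_mult_distrib field_simps power2_eq_square)
  finally have "- 2 * (pi * \<sigma> * \<xi>)\<^sup>2 + (2 * pi + 1) * \<bar>\<xi>\<bar> \<le> m\<^sup>2 / (8 * k) + - \<bar>\<xi>\<bar>"
    by (simp add: k_def m_def power_mult_distrib algebra_simps)
  then show ?thesis by (simp add: gauss_def m_def k_def flip: exp_add)
qed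

lemma gauss_has_vector_derivative:
  "((\<lambda>\<xi>. complex_of_real (gauss \<sigma> \<xi>)) has_vector_derivative complex_of_real (- (4 * (pi * \<sigma>)\<^sup>2 * \<xi>) * gauss \<sigma> \<xi>)) (at \<xi>)"
proof (rule bounded_linear.has_vector_derivative[OF bounded_linear_of_real])
  have "(gauss \<sigma> has_real_derivative - (4 * (pi * \<sigma>)\<^sup>2 * \<xi>) * gauss \<sigma> \<xi>) (at \<xi>)"
    unfolding gauss_def by (auto intro!: derivative_eq_intros simp: power2_eq_square)
  then show "(gauss \<sigma> has_vector_derivative - (4 * (pi * \<sigma>)\<^sup>2 * \<xi>) * gauss \<sigma> \<xi>) (at \<xi>)"
    by (simp add: has_real_derivative_iff_has_vector_derivative)
qed

section \<open>Divergence makes the Sobolev distance arbitrarily small\<close>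

lemma not_summable_large_sum:
  fixes w :: "real \<Rightarrow> real"
  assumes ns: "\<not> w summable_on X" and w: "\<And>x. w x \<ge> 0"
  shows "\<exists>F. finite F \<and> F \<subseteq> X \<and> sum w F > K"
proof (rule ccontr)
  assume neg: "\<not> ?thesis"
  have "bdd_above (sum w ` {F. F \<subseteq> X \<and> finite F})"
  proof (rule bdd_aboveI[of _ K])
    fix y assume "y \<in> sum w ` {F. F \<subseteq> X \<and> finite F}"
    then show "y \<le> K" using neg by (force simp: not_less)
  qed
  then have "w summable_on X" using w by (intro nonneg_bdd_above_summable_on) auto
  then show False using ns by simp
qed

lemma sob_distance_small_right:
  fixes x \<delta> :: real
  assumes \<delta>: "\<delta> > 0"
  shows "\<exists>T. \<forall>F. finite F \<and> F \<subseteq> {x<..} \<and> T < (\<Sum>l\<in>F. exp (- (pi / 2) * l)) \<longrightarrow>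
    (\<exists>r. r x = 1 \<and> Re (sob_form (insert x F) r r) \<le> \<delta>)"
proof -
  obtain K c where K: "K > 0" "c > 0" and ex: "\<forall>F. finite F \<and> F \<subseteq> {x<..} \<longrightarrow>
     (\<exists>r. r x = 1 \<and> Re (sob_form (insert x F) r r) \<le> K * exp (- c * (\<Sum>l\<in>F. exp (- (pi / 2) * l))))"
    using sob_distance_decay[of x] by (elim exE conjE) (rule that)
  have "K * exp (- c * s) \<le> \<delta>" if "ln (K / \<delta>) / c < s" for s
  proof -
    have "ln (K / \<delta>) \<le> c * s" using that K by (simp add: pos_divide_less_eq mult.commute)
    then have "exp (- (c * s)) \<le> exp (- ln (K / \<delta>))" by simp
    also have "\<dots> = \<delta> / K" using K \<delta> by (simp add: exp_minus)
    finally have "K * exp (- (c * s)) \<le> K * (\<delta> / K)" using K by (intro mult_left_mono) auto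
    then show ?thesis using K by simp
  qed
  then show ?thesis using ex by (intro exI[of _ "ln (K / \<delta>) / c"]) (meson order_trans)
qed

text \<open>Only finitely many points lie in [-|x|, |x|], so the series diverges to the right or to
  the left of it. The left case becomes the right one by reflection. Removing x from \<Lambda> gives
  one argument whether or not x belongs to it.\<close>

lemma sob_distance_small:
  fixes x \<delta> :: real
  assumes disc: "discrete_set \<Lambda>" and ns: "\<not> (\<lambda>l. exp (- (pi / 2) * \<bar>l\<bar>)) summable_on \<Lambda>" and \<delta>: "\<delta> > 0"
  shows "\<exists>F r. finite F \<and> F \<subseteq> \<Lambda> - {x} \<and> r x = 1 \<and> Re (sob_form (insert x F) r r) \<le> \<delta>"
proof -
  define w where "w l = exp (- (pi / 2) * \<bar>l\<bar>)" for l
  \<comment> \<open>Beyond max x 0 a point is both to the right of x and positive, so its weight is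
    exp(-pi l / 2) without absolute value.\<close>
  define P where "P = \<Lambda> \<inter> {max x 0<..}"
  define N where "N = \<Lambda> \<inter> {..<min x 0}"
  have w0: "w l \<ge> 0" for l by (simp add: w_def)
  have "finite (\<Lambda> \<inter> {- \<bar>x\<bar>..\<bar>x\<bar>})" using disc by (auto simp: discrete_set_def)
  then have fin: "w summable_on (\<Lambda> \<inter> {- \<bar>x\<bar>..\<bar>x\<bar>})" by (rule summable_on_finite)
  have "w summable_on \<Lambda>" if "w summable_on P" "w summable_on N"
  proof -
    have "w summable_on (P \<union> N \<union> (\<Lambda> \<inter> {- \<bar>x\<bar>..\<bar>x\<bar>}))"
      using that fin by (intro summable_on_union)
    then show ?thesis by (rule summable_on_subset_banach) (auto simp: P_def N_def)
  qed
  moreover have "\<not> w summable_on \<Lambda>" using ns unfolding w_def[abs_def] .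
  ultimately consider "\<not> w summable_on P" | "\<not> w summable_on N" by blast
  then show ?thesis
  proof cases
    case 1
    obtain T where T: "\<And>F. finite F \<Longrightarrow> F \<subseteq> {x<..} \<Longrightarrow> T < (\<Sum>l\<in>F. exp (- (pi / 2) * l)) \<Longrightarrow>
        \<exists>r. r x = 1 \<and> Re (sob_form (insert x F) r r) \<le> \<delta>"
      using sob_distance_small_right[OF \<delta>, of x] by blast
    obtain F where F: "finite F" "F \<subseteq> P" "sum w F > T"
      using not_summable_large_sum[OF 1 w0, of T] by blast
    have "sum w F = (\<Sum>l\<in>F. exp (- (pi / 2) * l))"
      using F(2) by (intro sum.cong refl) (auto simp: w_def P_def)
    moreover have "F \<subseteq> {x<..}" using F(2) by (auto simp: P_def)
    ultimately obtain r where "r x = 1" "Re (sob_form (insert x F) r r) \<le> \<delta>"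
      using T[OF F(1)] F(3) by auto
    moreover have "F \<subseteq> \<Lambda> - {x}" using F(2) by (auto simp: P_def)
    ultimately show ?thesis using F by blast
  next
    case 2
    obtain T where T: "\<And>F. finite F \<Longrightarrow> F \<subseteq> {- x<..} \<Longrightarrow> T < (\<Sum>l\<in>F. exp (- (pi / 2) * l)) \<Longrightarrow>
        \<exists>r. r (- x) = 1 \<and> Re (sob_form (insert (- x) F) r r) \<le> \<delta>"
      using sob_distance_small_right[OF \<delta>, of "- x"] by blast
    obtain F where F: "finite F" "F \<subseteq> N" "sum w F > T"
      using not_summable_large_sum[OF 2 w0, of T] by blast
    have "(\<Sum>l\<in>uminus ` F. exp (- (pi / 2) * l)) = (\<Sum>l\<in>F. exp (- (pi / 2) * (- l)))"
      by (subst sum.reindex) auto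
    also have "\<dots> = sum w F"
      using F(2) by (intro sum.cong refl) (auto simp: w_def N_def)
    finally have "T < (\<Sum>l\<in>uminus ` F. exp (- (pi / 2) * l))" using F(3) by simp
    moreover have "uminus ` F \<subseteq> {- x<..}" using F(2) by (force simp: N_def)
    ultimately obtain r where r: "r (- x) = 1" "Re (sob_form (insert (- x) (uminus ` F)) r r) \<le> \<delta>"
      using T[of "uminus ` F"] F(1) by auto
    have "sob_form (insert (- x) (uminus ` F)) r r = sob_form (insert x F) (\<lambda>l. r (- l)) (\<lambda>l. r (- l))"
      by (simp add: sob_form_reflect)
    then have "Re (sob_form (insert x F) (\<lambda>l. r (- l)) (\<lambda>l. r (- l))) \<le> \<delta>" using r(2) by simp
    moreover have "F \<subseteq> \<Lambda> - {x}" using F(2) by (auto simp: N_def)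
    ultimately show ?thesis using F r(1) by (intro exI[of _ F] exI[of _ "\<lambda>l. r (- l)"]) auto
  qed
qed

lemma L1_triangle:
  fixes f g h :: "real \<Rightarrow> complex"
  assumes "integrable lborel f" "integrable lborel g" "integrable lborel h"
  shows "(\<integral>t. norm (f t - h t) \<partial>lborel) \<le> (\<integral>t. norm (f t - g t) \<partial>lborel) + (\<integral>t. norm (g t - h t) \<partial>lborel)"
proof -
  have "(\<integral>t. norm (f t - h t) \<partial>lborel) \<le> (\<integral>t. norm (f t - g t) + norm (g t - h t) \<partial>lborel)"
  proof (rule integral_mono)
    show "norm (f t - h t) \<le> norm (f t - g t) + norm (g t - h t)" for t
      using norm_triangle_ineq[of "f t - g t" "g t - h t"] by simp
  qed (use assms in auto)
  also have "\<dots> = (\<integral>t. norm (f t - g t) \<partial>lborel) + (\<integral>t. norm (g t - h t) \<partial>lborel)"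
    using assms by (intro Bochner_Integration.integral_add) auto
  finally show ?thesis .
qed

section \<open>Functions in the closed span\<close>

context poisson_type
begin

definition spanned :: "real set \<Rightarrow> (real \<Rightarrow> complex) \<Rightarrow> bool" where
  "spanned \<Lambda> f \<longleftrightarrow> (\<forall>e>0. \<exists>F c. finite F \<and> F \<subseteq> \<Lambda> \<and> (\<integral>t. norm (f t - (\<Sum>l\<in>F. c l * \<phi> (t - l))) \<partial>lborel) < e)"

lemma integrable_sum_translates: "integrable lborel (\<lambda>t. \<Sum>l\<in>F. c l * \<phi> (t - l))"
  by (intro Bochner_Integration.integrable_sum integrable_mult_right integrable_shift \<phi>)

lemma spanned_closed:
  assumes f: "integrable lborel f"
    and ex: "\<And>e. e > 0 \<Longrightarrow> \<exists>g. integrable lborel g \<and> spanned \<Lambda> g \<and> (\<integral>t. norm (f t - g t) \<partial>lborel) < e"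
  shows "spanned \<Lambda> f"
  unfolding spanned_def
proof (intro allI impI)
  fix e :: real assume e: "e > 0"
  obtain g where g: "integrable lborel g" "spanned \<Lambda> g" "(\<integral>t. norm (f t - g t) \<partial>lborel) < e / 2"
    using ex[of "e / 2"] e by auto
  have "e / 2 > 0" using e by simp
  then obtain F c where F: "finite F" "F \<subseteq> \<Lambda>" "(\<integral>t. norm (g t - (\<Sum>l\<in>F. c l * \<phi> (t - l))) \<partial>lborel) < e / 2"
    using g(2) unfolding spanned_def by blast
  have "(\<integral>t. norm (f t - (\<Sum>l\<in>F. c l * \<phi> (t - l))) \<partial>lborel) < e"
    using L1_triangle[OF f g(1) integrable_sum_translates[where F = F and c = c]] g(3) F(3) by linarith
  then show "\<exists>F c. finite F \<and> F \<subseteq> \<Lambda> \<and> (\<integral>t. norm (f t - (\<Sum>l\<in>F. c l * \<phi> (t - l))) \<partial>lborel) < e"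
    using F by blast
qed

lemma spanned_zero: "spanned \<Lambda> (\<lambda>t. 0)"
  unfolding spanned_def by (intro allI impI exI[of _ "{}"]) auto

lemma spanned_add_mult:
  assumes f: "integrable lborel f" "spanned \<Lambda> f" and g: "integrable lborel g" "spanned \<Lambda> g"
  shows "spanned \<Lambda> (\<lambda>t. d * f t + g t)"
  unfolding spanned_def
proof (intro allI impI)
  fix e :: real assume e: "e > 0"
  \<comment> \<open>The summand 1 covers the case d = 0.\<close>
  define e1 where "e1 = e / (2 * (norm d + 1))"
  have nd: "norm d + 1 > 0" by (simp add: add_nonneg_pos)
  have e1: "e1 > 0" using e nd by (simp add: e1_def)
  obtain F c where F: "finite F" "F \<subseteq> \<Lambda>" "(\<integral>t. norm (f t - (\<Sum>l\<in>F. c l * \<phi> (t - l))) \<partial>lborel) < e1"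
    using f(2) e1 unfolding spanned_def by blast
  have "e / 2 > 0" using e by simp
  then obtain G b where G: "finite G" "G \<subseteq> \<Lambda>" "(\<integral>t. norm (g t - (\<Sum>l\<in>G. b l * \<phi> (t - l))) \<partial>lborel) < e / 2"
    using g(2) unfolding spanned_def by blast
  \<comment> \<open>F and G may overlap, so both coefficient families are extended by 0 to the union
    and added.\<close>
  define a where "a l = d * (if l \<in> F then c l else 0) + (if l \<in> G then b l else 0)" for l
  have sum: "(\<Sum>l\<in>F \<union> G. a l * \<phi> (t - l)) = d * (\<Sum>l\<in>F. c l * \<phi> (t - l)) + (\<Sum>l\<in>G. b l * \<phi> (t - l))" for t
  proof -
    have "(\<Sum>l\<in>F. c l * \<phi> (t - l)) = (\<Sum>l\<in>F \<union> G. (if l \<in> F then c l else 0) * \<phi> (t - l))"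
      using F G by (intro sum.mono_neutral_cong_left) auto
    moreover have "(\<Sum>l\<in>G. b l * \<phi> (t - l)) = (\<Sum>l\<in>F \<union> G. (if l \<in> G then b l else 0) * \<phi> (t - l))"
      using F G by (intro sum.mono_neutral_cong_left) auto
    ultimately show ?thesis
      unfolding a_def by (simp only: distrib_right sum.distrib sum_distrib_left mult.assoc)
  qed
  define f1 where "f1 t = f t - (\<Sum>l\<in>F. c l * \<phi> (t - l))" for t
  define g1 where "g1 t = g t - (\<Sum>l\<in>G. b l * \<phi> (t - l))" for t
  have i: "integrable lborel f1" "integrable lborel g1"
    unfolding f1_def g1_def by (intro Bochner_Integration.integrable_diff f g integrable_sum_translates)+
  have "(\<integral>t. norm (d * f t + g t - (\<Sum>l\<in>F \<union> G. a l * \<phi> (t - l))) \<partial>lborel) = (\<integral>t. norm (d * f1 t + g1 t) \<partial>lborel)"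
    by (intro Bochner_Integration.integral_cong refl) (simp add: sum f1_def g1_def algebra_simps)
  also have "\<dots> \<le> (\<integral>t. norm d * norm (f1 t) + norm (g1 t) \<partial>lborel)"
  proof (rule integral_mono)
    show "norm (d * f1 t + g1 t) \<le> norm d * norm (f1 t) + norm (g1 t)" for t
      using norm_triangle_ineq[of "d * f1 t" "g1 t"] by (simp add: norm_mult)
  qed (use i in auto)
  also have "\<dots> = norm d * (\<integral>t. norm (f1 t) \<partial>lborel) + (\<integral>t. norm (g1 t) \<partial>lborel)" using i by simp
  also have "\<dots> < e"
  proof -
    have "norm d * (\<integral>t. norm (f1 t) \<partial>lborel) \<le> norm d * e1"
      using F(3) by (intro mult_left_mono) (auto simp: f1_def)
    also have "\<dots> \<le> (norm d + 1) * e1" using e1 by (intro mult_right_mono) auto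
    also have "\<dots> = e / 2"
    proof -
      have "n * (e / (2 * n)) = e / 2" if "n > 0" for n using that by simp
      then show ?thesis using nd unfolding e1_def by blast
    qed
    finally show ?thesis using G(3) by (simp add: g1_def)
  qed
  finally show "\<exists>F c. finite F \<and> F \<subseteq> \<Lambda> \<and> (\<integral>t. norm (d * f t + g t - (\<Sum>l\<in>F. c l * \<phi> (t - l))) \<partial>lborel) < e"
    using F G by (intro exI[of _ "F \<union> G"] exI[of _ a]) auto
qed

lemma spanned_sum:
  assumes "finite Y" "\<And>y. y \<in> Y \<Longrightarrow> integrable lborel (\<psi> y)" "\<And>y. y \<in> Y \<Longrightarrow> spanned \<Lambda> (\<psi> y)"
  shows "spanned \<Lambda> (\<lambda>t. \<Sum>y\<in>Y. d y * \<psi> y t)"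
  using assms
proof (induction Y rule: finite_induct)
  case (insert y Y)
  have "spanned \<Lambda> (\<lambda>t. d y * \<psi> y t + (\<Sum>y\<in>Y. d y * \<psi> y t))"
    by (rule spanned_add_mult) (use insert in \<open>auto intro!: Bochner_Integration.integrable_sum\<close>)
  then show ?case using insert by simp
qed (simp add: spanned_zero)

text \<open>This is used twice: with \<phi> to reach the normal densities, then with a normal
  density to reach \<open>gconv \<sigma> f\<close>.\<close>

lemma spanned_convolution:
  assumes \<psi>: "integrable lborel \<psi>" and sp: "\<And>y. spanned \<Lambda> (\<lambda>t. \<psi> (t - y))" and g: "integrable lborel g"
  shows "spanned \<Lambda> (\<lambda>t. \<integral>x. g x * \<psi> (t - x) \<partial>lborel)"
proof (rule spanned_closed)
  show "integrable lborel (\<lambda>t. \<integral>x. g x * \<psi> (t - x) \<partial>lborel)"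
    using lborel_pair.integrable_snd[OF convolution_pair_integrable[OF \<psi> g]] .
  fix e :: real assume "e > 0"
  then obtain Y d where Y: "finite Y" "(\<integral>t. norm ((\<integral>x. g x * \<psi> (t - x) \<partial>lborel) - (\<Sum>y\<in>Y. d y * \<psi> (t - y))) \<partial>lborel) < e"
    using L1_convolution_approx[OF \<psi> g] by blast
  moreover have "integrable lborel (\<lambda>t. \<Sum>y\<in>Y. d y * \<psi> (t - y))"
    by (intro Bochner_Integration.integrable_sum integrable_mult_right integrable_shift \<psi>)
  moreover have "spanned \<Lambda> (\<lambda>t. \<Sum>y\<in>Y. d y * \<psi> (t - y))"
    by (rule spanned_sum[OF Y(1)]) (use sp \<psi> integrable_shift in auto)
  ultimately show "\<exists>h. integrable lborel h \<and> spanned \<Lambda> h \<and> (\<integral>t. norm ((\<integral>x. g x * \<psi> (t - x) \<partial>lborel) - h t) \<partial>lborel) < e"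
    by blast
qed

text \<open>Division on the Fourier side: g should have transform \<open>gauss \<sigma>\<close> over
  \<open>ft \<phi>\<close>. The lower bound on \<open>ft \<phi>\<close> makes the reciprocal grow at
  most like exp(2 pi |xi|), which the Gaussian defeats. The derivative bound makes the quotient a
  Sobolev function, so its inverse transform g is integrable.\<close>

lemma normal_density_as_convolution:
  assumes \<sigma>: "\<sigma> > 0"
  shows "\<exists>g. integrable lborel g \<and> (\<forall>t. (\<integral>x. g x * \<phi> (t - x) \<partial>lborel) = complex_of_real (normal_density 0 \<sigma> t))"
proof -
  define u where "u \<xi> = complex_of_real (gauss \<sigma> \<xi>) * inverse (ft \<phi> \<xi>)" for \<xi>
  define D where "D \<xi> = (if \<xi> = 0 then 0 else
     complex_of_real (gauss \<sigma> \<xi>) * (ft_deriv \<xi> * - (inverse (ft \<phi> \<xi>) ^ Suc (Suc 0))) +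
     complex_of_real (- (4 * (pi * \<sigma>)\<^sup>2 * \<xi>) * gauss \<sigma> \<xi>) * inverse (ft \<phi> \<xi>))" for \<xi>
  define h where "h \<xi> = exp (2 * pi * \<bar>\<xi>\<bar>)" for \<xi>
  \<comment> \<open>The three summands come from the quotient itself, the derivative of the Gaussian
    and the derivative of the reciprocal.\<close>
  define N where "N = 1 / A + 4 * (pi * \<sigma>)\<^sup>2 / A + C / A\<^sup>2"
  define M where "M = N * exp ((2 * pi + 2)\<^sup>2 / (8 * (pi * \<sigma>)\<^sup>2))"
  have h0: "h \<xi> > 0" for \<xi> by (simp add: h_def)
  have N0: "N \<ge> 0" using A C_nonneg by (simp add: N_def)
  have inv: "norm (inverse (ft \<phi> \<xi>)) \<le> h \<xi> / A" for \<xi>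
  proof -
    have "inverse (norm (ft \<phi> \<xi>)) \<le> inverse (A * exp (- (2 * pi * \<bar>\<xi>\<bar>)))"
      using A lower[of \<xi>] by (intro le_imp_inverse_le) auto
    also have "\<dots> = h \<xi> / A" by (simp add: h_def exp_minus divide_inverse mult.commute)
    finally show ?thesis by (simp only: norm_inverse)
  qed
  have gh: "k * (gauss \<sigma> \<xi> * h \<xi>) \<le> M * exp (- \<bar>\<xi>\<bar>)" if "k \<le> N * exp \<bar>\<xi>\<bar>" for k \<xi>
  proof -
    have gp: "gauss \<sigma> \<xi> * h \<xi> \<ge> 0" using gauss_bounds(1)[of \<sigma> \<xi>] h0[of \<xi>] by simp
    have "k * (gauss \<sigma> \<xi> * h \<xi>) \<le> N * exp \<bar>\<xi>\<bar> * (gauss \<sigma> \<xi> * h \<xi>)"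
      by (rule mult_right_mono[OF that gp])
    also have "\<dots> = N * (gauss \<sigma> \<xi> * exp ((2 * pi + 1) * \<bar>\<xi>\<bar>))" by (simp add: h_def distrib_right exp_add)
    also have "\<dots> \<le> N * (exp ((2 * pi + 2)\<^sup>2 / (8 * (pi * \<sigma>)\<^sup>2)) * exp (- \<bar>\<xi>\<bar>))"
      by (intro mult_left_mono gauss_exp_bound \<sigma> N0)
    finally show ?thesis by (simp add: M_def)
  qed
  have ub: "norm (u \<xi>) \<le> M * exp (- \<bar>\<xi>\<bar>)" for \<xi>
  proof -
    have "norm (u \<xi>) \<le> gauss \<sigma> \<xi> * (h \<xi> / A)"
      unfolding u_def norm_mult using gauss_bounds(1)[of \<sigma> \<xi>] by (intro mult_mono inv) auto
    also have "\<dots> = 1 / A * (gauss \<sigma> \<xi> * h \<xi>)" by simp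
    also have "\<dots> \<le> M * exp (- \<bar>\<xi>\<bar>)"
    proof (rule gh)
      have "1 / A \<le> N" using A C_nonneg by (simp add: N_def)
      also have "N \<le> N * exp \<bar>\<xi>\<bar>" using N0 by (simp add: mult_le_cancel_left1)
      finally show "1 / A \<le> N * exp \<bar>\<xi>\<bar>" .
    qed
    finally show ?thesis .
  qed
  have Db: "norm (D \<xi>) \<le> M * exp (- \<bar>\<xi>\<bar>)" for \<xi>
  proof (cases "\<xi> = 0")
    case True
    then show ?thesis using N0 by (simp add: D_def M_def)
  next
    case False
    have 1: "norm (complex_of_real (gauss \<sigma> \<xi>) * (ft_deriv \<xi> * - (inverse (ft \<phi> \<xi>) ^ Suc (Suc 0)))) \<le> C / A\<^sup>2 * (gauss \<sigma> \<xi> * h \<xi>)"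
    proof -
      have "norm (complex_of_real (gauss \<sigma> \<xi>) * (ft_deriv \<xi> * - (inverse (ft \<phi> \<xi>) ^ Suc (Suc 0))))
        = gauss \<sigma> \<xi> * (norm (ft_deriv \<xi>) * (norm (inverse (ft \<phi> \<xi>)))\<^sup>2)"
        using gauss_bounds(1)[of \<sigma> \<xi>] by (simp add: norm_mult norm_power numeral_2_eq_2 del: power_Suc)
      also have "\<dots> \<le> gauss \<sigma> \<xi> * (C * exp (- (2 * pi * \<bar>\<xi>\<bar>)) * (h \<xi> / A)\<^sup>2)"
        using gauss_bounds(1)[of \<sigma> \<xi>] C_nonneg
        by (intro mult_left_mono mult_mono ft_deriv_le power_mono inv) auto
      also have "\<dots> = C / A\<^sup>2 * (gauss \<sigma> \<xi> * h \<xi>)"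
        using h0[of \<xi>] by (simp add: h_def exp_minus power2_eq_square field_simps)
      finally show ?thesis .
    qed
    have 2: "norm (complex_of_real (- (4 * (pi * \<sigma>)\<^sup>2 * \<xi>) * gauss \<sigma> \<xi>) * inverse (ft \<phi> \<xi>)) \<le> 4 * (pi * \<sigma>)\<^sup>2 / A * \<bar>\<xi>\<bar> * (gauss \<sigma> \<xi> * h \<xi>)"
    proof -
      have "norm (complex_of_real (- (4 * (pi * \<sigma>)\<^sup>2 * \<xi>) * gauss \<sigma> \<xi>) * inverse (ft \<phi> \<xi>)) = (4 * (pi * \<sigma>)\<^sup>2 * \<bar>\<xi>\<bar> * gauss \<sigma> \<xi>) * norm (inverse (ft \<phi> \<xi>))"
        using gauss_bounds(1)[of \<sigma> \<xi>] unfolding norm_mult norm_of_real by (simp add: abs_mult)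
      also have "\<dots> \<le> (4 * (pi * \<sigma>)\<^sup>2 * \<bar>\<xi>\<bar> * gauss \<sigma> \<xi>) * (h \<xi> / A)"
        using gauss_bounds(1)[of \<sigma> \<xi>] by (intro mult_left_mono inv) auto
      finally show ?thesis by (simp add: mult_ac)
    qed
    have "norm (D \<xi>) \<le> C / A\<^sup>2 * (gauss \<sigma> \<xi> * h \<xi>) + 4 * (pi * \<sigma>)\<^sup>2 / A * \<bar>\<xi>\<bar> * (gauss \<sigma> \<xi> * h \<xi>)"
      unfolding D_def using False by (simp only: if_False) (rule order_trans[OF norm_triangle_ineq add_mono[OF 1 2]])
    also have "\<dots> = (C / A\<^sup>2 + 4 * (pi * \<sigma>)\<^sup>2 / A * \<bar>\<xi>\<bar>) * (gauss \<sigma> \<xi> * h \<xi>)" by (rule distrib_right[symmetric])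
    also have "\<dots> \<le> M * exp (- \<bar>\<xi>\<bar>)"
    proof (rule gh)
      have "\<bar>\<xi>\<bar> \<le> exp \<bar>\<xi>\<bar>" using exp_ge_add_one_self[of "\<bar>\<xi>\<bar>"] by linarith
      then have "4 * (pi * \<sigma>)\<^sup>2 / A * \<bar>\<xi>\<bar> \<le> 4 * (pi * \<sigma>)\<^sup>2 / A * exp \<bar>\<xi>\<bar>" using A by (intro mult_left_mono) auto
      moreover have "C / A\<^sup>2 * 1 \<le> C / A\<^sup>2 * exp \<bar>\<xi>\<bar>" using C_nonneg by (intro mult_left_mono) auto
      moreover have "0 \<le> 1 / A * exp \<bar>\<xi>\<bar>" using A by simp
      ultimately show "C / A\<^sup>2 + 4 * (pi * \<sigma>)\<^sup>2 / A * \<bar>\<xi>\<bar> \<le> N * exp \<bar>\<xi>\<bar>"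
        unfolding N_def distrib_right by linarith
    qed
    finally show ?thesis .
  qed
  interpret u: sobolev_function u D M "\<lambda>\<xi>. 2 * M\<^sup>2 * exp (- (2 * \<bar>\<xi>\<bar>))"
  proof
    show "continuous_on UNIV u"
    proof -
      have "continuous_on UNIV (\<lambda>\<xi>. complex_of_real (gauss \<sigma> \<xi>))"
        unfolding gauss_def by (intro continuous_intros)
      then show ?thesis unfolding u_def
        using continuous_on_ft[OF \<phi>] ft_nonzero by (intro continuous_on_mult continuous_on_inverse) auto
    qed
    show "(u has_vector_derivative D \<xi>) (at \<xi>)" if "\<xi> \<noteq> 0" for \<xi>
    proof -
      have "((inverse \<circ> ft \<phi>) has_vector_derivative ft_deriv \<xi> * - (inverse (ft \<phi> \<xi>) ^ Suc (Suc 0))) (at \<xi>)"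
        by (rule field_vector_diff_chain_at[OF ft_deriv(1)[OF that] DERIV_inverse[OF ft_nonzero]])
      then have "((\<lambda>\<xi>. inverse (ft \<phi> \<xi>)) has_vector_derivative ft_deriv \<xi> * - (inverse (ft \<phi> \<xi>) ^ Suc (Suc 0))) (at \<xi>)"
        by (simp only: o_def)
      from has_vector_derivative_mult[OF gauss_has_vector_derivative this]
      show ?thesis using that unfolding u_def D_def by (simp only: if_False)
    qed
    show "D 0 = 0" by (simp add: D_def)
    show "integrable lborel (\<lambda>\<xi>. 2 * M\<^sup>2 * exp (- (2 * \<bar>\<xi>\<bar>)))"
      using integrable_exp_neg_abs[of 2] by simp
    show "(norm (u \<xi>))\<^sup>2 + (norm (D \<xi>))\<^sup>2 \<le> 2 * M\<^sup>2 * exp (- (2 * \<bar>\<xi>\<bar>))" for \<xi>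
    proof -
      have "(norm (u \<xi>))\<^sup>2 \<le> (M * exp (- \<bar>\<xi>\<bar>))\<^sup>2" "(norm (D \<xi>))\<^sup>2 \<le> (M * exp (- \<bar>\<xi>\<bar>))\<^sup>2"
        by (intro power_mono ub Db norm_ge_zero)+
      moreover have "(M * exp (- \<bar>\<xi>\<bar>))\<^sup>2 = M\<^sup>2 * exp (- (2 * \<bar>\<xi>\<bar>))"
        by (simp add: power_mult_distrib power2_eq_square flip: exp_add)
      ultimately show ?thesis by linarith
    qed
  qed (use ub Db in auto)
  \<comment> \<open>The reflection turns a second application of the transform into inversion, so
    that \<open>ft g\<close> is \<open>u\<close> almost everywhere.\<close>
  define g where "g t = ft u (- t)" for t
  have gi: "integrable lborel g" unfolding g_def by (intro integrable_reflect u.ft_integrable_bound(1))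
  have ftg: "AE \<xi> in lborel. u \<xi> = ft g \<xi>"
    using ft_inversion_AE[OF u.v_integrable u.ft_integrable_bound(1)]
  proof eventually_elim
    case (elim \<xi>)
    have "ft g \<xi> = (\<integral>t. (\<lambda>s. ft u s * cis (- (2 * pi * s * (- \<xi>)))) (- t) \<partial>lborel)"
      by (simp add: ft_def[of g] g_def)
    also have "\<dots> = ft (ft u) (- \<xi>)" unfolding ft_def[of "ft u"] by (rule integral_reflect)
    finally show ?case using elim by simp
  qed
  have "(\<integral>x. g x * \<phi> (t - x) \<partial>lborel) = complex_of_real (normal_density 0 \<sigma> t)" for t
  proof -
    \<comment> \<open>The transform of \<open>q\<close> at x is \<phi>(t - x) for almost every x.
      The multiplication formula then replaces the convolution by the integral of u q, where
      \<open>ft \<phi>\<close> cancels and a Gaussian remains; exceptions in x are null, so the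
      result holds for every t.\<close>
    define q where "q \<xi> = ft \<phi> \<xi> * cis (2 * pi * \<xi> * t)" for \<xi>
    have qi: "integrable lborel q" unfolding q_def by (rule integrable_mult_unimodular[OF ft_integrable]) auto
    have [measurable]: "\<phi> \<in> borel_measurable borel" "g \<in> borel_measurable borel" "q \<in> borel_measurable borel" "u \<in> borel_measurable borel"
      using borel_measurable_integrable[OF \<phi>] borel_measurable_integrable[OF gi] borel_measurable_integrable[OF qi] by auto
    have ftq: "ft q x = ft (ft \<phi>) (- (t + - 1 * x))" for x
      unfolding q_def ft_modulation by simp
    have "(\<integral>x. g x * \<phi> (t - x) \<partial>lborel) = (\<integral>x. g x * ft q x \<partial>lborel)"
    proof (rule integral_cong_AE)
      show "AE x in lborel. g x * \<phi> (t - x) = g x * ft q x"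
      proof -
        have "AE x in lborel. \<phi> (t + - 1 * x) = ft (ft \<phi>) (- (t + - 1 * x))" by (rule inversion_affine) simp
        then show ?thesis by eventually_elim (simp add: ftq)
      qed
    qed measurable
    also have "\<dots> = (\<integral>\<xi>. ft g \<xi> * q \<xi> \<partial>lborel)" by (rule ft_multiplication[OF gi qi, symmetric])
    also have "\<dots> = (\<integral>\<xi>. u \<xi> * q \<xi> \<partial>lborel)"
      by (rule integral_cong_AE) (use ftg in \<open>auto\<close>)
    also have "\<dots> = (\<integral>\<xi>. complex_of_real (gauss \<sigma> \<xi>) * cis (- (2 * pi * \<xi> * (- t))) \<partial>lborel)"
      using ft_nonzero by (intro Bochner_Integration.integral_cong refl) (simp add: u_def q_def)
    also have "\<dots> = complex_of_real (normal_density 0 \<sigma> (- t))"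
      unfolding ft_gauss[OF \<sigma>, symmetric] ft_def ..
    finally show ?thesis by (simp add: normal_density_def)
  qed
  then show ?thesis using gi by blast
qed

text \<open>The L1 bound is (s I + K form / s) / 2. With the form at most delta^2 and s = delta both
  terms are of order delta.\<close>

lemma spanned_translate:
  assumes disc: "discrete_set \<Lambda>" and ns: "\<not> (\<lambda>l. exp (- (pi / 2) * \<bar>l\<bar>)) summable_on \<Lambda>"
  shows "spanned \<Lambda> (\<lambda>t. \<phi> (t - x))"
  unfolding spanned_def
proof (intro allI impI)
  fix e :: real assume e: "e > 0"
  define I where "I = (\<integral>t. 1 / (1 + (t::real)\<^sup>2) \<partial>lborel)"
  define K where "K = 2 * B\<^sup>2 + 2 * C\<^sup>2"
  have I0: "I \<ge> 0" unfolding I_def by (rule Bochner_Integration.integral_nonneg) auto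
  have K0: "K \<ge> 0" by (simp add: K_def)
  define \<delta> where "\<delta> = e / (I + K + 1)"
  have IK: "I + K + 1 > 0" using I0 K0 by simp
  have \<delta>: "\<delta> > 0" using e IK by (simp add: \<delta>_def)
  then obtain F r where F: "finite F" "F \<subseteq> \<Lambda> - {x}" and r: "r x = 1" "Re (sob_form (insert x F) r r) \<le> \<delta>\<^sup>2"
    using sob_distance_small[OF disc ns, of "\<delta>\<^sup>2" x] by auto
  have xF: "x \<notin> F" using F by auto
  have "(\<integral>t. norm (\<phi> (t - x) - (\<Sum>l\<in>F. - r l * \<phi> (t - l))) \<partial>lborel) = (\<integral>t. norm (\<Sum>l\<in>insert x F. r l * \<phi> (t - l)) \<partial>lborel)"
    using F(1) xF r(1) by (simp add: sum_negf)
  also have "\<dots> \<le> (\<delta> * I + K * Re (sob_form (insert x F) r r) / \<delta>) / 2"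
    unfolding I_def K_def by (rule translates_L1_bound) (use F \<delta> in auto)
  also have "\<dots> \<le> (\<delta> * I + K * \<delta>\<^sup>2 / \<delta>) / 2"
    using r(2) K0 \<delta> by (intro divide_right_mono add_left_mono mult_left_mono) auto
  also have "\<dots> = \<delta> * (I + K) / 2" using \<delta> by (simp add: power2_eq_square algebra_simps)
  also have "\<dots> < e"
  proof -
    have "\<delta> * (I + K) \<le> \<delta> * (I + K + 1)" using \<delta> by (intro mult_left_mono) auto
    also have "\<dots> = e" using IK by (simp add: \<delta>_def)
    finally show ?thesis using e by linarith
  qed
  finally show "\<exists>F c. finite F \<and> F \<subseteq> \<Lambda> \<and> (\<integral>t. norm (\<phi> (t - x) - (\<Sum>l\<in>F. c l * \<phi> (t - l))) \<partial>lborel) < e"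
    using F by (intro exI[of _ F] exI[of _ "\<lambda>l. - r l"]) auto
qed

text \<open>From translates of \<phi> to translates of normal densities by one convolution, from
  these to the Gaussian means of f by a second, and to f in the limit.\<close>

lemma spanned_all:
  assumes disc: "discrete_set \<Lambda>" and ns: "\<not> (\<lambda>l. exp (- (pi / 2) * \<bar>l\<bar>)) summable_on \<Lambda>"
    and f: "integrable lborel f"
  shows "spanned \<Lambda> f"
proof -
  have density: "spanned \<Lambda> (\<lambda>t. complex_of_real (normal_density 0 \<sigma> (t - y)))" if \<sigma>: "\<sigma> > 0" for \<sigma> y
  proof -
    obtain g where g: "integrable lborel g" "\<And>t. (\<integral>x. g x * \<phi> (t - x) \<partial>lborel) = complex_of_real (normal_density 0 \<sigma> t)"
      using normal_density_as_convolution[OF \<sigma>] by blast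
    have "spanned \<Lambda> (\<lambda>t. \<integral>x. g (x - y) * \<phi> (t - x) \<partial>lborel)"
      by (intro spanned_convolution \<phi> spanned_translate disc ns integrable_shift g)
    moreover have "(\<integral>x. g (x - y) * \<phi> (t - x) \<partial>lborel) = complex_of_real (normal_density 0 \<sigma> (t - y))" for t
    proof -
      have "(\<integral>x. g (x - y) * \<phi> (t - x) \<partial>lborel) = (\<integral>x. (\<lambda>s. g s * \<phi> (t - y - s)) (x - y) \<partial>lborel)" by simp
      also have "\<dots> = (\<integral>s. g s * \<phi> (t - y - s) \<partial>lborel)" by (rule integral_shift)
      finally show ?thesis using g(2) by simp
    qed
    ultimately show ?thesis by simp
  qed
  have gc: "spanned \<Lambda> (gconv \<sigma> f)" if \<sigma>: "\<sigma> > 0" for \<sigma>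
  proof -
    show ?thesis
      unfolding gconv_def[abs_def] using integrable_normal_density[OF \<sigma>, of 0]
      by (intro spanned_convolution[where \<psi> = "\<lambda>t. complex_of_real (normal_density 0 \<sigma> t)"] density \<sigma> f) auto
  qed
  show ?thesis
  proof (rule spanned_closed[OF f])
    fix e :: real assume "e > 0"
    then have "\<forall>\<^sub>F n in sequentially. (\<integral>t. norm (f t - gconv (1 / real (Suc n)) f t) \<partial>lborel) < e"
      by (rule order_tendstoD(2)[OF gconv_tendsto_L1[OF f]])
    then obtain n where "(\<integral>t. norm (f t - gconv (1 / real (Suc n)) f t) \<partial>lborel) < e"
      using eventually_happens'[OF trivial_limit_sequentially] by blast
    moreover have "1 / real (Suc n) > 0" by simp
    ultimately show "\<exists>g. integrable lborel g \<and> spanned \<Lambda> g \<and> (\<integral>t. norm (f t - g t) \<partial>lborel) < e"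
      using gc gconv_integrable[OF f] by blast
  qed
qed

end

section \<open>Passage from Lebesgue measurable functions to Borel representatives\<close>

lemma lebesgue_integrable_borel_representative:
  fixes f :: "real \<Rightarrow> complex"
  assumes f: "integrable lebesgue f"
  obtains g where "integrable lborel g" "AE t in lborel. f t = g t"
proof -
  have fm: "f \<in> borel_measurable lebesgue" using f by (rule borel_measurable_integrable)
  have "(\<lambda>t. Re (f t)) \<in> borel_measurable lebesgue" "(\<lambda>t. Im (f t)) \<in> borel_measurable lebesgue"
    using fm by measurable
  then obtain a b where [measurable]: "a \<in> borel_measurable lborel" "b \<in> borel_measurable lborel"
    and ab: "AE t in lborel. Re (f t) = a t" "AE t in lborel. Im (f t) = b t"
    using completion_ex_borel_measurable_real by metis
  define g where "g t = complex_of_real (a t) + \<i> * complex_of_real (b t)" for t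
  have gm: "g \<in> borel_measurable lborel" unfolding g_def by measurable
  have ae: "AE t in lborel. f t = g t"
    using ab by eventually_elim (simp add: g_def complex_eq_iff)
  have "integrable lebesgue g"
    using f by (rule integrable_cong_AE_imp) (use gm AE_completion[OF ae] in \<open>auto intro: measurable_completion\<close>)
  then have "integrable lborel g" using gm by (simp add: integrable_completion)
  then show thesis using ae by (rule that)
qed

text \<open>Completeness of Lebesgue measure makes f measurable from its agreement almost everywhere
  with a Borel function.\<close>

lemma lebesgue_integral_eq_lborel:
  fixes f g :: "real \<Rightarrow> 'a::euclidean_space"
  assumes g: "g \<in> borel_measurable borel" and ae: "AE t in lborel. f t = g t"
  shows "(LINT t|lebesgue. f t) = (\<integral>t. g t \<partial>lborel)"
proof -
  have gl: "g \<in> borel_measurable lebesgue" using g by (intro measurable_completion) simp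
  have ae': "AE t in lebesgue. g t = f t" using AE_completion[OF ae] by auto
  have "f \<in> borel_measurable lebesgue" by (rule borel_measurable_AE[OF gl ae'])
  then have "(LINT t|lebesgue. f t) = (LINT t|lebesgue. g t)"
    using gl ae' by (intro integral_cong_AE) auto
  also have "\<dots> = (\<integral>t. g t \<partial>lborel)" using g by (intro integral_completion) simp
  finally show ?thesis .
qed

text \<open>The exceptional set of P need not be Borel, so it is first covered by a Borel null set,
  which is then shifted.\<close>

lemma AE_lborel_shift:
  assumes "AE t in lborel. P t"
  shows "AE t in lborel. P (t - l :: real)"
proof -
  obtain N where N: "{t \<in> space lborel. \<not> P t} \<subseteq> N" "N \<in> null_sets lborel"
    using assms by (auto elim!: AE_E simp: null_sets_def)
  have [measurable]: "N \<in> sets borel" using N(2) by (auto simp: null_sets_def)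
  have "AE t in lborel. t \<notin> N" using N(2) by (rule AE_not_in)
  then have "AE t in lborel. - l + 1 * t \<notin> N" by (intro AE_borel_affine) auto
  then show ?thesis by eventually_elim (use N(1) in auto)
qed

lemma fourier_transform_eq_ft:
  assumes "integrable lborel g" and ae: "AE t in lborel. \<phi> t = g t"
  shows "fourier_transform \<phi> \<xi> = ft g \<xi>"
  unfolding fourier_transform_def ft_def
proof (rule lebesgue_integral_eq_lborel)
  show "(\<lambda>t. g t * cis (- (2 * pi * t * \<xi>))) \<in> borel_measurable borel"
    using borel_measurable_integrable[OF assms(1)] by simp
  show "AE t in lborel. \<phi> t * exp (- (2 * complex_of_real pi * \<i> * complex_of_real (t * \<xi>))) = g t * cis (- (2 * pi * t * \<xi>))"
    using ae by eventually_elim (simp add: cis_conv_exp mult_ac)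
qed

lemma translates_error_eq:
  fixes f f0 \<phi> \<phi>0 :: "real \<Rightarrow> complex"
  assumes \<phi>: "integrable lborel \<phi>0" "AE t in lborel. \<phi> t = \<phi>0 t" and f: "integrable lborel f0" "AE t in lborel. f t = f0 t"
    and F: "finite F"
  shows "(LINT t|lebesgue. norm (f t - (\<Sum>l\<in>F. c l * \<phi> (t - l)))) = (\<integral>t. norm (f0 t - (\<Sum>l\<in>F. c l * \<phi>0 (t - l))) \<partial>lborel)"
proof (rule lebesgue_integral_eq_lborel)
  have [measurable]: "\<phi>0 \<in> borel_measurable borel" "f0 \<in> borel_measurable borel"
    using borel_measurable_integrable[OF \<phi>(1)] borel_measurable_integrable[OF f(1)] by auto
  show "(\<lambda>t. norm (f0 t - (\<Sum>l\<in>F. c l * \<phi>0 (t - l)))) \<in> borel_measurable borel" by measurable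
  have "AE t in lborel. \<forall>l\<in>F. \<phi> (t - l) = \<phi>0 (t - l)"
    by (intro AE_finite_allI F AE_lborel_shift \<phi>(2))
  then show "AE t in lborel. norm (f t - (\<Sum>l\<in>F. c l * \<phi> (t - l))) = norm (f0 t - (\<Sum>l\<in>F. c l * \<phi>0 (t - l)))"
    using f(2) by eventually_elim simp
qed

section \<open>A translate outside the closed span when the series converges\<close>

context poisson_type
begin

text \<open>A small L1 error has a small transform, and dividing by the lower bound for
  \<open>ft \<phi>\<close> gives the growth hypothesis of \<open>strip_extremal_bound\<close>. The
  lower bound c on the products and the constant W (which includes the weight of the pole x) are
  fixed before F, so \<eta> can be chosen to contradict the extremal bound.\<close>

lemma not_spanned_translate:
  assumes disc: "discrete_set \<Lambda>" and sm: "(\<lambda>l. exp (- (pi / 2) * \<bar>l\<bar>)) summable_on \<Lambda>" and x: "x \<notin> \<Lambda>"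
  shows "\<not> spanned \<Lambda> (\<lambda>t. \<phi> (t - x))"
proof
  assume sp: "spanned \<Lambda> (\<lambda>t. \<phi> (t - x))"
  define w where "w l = exp (- (pi / 2) * \<bar>l\<bar>)" for l
  define W where "W = infsum w \<Lambda> + w x"
  obtain c where c: "c > 0" "\<And>F. finite F \<Longrightarrow> F \<subseteq> \<Lambda> \<Longrightarrow> c \<le> (\<Prod>l\<in>F. norm (strip_factor l (complex_of_real x)))"
    using strip_factor_prod_lower_bound[OF disc x sm] by blast
  define m where "m = pi / 4 * c * exp (- x\<^sup>2)"
  define L where "L = 4 * exp (3 + pi * W)"
  have m: "m > 0" and L: "L > 0" using c(1) by (auto simp: m_def L_def)
  \<comment> \<open>Half of the critical ratio m / L, so that m <= L \<eta> fails.\<close>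
  define \<eta> where "\<eta> = m / (2 * L)"
  have \<eta>: "\<eta> > 0" using m L by (simp add: \<eta>_def)
  then have "\<eta> * A > 0" using A by simp
  then obtain F b where F: "finite F" "F \<subseteq> \<Lambda>" and err: "(\<integral>t. norm (\<phi> (t - x) - (\<Sum>l\<in>F. b l * \<phi> (t - l))) \<partial>lborel) < \<eta> * A"
    using sp unfolding spanned_def by blast
  have xF: "x \<notin> F" using F x by auto
  define \<mu> where "\<mu> l = (if l = x then 1 else - b l)" for l
  have E: "norm (\<Sum>l\<in>insert x F. \<mu> l * cis (- (2 * pi * l * \<xi>))) \<le> \<eta> * exp (2 * pi * \<bar>\<xi>\<bar>)" for \<xi>
  proof -
    define f where "f t = (\<Sum>l\<in>insert x F. \<mu> l * \<phi> (t - l))" for t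
    have feq: "f t = \<phi> (t - x) - (\<Sum>l\<in>F. b l * \<phi> (t - l))" for t
    proof -
      have "(\<Sum>l\<in>F. \<mu> l * \<phi> (t - l)) = (\<Sum>l\<in>F. - (b l * \<phi> (t - l)))"
        using xF by (intro sum.cong refl) (auto simp: \<mu>_def)
      then show ?thesis using F(1) xF by (simp add: f_def \<mu>_def sum_negf)
    qed
    have fi: "integrable lborel f" unfolding f_def by (rule integrable_sum_translates)
    have "ft f \<xi> = (\<Sum>l\<in>insert x F. \<mu> l * ft (\<lambda>t. \<phi> (t - l)) \<xi>)"
    proof -
      have i: "integrable lborel (\<lambda>t. \<mu> l * (\<phi> (t - l) * cis (- (2 * pi * t * \<xi>))))" for l
        by (intro integrable_mult_right integrable_ft_integrand integrable_shift \<phi>)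
      have "ft f \<xi> = (\<integral>t. (\<Sum>l\<in>insert x F. \<mu> l * (\<phi> (t - l) * cis (- (2 * pi * t * \<xi>)))) \<partial>lborel)"
        unfolding ft_def f_def sum_distrib_right mult.assoc ..
      also have "\<dots> = (\<Sum>l\<in>insert x F. (\<integral>t. \<mu> l * (\<phi> (t - l) * cis (- (2 * pi * t * \<xi>))) \<partial>lborel))"
        by (rule Bochner_Integration.integral_sum[OF i])
      finally show ?thesis by (simp only: ft_def integral_mult_right_zero)
    qed
    also have "\<dots> = (\<Sum>l\<in>insert x F. \<mu> l * cis (- (2 * pi * l * \<xi>))) * ft \<phi> \<xi>"
      unfolding ft_translation sum_distrib_right by (simp only: mult.assoc)
    finally have "norm (\<Sum>l\<in>insert x F. \<mu> l * cis (- (2 * pi * l * \<xi>))) * norm (ft \<phi> \<xi>) = norm (ft f \<xi>)"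
      by (simp only: norm_mult)
    also have "\<dots> \<le> (\<integral>t. norm (f t) \<partial>lborel)" by (rule norm_ft_le[OF fi])
    also have "\<dots> \<le> \<eta> * A" using err by (simp add: feq)
    finally have 1: "norm (\<Sum>l\<in>insert x F. \<mu> l * cis (- (2 * pi * l * \<xi>))) * norm (ft \<phi> \<xi>) \<le> \<eta> * A" .
    have "norm (\<Sum>l\<in>insert x F. \<mu> l * cis (- (2 * pi * l * \<xi>))) * (A * exp (- (2 * pi * \<bar>\<xi>\<bar>))) \<le> \<eta> * A"
      by (rule order_trans[OF mult_left_mono[OF lower] 1]) simp
    then have "(norm (\<Sum>l\<in>insert x F. \<mu> l * cis (- (2 * pi * l * \<xi>))) * exp (- (2 * pi * \<bar>\<xi>\<bar>))) * A \<le> \<eta> * A"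
      by (simp only: mult_ac)
    then have "norm (\<Sum>l\<in>insert x F. \<mu> l * cis (- (2 * pi * l * \<xi>))) * exp (- (2 * pi * \<bar>\<xi>\<bar>)) \<le> \<eta>"
      using A by (rule mult_right_le_imp_le)
    then show ?thesis by (simp only: exp_minus divide_inverse[symmetric] pos_divide_le_eq exp_gt_zero)
  qed
  have "(\<Sum>l\<in>insert x F. w l) \<le> W"
  proof -
    have "w summable_on \<Lambda>" using sm unfolding w_def[abs_def] .
    then have "sum w F \<le> infsum w \<Lambda>" using F by (intro finite_sum_le_infsum) (auto simp: w_def)
    then show ?thesis using F(1) xF by (simp add: W_def)
  qed
  then have "pi / 4 * (\<Prod>l\<in>insert x F - {x}. norm (strip_factor l (complex_of_real x))) * exp (- x\<^sup>2) \<le> L * \<eta>"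
    unfolding L_def w_def
    by (intro strip_extremal_bound[where \<mu> = \<mu>] \<eta> E) (use F in \<open>auto simp: \<mu>_def\<close>)
  moreover have "insert x F - {x} = F" using xF by auto
  moreover have "m \<le> pi / 4 * (\<Prod>l\<in>F. norm (strip_factor l (complex_of_real x))) * exp (- x\<^sup>2)"
    unfolding m_def using c(2)[OF F] by (intro mult_right_mono mult_left_mono) auto
  ultimately have "m \<le> L * \<eta>" by simp
  also have "\<dots> = m / 2" using L by (simp add: \<eta>_def)
  finally show False using m by simp
qed

end

text \<open>For nonnegative terms, failure of \<open>summable_on\<close> is exactly an infinite sum.
  The derivative bound is imposed away from 0 so that the Poisson kernel, whose transform has a
  corner there, is included.\<close>

theorem theorem1p2:
  fixes \<phi> :: "real \<Rightarrow> complex" and \<Lambda> :: "real set" and A B :: real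
  assumes "integrable lebesgue \<phi>"
    and "\<forall>\<xi>. fourier_transform \<phi> \<xi> \<noteq> 0"
    and "A > 0" and "B > 0"
    and "\<forall>\<xi>. A * exp (- 2 * pi * \<bar>\<xi>\<bar>) \<le> norm (fourier_transform \<phi> \<xi>)
              \<and> norm (fourier_transform \<phi> \<xi>) \<le> B * exp (- 2 * pi * \<bar>\<xi>\<bar>)"
    and "\<exists>C. \<forall>\<xi>. \<xi> \<noteq> 0 \<longrightarrow>
           (\<exists>D. (fourier_transform \<phi> has_vector_derivative D) (at \<xi>)
                 \<and> norm D \<le> C * exp (- 2 * pi * \<bar>\<xi>\<bar>))"
    and "discrete_set \<Lambda>"
  shows "translates_span_L1 \<phi> \<Lambda> \<longleftrightarrow>
         \<not> ((\<lambda>l. exp (- (pi / 2) * \<bar>l\<bar>)) summable_on \<Lambda>)"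
proof -
  obtain \<phi>0 where \<phi>0: "integrable lborel \<phi>0" "AE t in lborel. \<phi> t = \<phi>0 t"
    using lebesgue_integrable_borel_representative[OF assms(1)] .
  have FT: "fourier_transform \<phi> = ft \<phi>0"
    using fourier_transform_eq_ft[OF \<phi>0] by (intro ext)
  obtain C where C: "\<And>\<xi>. \<xi> \<noteq> 0 \<Longrightarrow> \<exists>D. (ft \<phi>0 has_vector_derivative D) (at \<xi>) \<and> norm D \<le> C * exp (- 2 * pi * \<bar>\<xi>\<bar>)"
    using assms(6) unfolding FT by blast
  interpret poisson_type \<phi>0 A B C
    by unfold_locales (use \<phi>0 assms(3,5) C in \<open>auto simp: FT\<close>)
  have span_iff: "translates_span_L1 \<phi> \<Lambda> \<longleftrightarrow> (\<forall>f. integrable lborel f \<longrightarrow> spanned \<Lambda> f)"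
  proof (intro iffI allI impI)
    fix f :: "real \<Rightarrow> complex" assume L: "translates_span_L1 \<phi> \<Lambda>" and f: "integrable lborel f"
    have fl: "integrable lebesgue f"
      using f by (subst integrable_completion) (rule borel_measurable_integrable)
    show "spanned \<Lambda> f"
      unfolding spanned_def
    proof (intro allI impI)
      fix e :: real assume e: "e > 0"
      obtain F c where F: "finite F" "F \<subseteq> \<Lambda>" "(LINT t|lebesgue. norm (f t - (\<Sum>l\<in>F. c l * \<phi> (t - l)))) < e"
        using L[unfolded translates_span_L1_def, rule_format, OF fl e] by (elim exE conjE)
      have "(\<integral>t. norm (f t - (\<Sum>l\<in>F. c l * \<phi>0 (t - l))) \<partial>lborel) < e"
        using F(3) unfolding translates_error_eq[OF \<phi>0 f AE_I2[OF refl] F(1)] .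
      then show "\<exists>F c. finite F \<and> F \<subseteq> \<Lambda> \<and> (\<integral>t. norm (f t - (\<Sum>l\<in>F. c l * \<phi>0 (t - l))) \<partial>lborel) < e"
        using F(1,2) by (intro exI[of _ F] exI[of _ c] conjI)
    qed
  next
    assume R: "\<forall>f. integrable lborel f \<longrightarrow> spanned \<Lambda> f"
    show "translates_span_L1 \<phi> \<Lambda>"
      unfolding translates_span_L1_def
    proof (intro allI impI)
      fix f :: "real \<Rightarrow> complex" and e :: real assume fi: "integrable lebesgue f" and e: "e > 0"
      obtain f0 where f0: "integrable lborel f0" "AE t in lborel. f t = f0 t"
        using lebesgue_integrable_borel_representative[OF fi] .
      obtain F c where F: "finite F" "F \<subseteq> \<Lambda>" "(\<integral>t. norm (f0 t - (\<Sum>l\<in>F. c l * \<phi>0 (t - l))) \<partial>lborel) < e"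
        using R[rule_format, OF f0(1), unfolded spanned_def, rule_format, OF e] by (elim exE conjE)
      have "(LINT t|lebesgue. norm (f t - (\<Sum>l\<in>F. c l * \<phi> (t - l)))) < e"
        unfolding translates_error_eq[OF \<phi>0 f0 F(1)] by (rule F(3))
      then show "\<exists>F c. finite F \<and> F \<subseteq> \<Lambda> \<and> (LINT t|lebesgue. norm (f t - (\<Sum>l\<in>F. c l * \<phi> (t - l)))) < e"
        using F(1,2) by (intro exI[of _ F] exI[of _ c] conjI)
    qed
  qed
  show ?thesis
  proof
    assume span: "translates_span_L1 \<phi> \<Lambda>"
    \<comment> \<open>A set with finitely many points in [-1, 1] misses some x there; the translate
      by this x is the function that cannot be approximated.\<close>
    have "finite (\<Lambda> \<inter> {-1..1})" using assms(7) by (auto simp: discrete_set_def)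
    moreover have "infinite {-1..1::real}" by (simp add: infinite_Icc)
    ultimately have "\<not> {-1..1} \<subseteq> \<Lambda> \<inter> {-1..1}" using finite_subset by blast
    then obtain x where "x \<notin> \<Lambda>" by auto
    then show "\<not> (\<lambda>l. exp (- (pi / 2) * \<bar>l\<bar>)) summable_on \<Lambda>"
      using not_spanned_translate[OF assms(7)] span integrable_shift[OF \<phi>0(1)] unfolding span_iff by blast
  next
    assume "\<not> (\<lambda>l. exp (- (pi / 2) * \<bar>l\<bar>)) summable_on \<Lambda>"
    then show "translates_span_L1 \<phi> \<Lambda>"
      unfolding span_iff using spanned_all[OF assms(7)] by blast
  qed
qed

end
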